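(* Any Euclidean building $X$ of type $\tilde{B}_n$, $\tilde{C}_n$ or $\tilde{D}_n$, with the standard $\ell^\infty$ metric, is CUB.
   Context: Ordered simplicial structure. If $X$ is a Euclidean building of type $\tilde C_n$, it is an $n$-dimensional simplicial complex, each vertex has a type in $\{0,1,\dots,n\}$ (numbered linearly along the $\tilde C_n$ Coxeter diagram), and the vertices of each simplex have different types, hence are totally ordered by type. If $X$ is of type $\tilde B_n$ or $\tilde D_n$, one first subdivides each maximal simplex into $2$ simplices (type $\tilde B_n$) or $4$ simplices (type $\tilde D_n$) so that each apartment becomes the Coxeter complex of type $\tilde C_n$, which turns $X$ into a non-thick Euclidean building of type $\tilde C_n$. Concretely, in an apartment identified with $\mathbb{R}^n$ in which the walls are $\{x_i\pm x_j=k\}_{i<j,\,k\in\mathbb{Z}}$ (type $\tilde D_n$), together with $\{x_i=k\}_{k\in\mathbb{Z}}$ (type $\tilde B_n$), one subdivides along all hyperplanes $\{x_i=k/2\}_{k\in\mathbb{Z}}$; equivalently, one inserts the midpoint of each edge joining two vertices whose types are the two leaves of a fork of the Coxeter diagram. The simplices are then totally ordered by the types $0<1<\dots<n$ of type $\tilde C_n$. Standard $\ell^\infty$ metric. Identify each $d$-simplex with ordered vertices $v_0<\dots<v_d$ with the convex hull in $\mathbb{R}^d$ of $v_0=(0,\dots,0)$, $v_1=(1,0,\dots,0)$, $\dots$, $v_d=(1,\dots,1)$, with the norm $\|x\|_\infty=\max_i|x_i|$; the standard $\ell^\infty$ metric is the associated length metric. A convex bicombing on a geodesic metric space $X$ is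 a map $\sigma : X\times X\times[0,1]\to X$ such that: (1) for all $x,y$, $t\mapsto\sigma(x,y,t)$ is a constant speed reparametrized geodesic from $x$ to $y$; (2) $\sigma(x,y,t)=\sigma(y,x,1-t)$; (3) $\sigma(x,y,st)=\sigma(x,\sigma(x,y,t),s)$; (4) for all $x,y,x',y'$ the map $t\mapsto d(\sigma(x,y,t),\sigma(x',y',t))$ is convex. A metric space is CUB if it, and each of its balls (with the induced metric), admit a unique convex bicombing. *)

theory Defs
  imports "HOL-Analysis.Analysis"
begin

section \<open>Convex bicombings and CUB spaces\<close>

definition convex_bicombing :: "'a set \<Rightarrow> ('a \<Rightarrow> 'a \<Rightarrow> real) \<Rightarrow> ('a \<Rightarrow> 'a \<Rightarrow> real \<Rightarrow> 'a) \<Rightarrow> bool" where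
  "convex_bicombing M d \<sigma> \<longleftrightarrow>
     (\<forall>x\<in>M. \<forall>y\<in>M. \<forall>t\<in>{0..1}. \<sigma> x y t \<in> M) \<and>
     (\<forall>x\<in>M. \<forall>y\<in>M. \<sigma> x y 0 = x \<and> \<sigma> x y 1 = y \<and>
        (\<forall>s\<in>{0..1}. \<forall>t\<in>{0..1}. d (\<sigma> x y s) (\<sigma> x y t) = \<bar>s - t\<bar> * d x y)) \<and>
     (\<forall>x\<in>M. \<forall>y\<in>M. \<forall>t\<in>{0..1}. \<sigma> x y t = \<sigma> y x (1 - t)) \<and>
     (\<forall>x\<in>M. \<forall>y\<in>M. \<forall>s\<in>{0..1}. \<forall>t\<in>{0..1}. \<sigma> x y (s * t) = \<sigma> x (\<sigma> x y t) s) \<and>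
     (\<forall>x\<in>M. \<forall>y\<in>M. \<forall>x'\<in>M. \<forall>y'\<in>M. convex_on {0..1} (\<lambda>t. d (\<sigma> x y t) (\<sigma> x' y' t)))"

text \<open>A bicombing is a map on \<open>M \<times> M \<times> [0,1]\<close>, so uniqueness only concerns values there.\<close>

definition has_unique_convex_bicombing :: "'a set \<Rightarrow> ('a \<Rightarrow> 'a \<Rightarrow> real) \<Rightarrow> bool" where
  "has_unique_convex_bicombing M d \<longleftrightarrow>
     (\<exists>\<sigma>. convex_bicombing M d \<sigma>) \<and>
     (\<forall>\<sigma> \<sigma>'. convex_bicombing M d \<sigma> \<longrightarrow> convex_bicombing M d \<sigma>' \<longrightarrow>
        (\<forall>x\<in>M. \<forall>y\<in>M. \<forall>t\<in>{0..1}. \<sigma> x y t = \<sigma>' x y t))"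

definition CUB :: "'a set \<Rightarrow> ('a \<Rightarrow> 'a \<Rightarrow> real) \<Rightarrow> bool" where
  "CUB M d \<longleftrightarrow>
     Metric_space M d \<and>
     has_unique_convex_bicombing M d \<and>
     (\<forall>c\<in>M. \<forall>r>0. has_unique_convex_bicombing (Metric_space.mball M d c r) d \<and>
                   has_unique_convex_bicombing (Metric_space.mcball M d c r) d)"


section \<open>Simplicial complexes\<close>

text \<open>A complex is the set of its nonempty simplices; its vertex set is \<open>\<Union>K\<close>.\<close>

definition simplicial_complex :: "'v set set \<Rightarrow> bool" where
  "simplicial_complex K \<longleftrightarrow>
     (\<forall>S\<in>K. finite S \<and> S \<noteq> {} \<and> (\<forall>T. T \<subseteq> S \<and> T \<noteq> {} \<longrightarrow> T \<in> K))"

definition simplicial_iso :: "('v \<Rightarrow> 'w) \<Rightarrow> 'v set set \<Rightarrow> 'w set set \<Rightarrow> bool" where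
  "simplicial_iso \<phi> K L \<longleftrightarrow> bij_betw \<phi> (\<Union>K) (\<Union>L) \<and> (\<lambda>S. \<phi> ` S) ` K = L"


section \<open>Coxeter complexes of types B, C, D (affine)\<close>

datatype affine_type = AffB | AffC | AffD

text \<open>The rank is \<open>n = CARD('n)\<close>; the bounds are those for which the diagrams with forks
  exist and \<open>B\<close>, \<open>D\<close> are not other types in disguise. \<open>C\<close> in rank 1 is the infinite dihedral
  type.\<close>

definition admissible_rank :: "affine_type \<Rightarrow> nat \<Rightarrow> bool" where
  "admissible_rank ty n \<longleftrightarrow>
     (case ty of AffB \<Rightarrow> n \<ge> 3 | AffC \<Rightarrow> n \<ge> 1 | AffD \<Rightarrow> n \<ge> 4)"

definition walls :: "affine_type \<Rightarrow> (real^'n) set set" where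
  "walls ty =
     {{x. x $ i + x $ j = of_int k} | i j k. i \<noteq> j} \<union>
     {{x. x $ i - x $ j = of_int k} | i j k. i \<noteq> j} \<union>
     (case ty of
        AffD \<Rightarrow> {}
      | AffB \<Rightarrow> {{x. x $ i = of_int k} | i k. True}
      | AffC \<Rightarrow> {{x. x $ i = of_int k / 2} | i k. True})"

text \<open>Maximal simplices are the vertex sets of the closed alcoves.\<close>

definition coxeter_complex :: "affine_type \<Rightarrow> (real^'n) set set" where
  "coxeter_complex ty =
     {S. S \<noteq> {} \<and> (\<exists>C \<in> components (UNIV - \<Union>(walls ty)).
                      S \<subseteq> {v. v extreme_point_of (closure C)})}"

text \<open>The type of a vertex of the Coxeter complex, numbered along the diagram, constant on orbits
  of the affine Weyl group. Let \<open>\<eta>\<^sub>k = (1/2,\<dots>,1/2,0,\<dots>,0)\<close> with \<open>k\<close> nonzero entries.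
  On the vertices of the standard alcove the values are:
  type \<open>C\<close>: \<open>\<eta>\<^sub>k \<mapsto> k\<close> for \<open>0 \<le> k \<le> n\<close>;
  type \<open>B\<close>: \<open>0 \<mapsto> 0\<close>, \<open>(1,0,\<dots>,0) \<mapsto> 1\<close>, \<open>\<eta>\<^sub>k \<mapsto> k\<close> for \<open>2 \<le> k \<le> n\<close>;
  type \<open>D\<close>: \<open>0 \<mapsto> 0\<close>, \<open>(1,0,\<dots>,0) \<mapsto> 1\<close>, \<open>\<eta>\<^sub>k \<mapsto> k\<close> for \<open>2 \<le> k \<le> n - 2\<close>,
  \<open>(1/2,\<dots>,1/2,-1/2) \<mapsto> n - 1\<close>, \<open>\<eta>\<^sub>n \<mapsto> n\<close>.\<close>

definition coxeter_type :: "affine_type \<Rightarrow> real^'n \<Rightarrow> nat" where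
  "coxeter_type ty v =
     (let h = card {i. v $ i \<notin> \<int>} in
      if ty \<noteq> AffC \<and> h = 0 then (if (\<Sum>i\<in>UNIV. v $ i) / 2 \<in> \<int> then 0 else 1)
      else if ty = AffD \<and> h = CARD('n) then
        (if (\<Sum>i\<in>UNIV. v $ i - 1 / 2) / 2 \<in> \<int> then CARD('n) else CARD('n) - 1)
      else h)"


section \<open>Euclidean buildings\<close>

text \<open>The usual apartment axioms (thickness is not required). The vertex typing \<open>\<tau>\<close> is part of the
  data: for affine \<open>D\<^sub>4\<close>, whose diagram is a star with four leaves, the complex alone does not
  determine which pairs of leaves are regarded as forks.\<close>

definition euclidean_building ::
    "affine_type \<Rightarrow> 'n::finite itself \<Rightarrow> 'v set set \<Rightarrow> ('v \<Rightarrow> nat) \<Rightarrow> bool" where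
  "euclidean_building ty _ K \<tau> \<longleftrightarrow>
     admissible_rank ty CARD('n) \<and> simplicial_complex K \<and> K \<noteq> {} \<and>
     (\<exists>\<A>. \<Union>\<A> = K \<and>
        (\<forall>A\<in>\<A>. \<exists>\<phi>. simplicial_iso \<phi> A (coxeter_complex ty :: (real^'n) set set) \<and>
                     (\<forall>v\<in>\<Union>A. \<tau> v = coxeter_type ty (\<phi> v))) \<and>
        (\<forall>S\<in>K. \<forall>T\<in>K. \<exists>A\<in>\<A>. S \<in> A \<and> T \<in> A) \<and>
        (\<forall>A\<in>\<A>. \<forall>A'\<in>\<A>. \<forall>S \<in> A \<inter> A'. \<forall>T \<in> A \<inter> A'.
           \<exists>\<psi>. simplicial_iso \<psi> A A' \<and> (\<forall>v \<in> S \<union> T. \<psi> v = v)))"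


section \<open>Subdivision to affine type C\<close>

text \<open>The sets of types of the two leaves of a fork of the diagram.\<close>

definition forks :: "affine_type \<Rightarrow> nat \<Rightarrow> nat set set" where
  "forks ty n = (case ty of AffB \<Rightarrow> {{0, 1}} | AffC \<Rightarrow> {} | AffD \<Rightarrow> {{0, 1}, {n - 1, n}})"

text \<open>A vertex of the subdivision is encoded by its carrier in \<open>K\<close>: an old vertex \<open>v\<close> by \<open>{v}\<close>, the
  midpoint of a fork edge by that edge.\<close>

definition subdivision_vertices ::
    "affine_type \<Rightarrow> nat \<Rightarrow> 'v set set \<Rightarrow> ('v \<Rightarrow> nat) \<Rightarrow> 'v set set" where
  "subdivision_vertices ty n K \<tau> = {e \<in> K. (\<exists>v. e = {v}) \<or> \<tau> ` e \<in> forks ty n}"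

text \<open>The affine \<open>C\<close> type, i.e. the number of coordinates in \<open>1/2 + \<int>\<close> in any apartment. Both leaves of
  the first fork become type \<open>0\<close> and their midpoint (e.g. \<open>(1/2,0,\<dots>,0)\<close>) has type \<open>1\<close>; both
  leaves of the last fork become type \<open>n\<close> and their midpoint (e.g. \<open>(1/2,\<dots>,1/2,0)\<close>) has type
  \<open>n - 1\<close>.\<close>

definition subdivision_type :: "affine_type \<Rightarrow> nat \<Rightarrow> ('v \<Rightarrow> nat) \<Rightarrow> 'v set \<Rightarrow> nat" where
  "subdivision_type ty n \<tau> e =
     (if ty \<noteq> AffC \<and> \<tau> ` e = {0, 1} then 1
      else if ty \<noteq> AffC \<and> \<tau> ` e \<subseteq> {0, 1} then 0
      else if ty = AffD \<and> \<tau> ` e = {n - 1, n} then n - 1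
      else if ty = AffD \<and> \<tau> ` e \<subseteq> {n - 1, n} then n
      else the_elem (\<tau> ` e))"

text \<open>Inside one simplex of \<open>K\<close>, the only subdivision vertices of equal type are the two leaves of a
  fork, and these are exactly the pairs separated by the subdivision. For type \<open>C\<close> nothing is
  subdivided (up to writing \<open>{v}\<close> for \<open>v\<close>).\<close>

definition subdivision ::
    "affine_type \<Rightarrow> nat \<Rightarrow> 'v set set \<Rightarrow> ('v \<Rightarrow> nat) \<Rightarrow> 'v set set set" where
  "subdivision ty n K \<tau> =
     {S. S \<noteq> {} \<and> S \<subseteq> subdivision_vertices ty n K \<tau> \<and> \<Union>S \<in> K \<and>
         inj_on (subdivision_type ty n \<tau>) S}"


section \<open>The standard \<open>\<ell>\<^sup>\<infinity>\<close> metric\<close>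

text \<open>Points are given by their barycentric coordinates.\<close>

definition closed_simplex :: "'v set \<Rightarrow> ('v \<Rightarrow> real) set" where
  "closed_simplex S = {x. (\<forall>v. 0 \<le> x v) \<and> (\<forall>v. v \<notin> S \<longrightarrow> x v = 0) \<and> (\<Sum>v\<in>S. x v) = 1}"

definition realization :: "'v set set \<Rightarrow> ('v \<Rightarrow> real) set" where
  "realization K = (\<Union>S\<in>K. closed_simplex S)"

text \<open>For \<open>S = {v\<^sub>0 < \<dots> < v\<^sub>d}\<close>, ordered by \<open>\<tau>\<close> and embedded in \<open>\<real>\<^sup>d\<close> by
  \<open>v\<^sub>i \<mapsto> (1,\<dots>,1,0,\<dots>,0)\<close> with \<open>i\<close> ones, the \<open>j\<close>-th coordinate of \<open>x\<close> is the sum of \<open>x v\<^sub>i\<close>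
  over \<open>i \<ge> j\<close>. The index \<open>j = 0\<close> gives the constant \<open>1\<close> and does not affect the distance below.\<close>

definition simplex_coord :: "('v \<Rightarrow> nat) \<Rightarrow> 'v set \<Rightarrow> 'v \<Rightarrow> ('v \<Rightarrow> real) \<Rightarrow> real" where
  "simplex_coord \<tau> S v x = (\<Sum>w | w \<in> S \<and> \<tau> v \<le> \<tau> w. x w)"

definition simplex_dist :: "('v \<Rightarrow> nat) \<Rightarrow> 'v set \<Rightarrow> ('v \<Rightarrow> real) \<Rightarrow> ('v \<Rightarrow> real) \<Rightarrow> real" where
  "simplex_dist \<tau> S x y = Max ((\<lambda>v. \<bar>simplex_coord \<tau> S v x - simplex_coord \<tau> S v y\<bar>) ` S)"

text \<open>\<open>polygonal_path K \<tau> x y l\<close>: there is a path from \<open>x\<close> to \<open>y\<close> of length \<open>l\<close> that is a finite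
  concatenation of affine segments, each inside a closed simplex of \<open>K\<close>.\<close>

inductive polygonal_path ::
    "'v set set \<Rightarrow> ('v \<Rightarrow> nat) \<Rightarrow> ('v \<Rightarrow> real) \<Rightarrow> ('v \<Rightarrow> real) \<Rightarrow> real \<Rightarrow> bool"
  for K \<tau> where
  refl: "x \<in> realization K \<Longrightarrow> polygonal_path K \<tau> x x 0"
| step: "S \<in> K \<Longrightarrow> x \<in> closed_simplex S \<Longrightarrow> y \<in> closed_simplex S \<Longrightarrow>
         polygonal_path K \<tau> y z l \<Longrightarrow> polygonal_path K \<tau> x z (simplex_dist \<tau> S x y + l)"

text \<open>Outside the realization the value is irrelevant; it is set to \<open>0\<close> because \<open>Metric_space\<close> asks
  for nonnegativity on the whole type.\<close>

definition linf_metric :: "'v set set \<Rightarrow> ('v \<Rightarrow> nat) \<Rightarrow> ('v \<Rightarrow> real) \<Rightarrow> ('v \<Rightarrow> real) \<Rightarrow> real" where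
  "linf_metric K \<tau> x y =
     (if x \<in> realization K \<and> y \<in> realization K then Inf {l. polygonal_path K \<tau> x y l} else 0)"

end

theory Submission
  imports Defs
begin

text \<open>Scale each apartment by \<open>2\<close>. The subdivision of the Coxeter complex then has vertex set \<open>\<int>\<^sup>n\<close>, and the type
of an integer point is the number of its odd coordinates. A maximal simplex is a flag: start at a
point with even coordinates and move each coordinate once by \<open>1\<close> or \<open>-1\<close>, in some order. In these
coordinates the standard metric of a simplex is the supremum norm.

\<^bold>\<open>Existence.\<close> The building enters through two facts: any two simplices lie in a common apartment, and
the charts of two apartments agree on two given common simplices up to an isometry. An apartment through
a point \<open>x\<close> and a simplex containing a segment \<open>[y, z]\<close> contains the triangle \<open>x, y, z\<close>, so
chart distances satisfy the triangle inequality one step at a time along polygonal paths; hence the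
length metric is the chart distance (\<open>dst_triangle\<close>, \<open>linf_metric_dst\<close>). The same triangle shows that
the affine combing contracts linearly towards \<open>x\<close> (\<open>seg_thin\<close>), which gives a convex bicombing,
and balls are closed under it. That affine segments do not depend on the chart
(\<open>seg_pt_unique\<close>) follows from retractions onto an apartment (\<open>point_retraction\<close>) and the strict
convexity of the Euclidean norm, which the transition isometries preserve as well.

\<^bold>\<open>Uniqueness.\<close> Let \<open>\<sigma>\<close> be a convex bicombing, \<open>x\<close> and \<open>y\<close> points of an apartment, \<open>q = \<sigma> x y t\<close>.
If \<open>z\<close> lies far from \<open>x\<close> in the direction of the coordinate \<open>e\<^sub>i\<close>, then \<open>d z\<close> is, at \<open>x\<close> and \<open>y\<close>,
a constant minus the \<open>i\<close>-th coordinate. Convexity of \<open>t \<mapsto> d z (\<sigma> x y t)\<close> bounds the \<open>i\<close>-th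
coordinate of the retraction of \<open>q\<close> from below, and \<open>-e\<^sub>i\<close> bounds it from above. So \<open>q\<close> retracts to the
affine point, for every choice of the centre of the retraction; with the affine point itself as centre
this forces equality (\<open>bicombing_locally_seg\<close>). In a ball the test points have to stay inside, so the argument only
works for nearby points; convexity of \<open>t \<mapsto> d (\<sigma> x y t) (seg x y t)\<close> makes it global, and boundary
points of a closed ball are limits of interior points (\<open>ball_unique_bicombing\<close>).

\<^bold>\<open>Charts.\<close> The alcoves of the three types are identified by sorting the distances of the
coordinates to the nearest even integers (\<open>coxeter_complex_frames\<close>). The exchange axiom gives isomorphisms
of apartments that need not respect types; those fixing a chamber do, because two labellings
that agree on one chamber agree along galleries (\<open>labels_agree\<close>). A type-preserving isomorphism
keeps the coordinates of every simplex up to order, sign and translation, so it is an isometry on each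
simplex (\<open>chart_map_norms\<close>), and then globally, by cutting segments into pieces inside simplices.\<close>

section \<open>Spaces with an atlas of flat charts\<close>

text \<open>The tool for passing from simplices to whole apartments. Follow the segment to the last point that lies
in one closed set containing the current start; the rest of the segment is covered by the remaining sets,
because these are closed. Read \<open>Q p q l\<close> as: \<open>p\<close> and \<open>q\<close> can be
joined at cost \<open>l\<close>.\<close>

lemma segment_chain:
  fixes a b :: "'e::real_normed_vector"
  assumes "finite F" and "\<And>C. C \<in> F \<Longrightarrow> closed C" and "closed_segment a b \<subseteq> \<Union>F"
    and step: "\<And>C p q. C \<in> F \<Longrightarrow> p \<in> C \<Longrightarrow> q \<in> C \<Longrightarrow> Q p q (N (q - p))"
    and trans: "\<And>p q r k l. Q p q k \<Longrightarrow> Q q r l \<Longrightarrow> Q p r (k + l)"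
    and N: "\<And>c v. N (c *\<^sub>R v) = \<bar>c\<bar> * (N v :: real)"
  shows "Q a b (N (b - a))"
  using assms(1-4)
proof (induction "card F" arbitrary: F a)
  case 0
  then show ?case by auto
next
  case (Suc m)
  define g where "g t = a + t *\<^sub>R (b - a)" for t :: real
  have g_cont: "continuous_on UNIV g" unfolding g_def by (intro continuous_intros)
  have g_seg: "closed_segment a b = g ` {0..1}"
    by (simp add: closed_segment_image_interval g_def algebra_simps)
  obtain C where C: "C \<in> F" "a \<in> C" using Suc.prems(3) by auto
  define T where "T = {0..1} \<inter> g -` C"
  have "closed (g -` C)"
    using g_cont Suc.prems(2)[OF C(1)] by (simp add: continuous_closed_vimage continuous_on_eq_continuous_at)
  then have "compact T" unfolding T_def by (intro compact_Int_closed) auto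
  moreover have "0 \<in> T" using C by (auto simp: T_def g_def)
  ultimately obtain t where t: "t \<in> T" "\<And>s. s \<in> T \<Longrightarrow> s \<le> t"
    using compact_attains_sup[of T] by auto
  have t01: "0 \<le> t" "t \<le> 1" and gt: "g t \<in> C" using t by (auto simp: T_def)
  have first: "Q a (g t) (t * N (b - a))"
    using Suc.prems(4)[OF C(1,2) gt] N[of t "b - a"] t01 by (simp add: g_def)
  show ?case
  proof (cases "t = 1")
    case True
    then show ?thesis using first by (simp add: g_def)
  next
    case False
    define F' where "F' = F - {C}"
    have "closed (\<Union>F')" using Suc.prems by (auto simp: F'_def intro!: closed_Union)
    then have cl: "closed (g -` \<Union>F')"
      using g_cont by (simp add: continuous_closed_vimage continuous_on_eq_continuous_at)
    have "{t<..1} \<subseteq> g -` \<Union>F'"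
    proof
      fix s assume s: "s \<in> {t<..1}"
      then have "g s \<in> closed_segment a b" using t01 by (auto simp: g_seg)
      moreover have "g s \<notin> C" using t(2)[of s] s t01 by (auto simp: T_def)
      ultimately show "s \<in> g -` \<Union>F'" using Suc.prems(3) by (auto simp: F'_def)
    qed
    then have "closure {t<..1} \<subseteq> g -` \<Union>F'" using cl by (rule closure_minimal)
    then have "{t..1} \<subseteq> g -` \<Union>F'" using False t01 by simp
    moreover have "closed_segment (g t) b \<subseteq> g ` {t..1}"
    proof
      fix p assume "p \<in> closed_segment (g t) b"
      then obtain u where u: "0 \<le> u" "u \<le> 1" "p = (1 - u) *\<^sub>R g t + u *\<^sub>R b"
        by (auto simp: closed_segment_def)
      have "p = g (t + u * (1 - t))" unfolding u(3) g_def by (simp add: algebra_simps)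
      moreover have "t + u * (1 - t) \<in> {t..1}"
        using u t01 mult_left_le_one_le[of "1 - t" u] by auto
      ultimately show "p \<in> g ` {t..1}" by blast
    qed
    ultimately have "closed_segment (g t) b \<subseteq> \<Union>F'" by blast
    moreover have "m = card F'" using Suc.hyps(2) C(1) Suc.prems(1) by (simp add: F'_def)
    ultimately have "Q (g t) b (N (b - g t))"
      using Suc.prems(1,2,4) by (intro Suc.hyps(1)[of F' "g t"]) (auto simp: F'_def)
    moreover have "b - g t = (1 - t) *\<^sub>R (b - a)" by (simp add: g_def algebra_simps)
    ultimately have "Q (g t) b ((1 - t) * N (b - a))" using N t01 by simp
    from trans[OF first this] show ?thesis by (simp add: algebra_simps)
  qed
qed

text \<open>Transition maps between charts are isometries for the supremum norm, which is the metric under study,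
and for the Euclidean norm, which is needed because its geodesics are unique. Facts that hold for both are
stated for \<open>N \<in> both_norms\<close>.\<close>

abbreviation both_norms :: "((real^'n) \<Rightarrow> real) set" where
  "both_norms \<equiv> {norm, infnorm}"

lemma both_norms:
  assumes "N \<in> both_norms"
  shows both_norms_scale: "N (c *\<^sub>R v) = \<bar>c\<bar> * N v"
    and both_norms_triangle: "N (v + w) \<le> N v + N w"
    and both_norms_commute: "N (v - w) = N (w - v)"
    and both_norms_nonneg: "0 \<le> N v"
    and both_norms_eq0: "N v = 0 \<longleftrightarrow> v = 0"
  using assms
  by (auto simp: infnorm_mul norm_triangle_ineq infnorm_triangle norm_minus_commute
      infnorm_sub infnorm_pos_le infnorm_eq_0)

text \<open>A chart \<open>(A, f)\<close> consists of the set \<open>A\<close> of the cells of an apartment and its identification \<open>f\<close> with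
\<open>\<real>\<^sup>n\<close>. The cells stand for the closed simplices of a building. In the last assumption \<open>C\<close> plays the role
of a chamber: a point of \<open>\<real>\<^sup>n\<close> is determined by its distances to the image of \<open>C\<close>.\<close>

locale flat_atlas =
  fixes charts :: "('p set set \<times> ('p \<Rightarrow> real^'n)) set"
  assumes bij: "(A, f) \<in> charts \<Longrightarrow> bij_betw f (\<Union>A) UNIV"
    and common_chart: "(A, f) \<in> charts \<Longrightarrow> (B, g) \<in> charts \<Longrightarrow> S \<in> A \<Longrightarrow> T \<in> B \<Longrightarrow>
          \<exists>C h. (C, h) \<in> charts \<and> S \<in> C \<and> T \<in> C"
    and common_cell: "(A, f) \<in> charts \<Longrightarrow> (B, g) \<in> charts \<Longrightarrow> x \<in> \<Union>A \<Longrightarrow> x \<in> \<Union>B \<Longrightarrow>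
          \<exists>S \<in> A \<inter> B. x \<in> S"
    and agree: "(A, f) \<in> charts \<Longrightarrow> (B, g) \<in> charts \<Longrightarrow> S \<in> A \<inter> B \<Longrightarrow> T \<in> A \<inter> B \<Longrightarrow>
          \<exists>h. (B, h) \<in> charts \<and> (\<forall>x \<in> S \<union> T. h x = f x)"
    and cell_isometry: "(A, f) \<in> charts \<Longrightarrow> (B, g) \<in> charts \<Longrightarrow> S \<in> A \<inter> B \<Longrightarrow> x \<in> S \<Longrightarrow> y \<in> S \<Longrightarrow>
          N \<in> both_norms \<Longrightarrow> N (f x - f y) = N (g x - g y)"
    and closed_cell: "(A, f) \<in> charts \<Longrightarrow> S \<in> A \<Longrightarrow> closed (f ` S)"
    and locally_finite: "(A, f) \<in> charts \<Longrightarrow> bounded R \<Longrightarrow>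
          \<exists>F \<subseteq> A. finite F \<and> R \<subseteq> (\<Union>S\<in>F. f ` S)"
    and chamber: "(A, f) \<in> charts \<Longrightarrow> x \<in> \<Union>A \<Longrightarrow>
          \<exists>C\<in>A. x \<in> C \<and> (\<forall>u v. (\<forall>c\<in>C. norm (u - f c) = norm (v - f c)) \<longrightarrow> u = v)"
begin

definition pts :: "'p set" where "pts = (\<Union>(A, f)\<in>charts. \<Union>A)"

lemma ptsI: "(A, f) \<in> charts \<Longrightarrow> x \<in> \<Union>A \<Longrightarrow> x \<in> pts"
  by (auto simp: pts_def)

lemma chart_onto:
  assumes "(A, f) \<in> charts" obtains x where "x \<in> \<Union>A" "f x = u"
  using bij_betw_imp_surj_on[OF bij[OF assms]] by (metis UNIV_I imageE)

lemma chart_inj: "(A, f) \<in> charts \<Longrightarrow> x \<in> \<Union>A \<Longrightarrow> y \<in> \<Union>A \<Longrightarrow> f x = f y \<Longrightarrow> x = y"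
  using bij_betw_imp_inj_on[OF bij] by (meson inj_onD)

lemma point_and_cell_chart:
  assumes "x \<in> pts" "(A, f) \<in> charts" "S \<in> A"
  obtains B g where "(B, g) \<in> charts" "x \<in> \<Union>B" "S \<in> B"
proof -
  obtain A' f' T where "(A', f') \<in> charts" "T \<in> A'" "x \<in> T"
    using assms(1) by (auto simp: pts_def)
  with common_chart[OF assms(2) this(1) assms(3) this(2)] that show ?thesis by blast
qed

lemma two_point_chart:
  assumes "x \<in> pts" "y \<in> pts"
  obtains A f where "(A, f) \<in> charts" "x \<in> \<Union>A" "y \<in> \<Union>A"
proof -
  obtain A f S where "(A, f) \<in> charts" "S \<in> A" "y \<in> S" using assms(2) by (auto simp: pts_def)
  with point_and_cell_chart[OF assms(1) this(1,2)] that show ?thesis by blast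
qed

lemma polygonal_chain:
  assumes ch: "(A, f) \<in> charts" and N: "N \<in> both_norms"
    and xy: "x \<in> \<Union>A" "y \<in> \<Union>A"
    and step: "\<And>S p q. S \<in> A \<Longrightarrow> p \<in> S \<Longrightarrow> q \<in> S \<Longrightarrow> Q p q (N (f q - f p))"
    and trans: "\<And>p q r k l. p \<in> \<Union>A \<Longrightarrow> q \<in> \<Union>A \<Longrightarrow> r \<in> \<Union>A \<Longrightarrow> Q p q k \<Longrightarrow> Q q r l \<Longrightarrow> Q p r (k + l)"
  shows "Q x y (N (f y - f x))"
proof -
  define g where "g = inv_into (\<Union>A) f"
  have surj: "f ` (\<Union>A) = UNIV" using bij[OF ch] by (simp add: bij_betw_def)
  have g_in: "g u \<in> \<Union>A" for u unfolding g_def using surj by (intro inv_into_into) auto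
  have gf: "g (f p) = p" if "p \<in> \<Union>A" for p
    unfolding g_def using that bij[OF ch] by (simp add: bij_betw_def)
  obtain F where F: "F \<subseteq> A" "finite F" "closed_segment (f x) (f y) \<subseteq> (\<Union>S\<in>F. f ` S)"
    using locally_finite[OF ch bounded_closed_segment] by metis
  have "Q (g (f x)) (g (f y)) (N (f y - f x))"
  proof (rule segment_chain[where F = "(`) f ` F" and Q = "\<lambda>u v. Q (g u) (g v)" and N = N])
    show "finite ((`) f ` F)" using F by simp
    show "closed C" if "C \<in> (`) f ` F" for C using that F closed_cell[OF ch] by auto
    show "closed_segment (f x) (f y) \<subseteq> \<Union> ((`) f ` F)" using F by simp
    show "Q (g p) (g q) (N (q - p))" if C: "C \<in> (`) f ` F" and "p \<in> C" "q \<in> C" for C p q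
    proof -
      obtain S p' q' where S: "S \<in> A" "p' \<in> S" "q' \<in> S" "p = f p'" "q = f q'"
        using C F(1) \<open>p \<in> C\<close> \<open>q \<in> C\<close> by blast
      then have "g p = p'" "g q = q'" using gf by auto
      with step[OF S(1-3)] S show ?thesis by simp
    qed
    show "Q (g p) (g r) (k + l)" if "Q (g p) (g q) k" "Q (g q) (g r) l" for p q r k l
      using trans[OF g_in g_in g_in that] .
    show "N (c *\<^sub>R v) = \<bar>c\<bar> * N v" for c v by (rule both_norms_scale[OF N])
  qed
  then show ?thesis using gf xy by simp
qed

text \<open>On each cell the two charts induce the same distance, so the image under \<open>g\<close> of the segment that is
straight for \<open>f\<close> is a path of the same length.\<close>

lemma chart_isometry_le:
  assumes f: "(A, f) \<in> charts" and g: "(A, g) \<in> charts" and N: "N \<in> both_norms"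
    and xy: "x \<in> \<Union>A" "y \<in> \<Union>A"
  shows "N (g y - g x) \<le> N (f y - f x)"
proof (rule polygonal_chain[OF f N xy, where Q = "\<lambda>p q l. N (g q - g p) \<le> l"])
  show "N (g q - g p) \<le> N (f q - f p)" if "S \<in> A" "p \<in> S" "q \<in> S" for S p q
    using cell_isometry[OF f g _ that(3,2) N] that(1) by simp
  show "N (g r - g p) \<le> k + l" if "N (g q - g p) \<le> k" "N (g r - g q) \<le> l" for p q r k l
    using both_norms_triangle[OF N, of "g q - g p" "g r - g q"] that by simp
qed

lemma chart_isometry:
  assumes "(A, f) \<in> charts" "(A, g) \<in> charts" "N \<in> both_norms" "x \<in> \<Union>A" "y \<in> \<Union>A"
  shows "N (f x - f y) = N (g x - g y)"
  using chart_isometry_le assms by (meson order_antisym)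

lemma agree_points:
  assumes f: "(A, f) \<in> charts" and g: "(B, g) \<in> charts"
    and "x \<in> \<Union>A" "x \<in> \<Union>B" "y \<in> \<Union>A" "y \<in> \<Union>B"
  obtains h where "(B, h) \<in> charts" "h x = f x" "h y = f y"
proof -
  obtain S T where "S \<in> A \<inter> B" "x \<in> S" "T \<in> A \<inter> B" "y \<in> T"
    using common_cell[OF f g] assms by metis
  with agree[OF f g this(1,3)] that show ?thesis by blast
qed

lemma transition_isometry:
  assumes f: "(A, f) \<in> charts" and g: "(B, g) \<in> charts" and N: "N \<in> both_norms"
    and xy: "x \<in> \<Union>A" "x \<in> \<Union>B" "y \<in> \<Union>A" "y \<in> \<Union>B"
  shows "N (f x - f y) = N (g x - g y)"
proof -
  obtain h where h: "(B, h) \<in> charts" "h x = f x" "h y = f y" using agree_points[OF f g xy] .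
  show ?thesis using chart_isometry[OF h(1) g N xy(2,4)] h(2,3) by simp
qed

text \<open>The choice of the chart does not matter by \<open>transition_isometry\<close>.\<close>

definition dst :: "((real^'n) \<Rightarrow> real) \<Rightarrow> 'p \<Rightarrow> 'p \<Rightarrow> real" where
  "dst N x y = (SOME l. \<exists>A f. (A, f) \<in> charts \<and> x \<in> \<Union>A \<and> y \<in> \<Union>A \<and> l = N (f x - f y))"

lemma dst_chart:
  assumes "(A, f) \<in> charts" "N \<in> both_norms" "x \<in> \<Union>A" "y \<in> \<Union>A"
  shows "dst N x y = N (f x - f y)"
  unfolding dst_def
proof (rule some_equality)
  show "\<exists>A' f'. (A', f') \<in> charts \<and> x \<in> \<Union>A' \<and> y \<in> \<Union>A' \<and> N (f x - f y) = N (f' x - f' y)"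
    using assms by (intro exI[of _ A] exI[of _ f] conjI) simp_all
  fix l assume "\<exists>A' f'. (A', f') \<in> charts \<and> x \<in> \<Union>A' \<and> y \<in> \<Union>A' \<and> l = N (f' x - f' y)"
  then obtain A' f' where *: "(A', f') \<in> charts" "x \<in> \<Union>A'" "y \<in> \<Union>A'" "l = N (f' x - f' y)"
    by (elim exE conjE)
  show "l = N (f x - f y)"
    unfolding *(4) by (rule transition_isometry[OF *(1) assms(1,2) *(2) assms(3) *(3) assms(4)])
qed

lemma dst_commute: "N \<in> both_norms \<Longrightarrow> x \<in> pts \<Longrightarrow> y \<in> pts \<Longrightarrow> dst N x y = dst N y x"
  by (erule (1) two_point_chart) (simp add: dst_chart both_norms_commute del: insert_iff)

lemma dst_nonneg: "N \<in> both_norms \<Longrightarrow> x \<in> pts \<Longrightarrow> y \<in> pts \<Longrightarrow> 0 \<le> dst N x y"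
  by (erule (1) two_point_chart) (simp add: dst_chart both_norms_nonneg del: insert_iff)

lemma dst_eq0: "N \<in> both_norms \<Longrightarrow> x \<in> pts \<Longrightarrow> y \<in> pts \<Longrightarrow> dst N x y = 0 \<longleftrightarrow> x = y"
  by (erule (1) two_point_chart)
    (auto simp: dst_chart both_norms_eq0 simp del: insert_iff dest: chart_inj)

text \<open>Move from \<open>y\<close> to \<open>z\<close> in steps inside cells: for each step there is a chart that contains both the cell
and the point \<open>x\<close>, and there the inequality is that of the norm.\<close>

lemma dst_triangle:
  assumes N: "N \<in> both_norms" and x: "x \<in> pts" and y: "y \<in> pts" and z: "z \<in> pts"
  shows "dst N x z \<le> dst N x y + dst N y z"
proof -
  obtain A f where ch: "(A, f) \<in> charts" and yz: "y \<in> \<Union>A" "z \<in> \<Union>A"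
    using two_point_chart[OF y z] .
  have "dst N x z \<le> dst N x y + N (f z - f y)"
  proof (rule polygonal_chain[OF ch N yz, where Q = "\<lambda>p q l. dst N x q \<le> dst N x p + l"])
    show "dst N x q \<le> dst N x p + N (f q - f p)" if S: "S \<in> A" "p \<in> S" "q \<in> S" for S p q
    proof -
      obtain B g where g: "(B, g) \<in> charts" "x \<in> \<Union>B" "S \<in> B"
        using point_and_cell_chart[OF x ch S(1)] .
      then have "N (f q - f p) = N (g q - g p)"
        using S ch N by (intro cell_isometry[of A f B g S]) auto
      moreover have "dst N x q = N (g x - g q)" "dst N x p = N (g x - g p)"
        using g S by (auto intro!: dst_chart N)
      moreover have "N (g x - g q) \<le> N (g x - g p) + N (g q - g p)"
        using both_norms_triangle[OF N, of "g x - g p" "g p - g q"]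
          both_norms_commute[OF N, of "g p" "g q"] by simp
      ultimately show ?thesis by simp
    qed
  qed auto
  then show ?thesis using dst_chart[OF ch N yz] both_norms_commute[OF N, of "f y" "f z"] by simp
qed

section \<open>Retractions and affine segments\<close>

text \<open>The retraction onto an apartment centred at a chamber \<open>C\<close>: a point \<open>z\<close> is read off in any chart that
contains \<open>z\<close> and coincides with \<open>f\<close> on \<open>C\<close>. Two such charts give the same value, since distances to \<open>C\<close>
determine a point. Distances to \<open>C\<close> are kept because \<open>z\<close> and \<open>C\<close> share the chart, and all other distances
do not grow because the retraction is isometric on every cell.\<close>

lemma retraction:
  assumes f: "(A, f) \<in> charts" and C: "C \<in> A"
    and span: "\<And>u v. (\<forall>c\<in>C. norm (u - f c) = norm (v - f c)) \<Longrightarrow> u = v"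
  obtains \<rho> where "\<And>x. x \<in> \<Union>A \<Longrightarrow> \<rho> x = f x"
    and "\<And>N x c. N \<in> both_norms \<Longrightarrow> x \<in> pts \<Longrightarrow> c \<in> C \<Longrightarrow> N (\<rho> x - f c) = dst N x c"
    and "\<And>N x y. N \<in> both_norms \<Longrightarrow> x \<in> pts \<Longrightarrow> y \<in> pts \<Longrightarrow> N (\<rho> x - \<rho> y) \<le> dst N x y"
proof -
  \<comment> \<open>Charts that contain \<open>C\<close> and coincide with \<open>f\<close> there.\<close>
  define based where
    "based B g \<longleftrightarrow> (B, g) \<in> charts \<and> C \<in> B \<and> (\<forall>c\<in>C. g c = f c)" for B g
  have uniq: "g z = h z" if g: "based B g" "z \<in> \<Union>B" and h: "based D h" "z \<in> \<Union>D" for B g D h z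
  proof -
    obtain T where T: "T \<in> B \<inter> D" "z \<in> T"
      using common_cell[of B g D h z] g h by (auto simp: based_def)
    obtain g' where g': "(D, g') \<in> charts" "\<forall>x \<in> C \<union> T. g' x = g x"
      using agree[of B g D h C T] g h T by (auto simp: based_def)
    have "norm (g z - f c) = norm (h z - f c)" if c: "c \<in> C" for c
    proof -
      have "norm (g' z - g' c) = norm (h z - h c)"
        using chart_isometry[of D g' h norm z c] g' h c by (auto simp: based_def)
      then show ?thesis using g' g h T c by (auto simp: based_def)
    qed
    then show ?thesis using span by blast
  qed
  define \<rho> where "\<rho> z = (SOME v. \<exists>B g. based B g \<and> z \<in> \<Union>B \<and> v = g z)" for z
  have \<rho>: "\<rho> z = g z" if "based B g" "z \<in> \<Union>B" for B g z
    unfolding \<rho>_def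
  proof (rule some_equality)
    show "\<exists>B' g'. based B' g' \<and> z \<in> \<Union>B' \<and> g z = g' z"
      using that by (intro exI[of _ B] exI[of _ g] conjI) simp_all
    fix v assume "\<exists>B' g'. based B' g' \<and> z \<in> \<Union>B' \<and> v = g' z"
    then obtain B' g' where *: "based B' g'" "z \<in> \<Union>B'" "v = g' z" by (elim exE conjE)
    show "v = g z" unfolding *(3) by (rule uniq[OF *(1,2) that])
  qed
  have based_ex: "\<exists>g. based B g" if "(B, h) \<in> charts" "C \<in> B" for B h
    using agree[of A f B h C C] that f C by (auto simp: based_def)
  have 1: "\<rho> x = f x" if "x \<in> \<Union>A" for x
    using \<rho>[of A f x] that f C by (auto simp: based_def)
  have 2: "N (\<rho> x - f c) = dst N x c" if N: "N \<in> both_norms" and x: "x \<in> pts" and c: "c \<in> C" for N x c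
  proof -
    obtain B h where "(B, h) \<in> charts" "x \<in> \<Union>B" "C \<in> B"
      using point_and_cell_chart[OF x f C] .
    with based_ex[of B h] obtain g where g: "based B g" "x \<in> \<Union>B" by blast
    then have "dst N x c = N (g x - g c)"
      using c dst_chart[OF _ N, of B g x c] by (auto simp: based_def)
    then show ?thesis using \<rho>[OF g] g c by (auto simp: based_def)
  qed
  have 3: "N (\<rho> x - \<rho> y) \<le> dst N x y"
    if N: "N \<in> both_norms" and x: "x \<in> pts" and y: "y \<in> pts" for N x y
  proof -
    obtain D k where k: "(D, k) \<in> charts" and xy: "x \<in> \<Union>D" "y \<in> \<Union>D"
      using two_point_chart[OF x y] .
    have "N (\<rho> y - \<rho> x) \<le> N (k y - k x)"
    proof (rule polygonal_chain[OF k N xy, where Q = "\<lambda>p q l. N (\<rho> q - \<rho> p) \<le> l"])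
      show "N (\<rho> q - \<rho> p) \<le> N (k q - k p)" if S: "S \<in> D" "p \<in> S" "q \<in> S" for S p q
      proof -
        obtain B h where h: "(B, h) \<in> charts" "S \<in> B" "C \<in> B"
          using common_chart[OF k f S(1) C] by blast
        then obtain g where g: "based B g" using based_ex by blast
        then have "\<rho> q = g q" "\<rho> p = g p" using \<rho> h S by blast+
        moreover have "N (k q - k p) = N (g q - g p)"
          using cell_isometry[of D k B g S q p N] k g h S N by (auto simp: based_def)
        ultimately show ?thesis by simp
      qed
      show "N (\<rho> r - \<rho> p) \<le> a + b" if "N (\<rho> q - \<rho> p) \<le> a" "N (\<rho> r - \<rho> q) \<le> b" for p q r a b
        using both_norms_triangle[OF N, of "\<rho> q - \<rho> p" "\<rho> r - \<rho> q"] that by simp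
    qed
    then show ?thesis using dst_chart[OF k N xy] both_norms_commute[OF N, of "\<rho> y" "\<rho> x"]
      both_norms_commute[OF N, of "k y" "k x"] by simp
  qed
  show thesis using that 1 2 3 by blast
qed

text \<open>A chamber containing \<open>q\<close> as centre of the retraction makes \<open>q\<close> the only point over its image.\<close>

lemma point_retraction:
  assumes f: "(A, f) \<in> charts" and q: "q \<in> \<Union>A"
  obtains \<rho> where "\<And>x. x \<in> \<Union>A \<Longrightarrow> \<rho> x = f x"
    and "\<And>x. x \<in> pts \<Longrightarrow> \<rho> x = f q \<Longrightarrow> x = q"
    and "\<And>N x y. N \<in> both_norms \<Longrightarrow> x \<in> pts \<Longrightarrow> y \<in> pts \<Longrightarrow> N (\<rho> x - \<rho> y) \<le> dst N x y"
proof -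
  obtain C where C: "C \<in> A" "q \<in> C"
    and span: "\<And>u v. (\<forall>c\<in>C. norm (u - f c) = norm (v - f c)) \<Longrightarrow> u = v"
    using chamber[OF f q] by blast
  obtain \<rho> where 1: "\<And>x. x \<in> \<Union>A \<Longrightarrow> \<rho> x = f x"
    and 2: "\<And>N x c. N \<in> both_norms \<Longrightarrow> x \<in> pts \<Longrightarrow> c \<in> C \<Longrightarrow> N (\<rho> x - f c) = dst N x c"
    and 3: "\<And>N x y. N \<in> both_norms \<Longrightarrow> x \<in> pts \<Longrightarrow> y \<in> pts \<Longrightarrow> N (\<rho> x - \<rho> y) \<le> dst N x y"
    using retraction[OF f C(1) span] by blast
  have "x = q" if "x \<in> pts" "\<rho> x = f q" for x
  proof -
    have "dst norm x q = 0" using 2[of norm x q] that C by simp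
    then show ?thesis using dst_eq0[of norm x q] that ptsI[OF f q] by simp
  qed
  then show thesis using that[of \<rho>] 1 3 by blast
qed

definition is_seg_pt :: "'p \<Rightarrow> 'p \<Rightarrow> real \<Rightarrow> 'p \<Rightarrow> bool" where
  "is_seg_pt x y t m \<longleftrightarrow> (\<exists>A f. (A, f) \<in> charts \<and> x \<in> \<Union>A \<and> y \<in> \<Union>A \<and> m \<in> \<Union>A \<and>
     f m = (1 - t) *\<^sub>R f x + t *\<^sub>R f y)"

text \<open>Strict convexity of the Euclidean norm, in the form of Stewart's identity.\<close>

lemma euclidean_between_unique:
  fixes a b m :: "real^'n"
  assumes "norm (m - a) \<le> t * norm (b - a)" "norm (m - b) \<le> (1 - t) * norm (b - a)" "0 \<le> t" "t \<le> 1"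
  shows "m = (1 - t) *\<^sub>R a + t *\<^sub>R b"
proof -
  define u where "u = m - a" define w where "w = b - a"
  have A: "u \<bullet> u \<le> t\<^sup>2 * (w \<bullet> w)"
    using power_mono[OF assms(1), of 2] by (simp add: u_def w_def power2_norm_eq_inner power_mult_distrib)
  have B: "(u - w) \<bullet> (u - w) \<le> (1 - t)\<^sup>2 * (w \<bullet> w)"
    using power_mono[OF assms(2), of 2] by (simp add: u_def w_def power2_norm_eq_inner power_mult_distrib)
  have "(u - t *\<^sub>R w) \<bullet> (u - t *\<^sub>R w)
        = (1 - t) * (u \<bullet> u) + t * ((u - w) \<bullet> (u - w)) - t * (1 - t) * (w \<bullet> w)"
    by (simp add: inner_diff inner_commute algebra_simps power2_eq_square)
  also have "\<dots> \<le> (1 - t) * (t\<^sup>2 * (w \<bullet> w)) + t * ((1 - t)\<^sup>2 * (w \<bullet> w)) - t * (1 - t) * (w \<bullet> w)"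
    using mult_left_mono[OF A, of "1 - t"] mult_left_mono[OF B, of t] assms by simp
  also have "\<dots> = 0" by (simp add: algebra_simps power2_eq_square)
  finally have "(u - t *\<^sub>R w) \<bullet> (u - t *\<^sub>R w) = 0" using inner_ge_zero order_antisym by blast
  then have "u - t *\<^sub>R w = 0" by (simp only: inner_eq_zero_iff)
  then show ?thesis by (simp add: u_def w_def algebra_simps)
qed

text \<open>Retract onto the first chart with centre \<open>m\<close>. The image of \<open>m'\<close> is not farther from the endpoints than
\<open>m'\<close> itself, so it is the point dividing the Euclidean segment in the ratio given by \<open>t\<close>, which is the
image of \<open>m\<close>; and no other point is mapped there.\<close>

lemma seg_pt_unique:
  assumes f: "(A, f) \<in> charts" and xA: "x \<in> \<Union>A" "y \<in> \<Union>A" "m \<in> \<Union>A"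
    and fm: "f m = (1 - t) *\<^sub>R f x + t *\<^sub>R f y"
    and g: "(B, g) \<in> charts" and xB: "x \<in> \<Union>B" "y \<in> \<Union>B" "m' \<in> \<Union>B"
    and gm: "g m' = (1 - t) *\<^sub>R g x + t *\<^sub>R g y"
    and t: "0 \<le> t" "t \<le> 1"
  shows "m' = m"
proof -
  obtain \<rho> where 1: "\<And>x. x \<in> \<Union>A \<Longrightarrow> \<rho> x = f x"
    and 2: "\<And>x. x \<in> pts \<Longrightarrow> \<rho> x = f m \<Longrightarrow> x = m"
    and 3: "\<And>N x y. N \<in> both_norms \<Longrightarrow> x \<in> pts \<Longrightarrow> y \<in> pts \<Longrightarrow> N (\<rho> x - \<rho> y) \<le> dst N x y"
    using point_retraction[OF f xA(3)] by blast
  have d: "dst norm x y = norm (f y - f x)" "dst norm x y = norm (g y - g x)"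
    using dst_chart[OF f _ xA(1,2), of norm] dst_chart[OF g _ xB(1,2), of norm]
    by (simp_all add: norm_minus_commute)
  have "g m' - g x = t *\<^sub>R (g y - g x)" "g m' - g y = (1 - t) *\<^sub>R (g x - g y)"
    unfolding gm by (simp_all add: algebra_simps)
  then have "dst norm m' x = t * norm (g y - g x)" "dst norm m' y = (1 - t) * norm (g x - g y)"
    using dst_chart[OF g _ xB(3,1), of norm] dst_chart[OF g _ xB(3,2), of norm] t by simp_all
  moreover have "norm (\<rho> m' - \<rho> x) \<le> dst norm m' x" "norm (\<rho> m' - \<rho> y) \<le> dst norm m' y"
    using 3[of norm m'] xA xB ptsI[OF f] ptsI[OF g] by auto
  ultimately have "\<rho> m' = (1 - t) *\<^sub>R f x + t *\<^sub>R f y"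
    using d t 1 xA by (intro euclidean_between_unique) (auto simp: norm_minus_commute)
  then show ?thesis using 2[of m'] ptsI[OF g xB(3)] fm by simp
qed

definition seg :: "'p \<Rightarrow> 'p \<Rightarrow> real \<Rightarrow> 'p" where
  "seg x y t = (SOME m. is_seg_pt x y t m)"

lemma seg_chart:
  assumes f: "(A, f) \<in> charts" and x: "x \<in> \<Union>A" and y: "y \<in> \<Union>A" and t: "t \<in> {0..1}"
  shows "seg x y t \<in> \<Union>A" "f (seg x y t) = (1 - t) *\<^sub>R f x + t *\<^sub>R f y"
proof -
  obtain m where m: "m \<in> \<Union>A" "f m = (1 - t) *\<^sub>R f x + t *\<^sub>R f y" using chart_onto[OF f] .
  then have "is_seg_pt x y t m" using f x y by (auto simp: is_seg_pt_def)
  moreover have "m' = m" if "is_seg_pt x y t m'" for m'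
    using that seg_pt_unique[OF f x y m] t by (auto simp: is_seg_pt_def)
  ultimately have "seg x y t = m" unfolding seg_def by (rule some_equality)
  with m show "seg x y t \<in> \<Union>A" "f (seg x y t) = (1 - t) *\<^sub>R f x + t *\<^sub>R f y" by auto
qed

lemma seg_pts: "x \<in> pts \<Longrightarrow> y \<in> pts \<Longrightarrow> t \<in> {0..1} \<Longrightarrow> seg x y t \<in> pts"
  by (erule (1) two_point_chart) (blast intro: seg_chart(1) ptsI)

abbreviation d where "d \<equiv> dst infnorm"

lemma affine_param:
  fixes u v :: "real^'n"
  shows "(1 - l) *\<^sub>R ((1 - a) *\<^sub>R u + a *\<^sub>R v) + l *\<^sub>R ((1 - b) *\<^sub>R u + b *\<^sub>R v)
    = (1 - ((1 - l) * a + l * b)) *\<^sub>R u + ((1 - l) * a + l * b) *\<^sub>R v"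
  by (simp add: algebra_simps)

lemma seg_endpoints:
  assumes "x \<in> pts" "y \<in> pts" shows "seg x y 0 = x" "seg x y 1 = y"
proof -
  obtain A f where f: "(A, f) \<in> charts" "x \<in> \<Union>A" "y \<in> \<Union>A" using two_point_chart[OF assms] .
  show "seg x y 0 = x" using seg_chart[OF f, of 0] chart_inj[OF f(1)] f by simp
  show "seg x y 1 = y" using seg_chart[OF f, of 1] chart_inj[OF f(1)] f by simp
qed

lemma seg_geodesic:
  assumes "x \<in> pts" "y \<in> pts" "s \<in> {0..1}" "t \<in> {0..1}"
  shows "d (seg x y s) (seg x y t) = \<bar>s - t\<bar> * d x y"
proof -
  obtain A f where f: "(A, f) \<in> charts" "x \<in> \<Union>A" "y \<in> \<Union>A" using two_point_chart[OF assms(1,2)] .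
  note s = seg_chart[OF f assms(3)] and t = seg_chart[OF f assms(4)]
  have "f (seg x y s) - f (seg x y t) = (t - s) *\<^sub>R (f x - f y)"
    unfolding s(2) t(2) by (simp add: algebra_simps)
  then show ?thesis
    using dst_chart[OF f(1) _ s(1) t(1), of infnorm] dst_chart[OF f(1) _ f(2,3), of infnorm]
    by (simp add: infnorm_mul abs_minus_commute)
qed

lemma seg_reparam:
  assumes xy: "x \<in> pts" "y \<in> pts" and ab: "a \<in> {0..1}" "b \<in> {0..1}" and l: "l \<in> {0..1}"
  shows "seg (seg x y a) (seg x y b) l = seg x y ((1 - l) * a + l * b)"
proof -
  obtain A f where f: "(A, f) \<in> charts" "x \<in> \<Union>A" "y \<in> \<Union>A" using two_point_chart[OF xy] .
  note a = seg_chart[OF f ab(1)] and b = seg_chart[OF f ab(2)]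
  have "(1 - l) * a + l * b \<in> {0..1}"
    using convexD_alt[of "{0..1::real}" a b l] ab l by auto
  note c = seg_chart[OF f this]
  have "f (seg (seg x y a) (seg x y b) l) = f (seg x y ((1 - l) * a + l * b))"
    unfolding seg_chart(2)[OF f(1) a(1) b(1) l] c(2) a(2) b(2) affine_param ..
  then show ?thesis by (rule chart_inj[OF f(1) seg_chart(1)[OF f(1) a(1) b(1) l] c(1)])
qed

lemma seg_commute:
  assumes xy: "x \<in> pts" "y \<in> pts" and t: "t \<in> {0..1}"
  shows "seg x y t = seg y x (1 - t)"
proof -
  obtain A f where f: "(A, f) \<in> charts" "x \<in> \<Union>A" "y \<in> \<Union>A" using two_point_chart[OF xy] .
  have t': "1 - t \<in> {0..1}" using t by auto
  show ?thesis
    using seg_chart[OF f t] seg_chart[OF f(1,3,2) t'] chart_inj[OF f(1)] by (simp add: add.commute)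
qed

text \<open>For \<open>y\<close> and \<open>y'\<close> in one cell, the triangle \<open>x, y, y'\<close> lies in one chart, where this is the
intercept theorem. In general, add up along the segment from \<open>y\<close> to \<open>y'\<close>.\<close>

lemma seg_thin:
  assumes x: "x \<in> pts" and y: "y \<in> pts" and y': "y' \<in> pts" and t: "t \<in> {0..1}"
  shows "d (seg x y t) (seg x y' t) \<le> t * d y y'"
proof -
  obtain A f where f: "(A, f) \<in> charts" and yy: "y \<in> \<Union>A" "y' \<in> \<Union>A" using two_point_chart[OF y y'] .
  have I: "infnorm \<in> both_norms" by simp
  have "d (seg x y t) (seg x y' t) \<le> t * infnorm (f y' - f y)"
  proof (rule polygonal_chain[OF f I yy, where Q = "\<lambda>p q l. d (seg x p t) (seg x q t) \<le> t * l"])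
    show "d (seg x p t) (seg x q t) \<le> t * infnorm (f q - f p)"
      if S: "S \<in> A" "p \<in> S" "q \<in> S" for S p q
    proof -
      obtain B g where g: "(B, g) \<in> charts" "x \<in> \<Union>B" "S \<in> B"
        using point_and_cell_chart[OF x f S(1)] .
      then have pq: "p \<in> \<Union>B" "q \<in> \<Union>B" using S by auto
      note p' = seg_chart[OF g(1,2) pq(1) t] and q' = seg_chart[OF g(1,2) pq(2) t]
      have "d (seg x p t) (seg x q t) = infnorm (g (seg x p t) - g (seg x q t))"
        by (rule dst_chart[OF g(1) I p'(1) q'(1)])
      also have "g (seg x p t) - g (seg x q t) = t *\<^sub>R (g p - g q)"
        unfolding p'(2) q'(2) by (simp add: algebra_simps)
      also have "infnorm \<dots> = t * infnorm (g q - g p)" using t by (simp add: infnorm_mul infnorm_sub)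
      also have "infnorm (g q - g p) = infnorm (f q - f p)"
        using cell_isometry[OF g(1) f _ S(3,2) I] g S by simp
      finally show ?thesis by simp
    qed
    show "d (seg x p t) (seg x r t) \<le> t * (k + l)"
      if "p \<in> \<Union>A" "q \<in> \<Union>A" "r \<in> \<Union>A" and
        "d (seg x p t) (seg x q t) \<le> t * k" "d (seg x q t) (seg x r t) \<le> t * l" for p q r k l
    proof -
      have "p \<in> pts" "q \<in> pts" "r \<in> pts" using ptsI[OF f] that by auto
      then have "d (seg x p t) (seg x r t) \<le> d (seg x p t) (seg x q t) + d (seg x q t) (seg x r t)"
        by (intro dst_triangle seg_pts x t) auto
      with that show ?thesis by (simp add: distrib_left)
    qed
  qed
  then show ?thesis using dst_chart[OF f I yy] infnorm_sub[of "f y'" "f y"] by simp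
qed

lemma seg_conical:
  assumes "x \<in> pts" "y \<in> pts" "x' \<in> pts" "y' \<in> pts" "t \<in> {0..1}"
  shows "d (seg x y t) (seg x' y' t) \<le> (1 - t) * d x x' + t * d y y'"
proof -
  have t': "1 - t \<in> {0..1}" using assms(5) by auto
  have "d (seg x y t) (seg x' y' t) \<le> d (seg x y t) (seg x y' t) + d (seg x y' t) (seg x' y' t)"
    by (rule dst_triangle[OF _ seg_pts[OF assms(1,2,5)] seg_pts[OF assms(1,4,5)] seg_pts[OF assms(3,4,5)]]) simp
  moreover have "d (seg x y t) (seg x y' t) \<le> t * d y y'" by (rule seg_thin[OF assms(1,2,4,5)])
  moreover have "d (seg x y' t) (seg x' y' t) \<le> (1 - t) * d x x'"
    using seg_thin[OF assms(4,1,3) t'] unfolding seg_commute[OF assms(1,4,5)] seg_commute[OF assms(3,4,5)] .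
  ultimately show ?thesis by simp
qed

text \<open>Subsegments of affine segments are affine, so convexity of the distance follows from the conical
inequality applied to subsegments.\<close>

lemma seg_bicombing:
  assumes M: "M \<subseteq> pts" and clos: "\<And>x y t. x \<in> M \<Longrightarrow> y \<in> M \<Longrightarrow> t \<in> {0..1} \<Longrightarrow> seg x y t \<in> M"
  shows "convex_bicombing M d seg"
  unfolding convex_bicombing_def
proof (intro conjI ballI)
  fix x y assume xy: "x \<in> M" "y \<in> M"
  then have p: "x \<in> pts" "y \<in> pts" using M by auto
  show "seg x y 0 = x" "seg x y 1 = y" using seg_endpoints p by auto
  show "seg x y t \<in> M" if "t \<in> {0..1}" for t using clos xy that by auto
  show "d (seg x y s) (seg x y t) = \<bar>s - t\<bar> * d x y" if "s \<in> {0..1}" "t \<in> {0..1}" for s t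
    using seg_geodesic p that by auto
  show "seg x y t = seg y x (1 - t)" if "t \<in> {0..1}" for t by (rule seg_commute[OF p that])
  show "seg x y (s * t) = seg x (seg x y t) s" if "s \<in> {0..1}" "t \<in> {0..1}" for s t
    using seg_reparam[OF p, of 0 t s] seg_endpoints p that by simp
  fix x' y' assume xy': "x' \<in> M" "y' \<in> M"
  then have p': "x' \<in> pts" "y' \<in> pts" using M by auto
  show "convex_on {0..1} (\<lambda>t. d (seg x y t) (seg x' y' t))"
  proof (rule convex_onI)
    fix l a b :: real assume l: "0 < l" "l < 1" and ab: "a \<in> {0..1}" "b \<in> {0..1}"
    then have l': "l \<in> {0..1}" by auto
    have eq: "seg u v ((1 - l) *\<^sub>R a + l *\<^sub>R b) = seg (seg u v a) (seg u v b) l"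
      if "u \<in> pts" "v \<in> pts" for u v
      using seg_reparam[OF that ab l'] by simp
    show "d (seg x y ((1 - l) *\<^sub>R a + l *\<^sub>R b)) (seg x' y' ((1 - l) *\<^sub>R a + l *\<^sub>R b))
       \<le> (1 - l) * d (seg x y a) (seg x' y' a) + l * d (seg x y b) (seg x' y' b)"
      unfolding eq[OF p] eq[OF p'] by (intro seg_conical seg_pts p p' ab l')
  qed simp
qed

end

section \<open>Uniqueness of convex bicombings\<close>

lemma convex_bicombingD:
  assumes "convex_bicombing M d \<sigma>"
  shows bicombing_in: "x \<in> M \<Longrightarrow> y \<in> M \<Longrightarrow> t \<in> {0..1} \<Longrightarrow> \<sigma> x y t \<in> M"
    and bicombing_start: "x \<in> M \<Longrightarrow> y \<in> M \<Longrightarrow> \<sigma> x y 0 = x"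
    and bicombing_end: "x \<in> M \<Longrightarrow> y \<in> M \<Longrightarrow> \<sigma> x y 1 = y"
    and bicombing_geodesic: "x \<in> M \<Longrightarrow> y \<in> M \<Longrightarrow> s \<in> {0..1} \<Longrightarrow> t \<in> {0..1} \<Longrightarrow>
      d (\<sigma> x y s) (\<sigma> x y t) = \<bar>s - t\<bar> * d x y"
    and bicombing_reverse: "x \<in> M \<Longrightarrow> y \<in> M \<Longrightarrow> t \<in> {0..1} \<Longrightarrow> \<sigma> x y t = \<sigma> y x (1 - t)"
    and bicombing_consistent: "x \<in> M \<Longrightarrow> y \<in> M \<Longrightarrow> s \<in> {0..1} \<Longrightarrow> t \<in> {0..1} \<Longrightarrow>
      \<sigma> x (\<sigma> x y t) s = \<sigma> x y (s * t)"
    and bicombing_convex: "x \<in> M \<Longrightarrow> y \<in> M \<Longrightarrow> x' \<in> M \<Longrightarrow> y' \<in> M \<Longrightarrow>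
      convex_on {0..1} (\<lambda>t. d (\<sigma> x y t) (\<sigma> x' y' t))"
proof -
  note a1 = assms[unfolded convex_bicombing_def]
  note a2 = a1[THEN conjunct2] note a3 = a2[THEN conjunct2] note a4 = a3[THEN conjunct2]
  note seg = a2[THEN conjunct1, THEN bspec, THEN bspec]
  show "x \<in> M \<Longrightarrow> y \<in> M \<Longrightarrow> t \<in> {0..1} \<Longrightarrow> \<sigma> x y t \<in> M"
    by (rule a1[THEN conjunct1, THEN bspec, THEN bspec, THEN bspec])
  show "x \<in> M \<Longrightarrow> y \<in> M \<Longrightarrow> \<sigma> x y 0 = x"
    by (rule seg[THEN conjunct1])
  show "x \<in> M \<Longrightarrow> y \<in> M \<Longrightarrow> \<sigma> x y 1 = y"
    by (rule seg[THEN conjunct2, THEN conjunct1])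
  show "x \<in> M \<Longrightarrow> y \<in> M \<Longrightarrow> s \<in> {0..1} \<Longrightarrow> t \<in> {0..1} \<Longrightarrow>
      d (\<sigma> x y s) (\<sigma> x y t) = \<bar>s - t\<bar> * d x y"
    by (rule seg[THEN conjunct2, THEN conjunct2, THEN bspec, THEN bspec])
  show "x \<in> M \<Longrightarrow> y \<in> M \<Longrightarrow> t \<in> {0..1} \<Longrightarrow> \<sigma> x y t = \<sigma> y x (1 - t)"
    by (rule a3[THEN conjunct1, THEN bspec, THEN bspec, THEN bspec])
  show "x \<in> M \<Longrightarrow> y \<in> M \<Longrightarrow> s \<in> {0..1} \<Longrightarrow> t \<in> {0..1} \<Longrightarrow>
      \<sigma> x (\<sigma> x y t) s = \<sigma> x y (s * t)"
    by (rule a4[THEN conjunct1, THEN bspec, THEN bspec, THEN bspec, THEN bspec, symmetric])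
  show "x \<in> M \<Longrightarrow> y \<in> M \<Longrightarrow> x' \<in> M \<Longrightarrow> y' \<in> M \<Longrightarrow>
      convex_on {0..1} (\<lambda>t. d (\<sigma> x y t) (\<sigma> x' y' t))"
    by (rule a4[THEN conjunct2, THEN bspec, THEN bspec, THEN bspec, THEN bspec])
qed

text \<open>The metric of the main theorem agrees with the chart distance only on the realization.\<close>

lemma convex_bicombing_cong:
  assumes cb: "convex_bicombing M d \<sigma>" and eq: "\<And>x y. x \<in> M \<Longrightarrow> y \<in> M \<Longrightarrow> d' x y = d x y"
  shows "convex_bicombing M d' \<sigma>"
  unfolding convex_bicombing_def
proof (intro conjI ballI)
  fix x y assume xy: "x \<in> M" "y \<in> M"
  note inM = bicombing_in[OF cb]
  show "\<sigma> x y t \<in> M" if "t \<in> {0..1}" for t by (rule inM[OF xy that])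
  show "\<sigma> x y 0 = x" "\<sigma> x y 1 = y" by (rule bicombing_start[OF cb xy] bicombing_end[OF cb xy])+
  show "d' (\<sigma> x y s) (\<sigma> x y t) = \<bar>s - t\<bar> * d' x y" if st: "s \<in> {0..1}" "t \<in> {0..1}" for s t
    using bicombing_geodesic[OF cb xy st] eq[OF inM[OF xy st(1)] inM[OF xy st(2)]] eq[OF xy] by simp
  show "\<sigma> x y t = \<sigma> y x (1 - t)" if "t \<in> {0..1}" for t by (rule bicombing_reverse[OF cb xy that])
  show "\<sigma> x y (s * t) = \<sigma> x (\<sigma> x y t) s" if st: "s \<in> {0..1}" "t \<in> {0..1}" for s t
    by (rule bicombing_consistent[OF cb xy st, symmetric])
  fix x' y' assume xy': "x' \<in> M" "y' \<in> M"
  show "convex_on {0..1} (\<lambda>t. d' (\<sigma> x y t) (\<sigma> x' y' t))"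
  proof (rule convex_onI)
    fix l a b :: real assume l: "0 < l" "l < 1" and ab: "a \<in> {0..1}" "b \<in> {0..1}"
    have c: "(1 - l) *\<^sub>R a + l *\<^sub>R b \<in> {0..1}"
      using convexD_alt[of "{0..1::real}" a b l] ab l by auto
    show "d' (\<sigma> x y ((1 - l) *\<^sub>R a + l *\<^sub>R b)) (\<sigma> x' y' ((1 - l) *\<^sub>R a + l *\<^sub>R b))
       \<le> (1 - l) * d' (\<sigma> x y a) (\<sigma> x' y' a) + l * d' (\<sigma> x y b) (\<sigma> x' y' b)"
      unfolding eq[OF inM[OF xy c] inM[OF xy' c]] eq[OF inM[OF xy ab(1)] inM[OF xy' ab(1)]]
        eq[OF inM[OF xy ab(2)] inM[OF xy' ab(2)]]
      by (rule convex_onD[OF bicombing_convex[OF cb xy xy']]) (use l ab in auto)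
  qed simp
qed

context flat_atlas begin

lemma dst_refl: "N \<in> both_norms \<Longrightarrow> x \<in> pts \<Longrightarrow> dst N x x = 0"
  using dst_eq0 by blast

lemma bicombing_constant:
  assumes cb: "convex_bicombing M d \<sigma>" and M: "M \<subseteq> pts" and z: "z \<in> M" and u: "u \<in> {0..1}"
  shows "\<sigma> z z u = z"
proof -
  have zp: "z \<in> pts" and I: "infnorm \<in> both_norms" using z M by auto
  have "d (\<sigma> z z 0) (\<sigma> z z u) = \<bar>0 - u\<bar> * d z z"
    by (rule bicombing_geodesic[OF cb z z _ u]) simp
  then have "d z (\<sigma> z z u) = 0" using dst_refl[OF I zp] bicombing_start[OF cb z z] by simp
  moreover have "\<sigma> z z u \<in> pts" using bicombing_in[OF cb z z u] M by blast
  ultimately show ?thesis using dst_eq0[OF I zp] by simp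
qed

lemma bicombing_distance_to_point:
  assumes cb: "convex_bicombing M d \<sigma>" and M: "M \<subseteq> pts"
    and z: "z \<in> M" and x: "x \<in> M" and y: "y \<in> M" and t: "t \<in> {0..1}"
  shows "d z (\<sigma> x y t) \<le> (1 - t) * d z x + t * d z y"
proof -
  have "d (\<sigma> z z t) (\<sigma> x y t) \<le> (1 - t) * d (\<sigma> z z 0) (\<sigma> x y 0) + t * d (\<sigma> z z 1) (\<sigma> x y 1)"
    using convex_onD[OF bicombing_convex[OF cb z z x y], of t 0 1] t by simp
  then show ?thesis
    using bicombing_start[OF cb] bicombing_end[OF cb] bicombing_constant[OF cb M z] t x y z by simp
qed

text \<open>From a point at distance \<open>R\<close> in a coordinate direction, the supremum norm only sees that coordinate,
as long as \<open>R\<close> dominates the other differences.\<close>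

lemma coordinate_test_point:
  assumes f: "(A, f) \<in> charts" and x: "x \<in> \<Union>A" and y: "y \<in> \<Union>A"
    and s: "s = 1 \<or> s = -1" and R: "2 * d x y \<le> R" "0 < R"
  obtains z where "z \<in> \<Union>A" "f z = f x + (s * R) *\<^sub>R axis i 1" "d z x = R" "d z y = R + s * (f x $ i - f y $ i)"
proof -
  obtain z where z: "z \<in> \<Union>A" "f z = f x + (s * R) *\<^sub>R axis i 1" using chart_onto[OF f] .
  have inf_eq: "infnorm v = \<bar>v $ i\<bar>" if "\<And>j. \<bar>v $ j\<bar> \<le> \<bar>v $ i\<bar>" for v :: "real^'n"
  proof (rule antisym)
    show "infnorm v \<le> \<bar>v $ i\<bar>" unfolding infnorm_cart by (rule cSup_least) (use that in auto)
  qed (rule component_le_infnorm_cart)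
  have I: "infnorm \<in> both_norms" by simp
  have "d z x = infnorm (f z - f x)" by (rule dst_chart[OF f I z(1) x])
  also have "\<dots> = R" using s R by (subst inf_eq) (auto simp: z(2) axis_def)
  finally have zx: "d z x = R" .
  have "\<bar>(f x - f y) $ j\<bar> \<le> d x y" for j
    using component_le_infnorm_cart[of "f x - f y" j] dst_chart[OF f I x y] by simp
  then have c: "\<bar>f x $ j - f y $ j\<bar> \<le> d x y" for j by simp
  have "d z y = infnorm (f z - f y)" by (rule dst_chart[OF f I z(1) y])
  also have "\<dots> = \<bar>(f z - f y) $ i\<bar>"
  proof (rule inf_eq)
    fix j show "\<bar>(f z - f y) $ j\<bar> \<le> \<bar>(f z - f y) $ i\<bar>"
      using s R c[of i] c[of j] by (auto simp: z(2) axis_def)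
  qed
  also have "\<dots> = R + s * (f x $ i - f y $ i)"
    using s R c[of i] by (auto simp: z(2) axis_def)
  finally show thesis using that z zx by blast
qed

text \<open>The two test points in the directions \<open>e\<^sub>i\<close> and \<open>-e\<^sub>i\<close> confine the \<open>i\<close>-th coordinate of the retraction of
\<open>\<sigma> x y t\<close> to one value. The test points must belong to \<open>M\<close>, hence the sphere of radius \<open>R\<close> around \<open>x\<close>.\<close>

lemma bicombing_locally_seg:
  assumes cb: "convex_bicombing M d \<sigma>" and M: "M \<subseteq> pts" and xM: "x \<in> M" and yM: "y \<in> M"
    and R: "2 * d x y \<le> R" "0 < R" and ball: "\<And>z. z \<in> pts \<Longrightarrow> d z x = R \<Longrightarrow> z \<in> M"
    and t: "t \<in> {0..1}"
  shows "\<sigma> x y t = seg x y t"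
proof -
  have I: "infnorm \<in> both_norms" by simp
  have p: "x \<in> pts" "y \<in> pts" using xM yM M by auto
  obtain A f where f: "(A, f) \<in> charts" and xy: "x \<in> \<Union>A" "y \<in> \<Union>A" using two_point_chart[OF p] .
  note m = seg_chart[OF f xy t]
  define q where "q = \<sigma> x y t"
  have qM: "q \<in> M" unfolding q_def by (rule bicombing_in[OF cb xM yM t])
  then have q: "q \<in> pts" using M by blast
  obtain \<rho> where 1: "\<And>x. x \<in> \<Union>A \<Longrightarrow> \<rho> x = f x"
    and 2: "\<And>z. z \<in> pts \<Longrightarrow> \<rho> z = f (seg x y t) \<Longrightarrow> z = seg x y t"
    and 3: "\<And>N x y. N \<in> both_norms \<Longrightarrow> x \<in> pts \<Longrightarrow> y \<in> pts \<Longrightarrow> N (\<rho> x - \<rho> y) \<le> dst N x y"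
    using point_retraction[OF f m(1)] by blast
  have bound: "s * ((1 - t) * f x $ i + t * f y $ i) \<le> s * \<rho> q $ i" if s: "s = 1 \<or> s = -1" for s i
  proof -
    obtain z where z: "z \<in> \<Union>A" "f z = f x + (s * R) *\<^sub>R axis i 1" "d z x = R"
      "d z y = R + s * (f x $ i - f y $ i)"
      using coordinate_test_point[OF f xy s R] .
    have zp: "z \<in> pts" using ptsI[OF f z(1)] .
    have zM: "z \<in> M" using ball[OF zp z(3)] .
    have "d z q \<le> (1 - t) * R + t * (R + s * (f x $ i - f y $ i))"
      using bicombing_distance_to_point[OF cb M zM xM yM t] z(3,4) by (simp add: q_def)
    moreover have "infnorm (\<rho> z - \<rho> q) \<le> d z q" by (rule 3[OF I zp q])
    moreover have "\<bar>(\<rho> z - \<rho> q) $ i\<bar> \<le> infnorm (\<rho> z - \<rho> q)" by (rule component_le_infnorm_cart)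
    moreover have "(\<rho> z - \<rho> q) $ i = f x $ i + s * R - \<rho> q $ i" using 1[OF z(1)] z(2) by simp
    ultimately have "\<bar>f x $ i + s * R - \<rho> q $ i\<bar> \<le> R + t * (s * (f x $ i - f y $ i))"
      by (simp add: algebra_simps)
    then show ?thesis using s by (auto simp: algebra_simps)
  qed
  have "\<rho> q = f (seg x y t)"
    unfolding m(2)
  proof (rule vec_eq_iff[THEN iffD2], rule allI)
    fix i show "\<rho> q $ i = ((1 - t) *\<^sub>R f x + t *\<^sub>R f y) $ i"
      using bound[of 1 i] bound[of "-1" i] by simp
  qed
  then show ?thesis using 2[OF q] by (simp add: q_def)
qed

text \<open>Consistency and symmetry together say that \<open>\<sigma>\<close> restricts to itself on subintervals: cut at \<open>b\<close> first,
reverse, and cut at \<open>a\<close>.\<close>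

lemma bicombing_reparam:
  assumes cb: "convex_bicombing M d \<sigma>" and M: "M \<subseteq> pts" and x: "x \<in> M" and y: "y \<in> M"
    and ab: "0 \<le> a" "a \<le> b" "b \<le> 1" and l: "l \<in> {0..1}"
  shows "\<sigma> (\<sigma> x y a) (\<sigma> x y b) l = \<sigma> x y ((1 - l) * a + l * b)"
proof -
  note inM = bicombing_in[OF cb] and ends = bicombing_start[OF cb]
    and rev = bicombing_reverse[OF cb] and cons = bicombing_consistent[OF cb]
  show ?thesis
  proof (cases "b = 0")
    case True
    then have "a = 0" using ab by simp
    have "\<sigma> x x l = \<sigma> x (\<sigma> x y 0) l" using ends x y by simp
    also have "\<dots> = \<sigma> x y (l * 0)" by (rule cons) (use x y l in auto)
    finally show ?thesis using True \<open>a = 0\<close> ends x y by simp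
  next
    case False
    define z where "z = \<sigma> x y b"
    define c where "c = a / b"
    have c: "c \<in> {0..1}" "a = c * b" using ab False by (auto simp: c_def)
    have b: "b \<in> {0..1}" using ab by auto
    have z: "z \<in> M" unfolding z_def by (rule inM[OF x y b])
    have c': "1 - c \<in> {0..1}" and l': "1 - l \<in> {0..1}" using c l by auto
    have lc: "(1 - l) * (1 - c) \<in> {0..1}" using c' l' by (auto intro: mult_le_one)
    then have lc': "1 - (1 - l) * (1 - c) \<in> {0..1}" by auto
    have a: "\<sigma> x y a = \<sigma> x z c" unfolding z_def using cons[OF x y c(1) b] c(2) by simp
    have "\<sigma> (\<sigma> x y a) z l = \<sigma> z (\<sigma> x y a) (1 - l)"
      by (rule rev[OF _ z l]) (unfold a, rule inM[OF x z c(1)])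
    also have "\<sigma> z (\<sigma> x y a) (1 - l) = \<sigma> z (\<sigma> z x (1 - c)) (1 - l)"
      unfolding a rev[OF x z c(1)] ..
    also have "\<sigma> z (\<sigma> z x (1 - c)) (1 - l) = \<sigma> z x ((1 - l) * (1 - c))"
      by (rule cons[OF z x l' c'])
    also have "\<dots> = \<sigma> x z (1 - (1 - l) * (1 - c))" by (rule rev[OF z x lc])
    also have "\<dots> = \<sigma> x y ((1 - (1 - l) * (1 - c)) * b)" unfolding z_def by (rule cons[OF x y lc' b])
    also have "(1 - (1 - l) * (1 - c)) * b = (1 - l) * a + l * b" by (simp add: c(2) algebra_simps)
    finally show ?thesis by (simp add: z_def)
  qed
qed

text \<open>The maximum principle, applied at the first index where the maximum is attained.\<close>

lemma discrete_convex_nonpos: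
  fixes h :: "nat \<Rightarrow> real"
  assumes "h 0 = 0" "h N = 0" and conv: "\<And>k. 0 < k \<Longrightarrow> k < N \<Longrightarrow> 2 * h k \<le> h (k - 1) + h (k + 1)"
    and k: "k \<le> N"
  shows "h k \<le> 0"
proof (rule ccontr)
  assume neg: "\<not> h k \<le> 0"
  define m where "m = Max (h ` {..N})"
  have le: "h j \<le> m" if "j \<le> N" for j unfolding m_def using that by (intro Max_ge) auto
  have "m \<in> h ` {..N}" unfolding m_def by (rule Max_in) auto
  then have ex: "\<exists>j. j \<le> N \<and> h j = m" by auto
  define j where "j = (LEAST j. j \<le> N \<and> h j = m)"
  have j: "j \<le> N" "h j = m" using LeastI_ex[OF ex] by (auto simp: j_def)
  have least: "j \<le> i" if "i \<le> N" "h i = m" for i unfolding j_def by (rule Least_le) (use that in simp)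
  have "m > 0" using le[OF k] neg by simp
  then have "0 < j" "j < N" using j assms(1,2) by (metis less_irrefl gr0I, metis le_neq_implies_less less_irrefl)
  moreover have "h (j - 1) \<noteq> m" using least[of "j - 1"] \<open>0 < j\<close> j(1) by linarith
  then have "h (j - 1) < m" using le[of "j - 1"] j(1) by fastforce
  ultimately show False using conv[of j] le[of "j + 1"] j by simp
qed

text \<open>Points of \<open>\<sigma> x y\<close> keep a uniform distance from the boundary of the ball, so short pieces of it are affine
by \<open>bicombing_locally_seg\<close>. On a fine grid the distance between \<open>\<sigma> x y\<close> and the affine segment is
therefore discretely convex; it vanishes at both ends.\<close>

lemma bicombing_unique_in_ball:
  assumes cb: "convex_bicombing M d \<sigma>" and M: "M \<subseteq> pts" and c: "c \<in> M"
    and ball: "\<And>z. z \<in> pts \<Longrightarrow> d c z < r \<Longrightarrow> z \<in> M"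
    and x: "x \<in> pts" "d c x < r" and y: "y \<in> pts" "d c y < r" and t: "t \<in> {0..1}"
  shows "\<sigma> x y t = seg x y t"
proof -
  have I: "infnorm \<in> both_norms" by simp
  have xM: "x \<in> M" and yM: "y \<in> M" using ball x y by auto
  have cp: "c \<in> pts" using c M by auto
  define r1 where "r1 = max (d c x) (d c y)"
  \<comment> \<open>Half of the distance to the boundary, since the ball may be open.\<close>
  define e where "e = (r - r1) / 2"
  have e: "e > 0" using x y by (simp add: e_def r1_def)
  have dxy: "0 \<le> d x y" by (rule dst_nonneg[OF I x(1) y(1)])
  \<comment> \<open>Points at parameter distance \<open>2/N\<close> then have distance at most \<open>e/2\<close>.\<close>
  obtain N0 :: nat where N0: "4 * d x y / e < real N0" using reals_Archimedean2 by blast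
  define N where "N = Suc N0"
  have N: "real N > 0" "4 * d x y / e \<le> real N" using N0 by (simp_all add: N_def)
  have inM: "\<sigma> x y u \<in> M" if "u \<in> {0..1}" for u by (rule bicombing_in[OF cb xM yM that])
  have inp: "\<sigma> x y u \<in> pts" if "u \<in> {0..1}" for u using inM M that by auto
  have near: "d c (\<sigma> x y u) \<le> r1" if u: "u \<in> {0..1}" for u
  proof -
    have "d c (\<sigma> x y u) \<le> (1 - u) * d c x + u * d c y"
      by (rule bicombing_distance_to_point[OF cb M c xM yM u])
    also have "\<dots> \<le> (1 - u) * r1 + u * r1"
      using u by (intro add_mono mult_left_mono) (auto simp: r1_def)
    finally show ?thesis by (simp add: algebra_simps)
  qed
  have loc: "\<sigma> x y ((1 - l) * a + l * b) = seg (\<sigma> x y a) (\<sigma> x y b) l"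
    if ab: "0 \<le> a" "a \<le> b" "b \<le> 1" "b - a \<le> 2 / N" and l: "l \<in> {0..1}" for a b l
  proof -
    have a': "a \<in> {0..1}" and b': "b \<in> {0..1}" using ab by auto
    have "d (\<sigma> x y a) (\<sigma> x y b) = \<bar>a - b\<bar> * d x y"
      by (rule bicombing_geodesic[OF cb xM yM a' b'])
    also have "\<dots> \<le> 2 / N * d x y" using ab dxy by (intro mult_right_mono) auto
    finally have "2 * d (\<sigma> x y a) (\<sigma> x y b) \<le> 4 * d x y / N" by simp
    also have "\<dots> \<le> e" using N e by (simp add: field_simps)
    finally have small: "2 * d (\<sigma> x y a) (\<sigma> x y b) \<le> e" .
    have "\<sigma> (\<sigma> x y a) (\<sigma> x y b) l = seg (\<sigma> x y a) (\<sigma> x y b) l"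
    proof (rule bicombing_locally_seg[OF cb M inM[OF a'] inM[OF b'] small e _ l])
      fix z assume z: "z \<in> pts" "d z (\<sigma> x y a) = e"
      have "d c z \<le> d c (\<sigma> x y a) + d (\<sigma> x y a) z" by (rule dst_triangle[OF I cp inp[OF a'] z(1)])
      also have "\<dots> \<le> r1 + e" using near[OF a'] z(2) dst_commute[OF I inp[OF a'] z(1)] by simp
      also have "\<dots> < r" using e by (simp add: e_def field_simps)
      finally show "z \<in> M" by (rule ball[OF z(1)])
    qed
    then show ?thesis using bicombing_reparam[OF cb M xM yM ab(1-3) l] by simp
  qed
  define h where "h k = d (\<sigma> x y (k / N)) (seg x y (k / N))" for k :: nat
  have node: "real k / N \<in> {0..1}" if "k \<le> N" for k using that N by (simp add: field_simps)
  have h0: "h k = 0" if k: "k \<le> N" for k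
  proof -
    have "h k \<le> 0"
    proof (rule discrete_convex_nonpos[where N = N])
      show "h 0 = 0" using bicombing_start[OF cb xM yM] seg_endpoints[OF x(1) y(1)] dst_refl[OF I x(1)]
        by (simp add: h_def)
      show "h N = 0" using bicombing_end[OF cb xM yM] seg_endpoints[OF x(1) y(1)] dst_refl[OF I y(1)] N
        by (simp add: h_def)
      show "2 * h k \<le> h (k - 1) + h (k + 1)" if k: "0 < k" "k < N" for k
      proof -
        define a b where "a = real (k - 1) / N" and "b = real (k + 1) / N"
        have mid: "real k / N = (1 - 1/2) * a + (1/2) * b" and gap: "b - a \<le> 2 / N"
          using k N by (simp_all add: a_def b_def field_simps of_nat_diff)
        have a: "a \<in> {0..1}" and b: "b \<in> {0..1}" unfolding a_def b_def by (rule node; use k in simp)+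
        have "a \<le> b" unfolding a_def b_def using N by (intro divide_right_mono) auto
        have half: "1/2 \<in> {0..1::real}" by simp
        have "\<sigma> x y (real k / N) = seg (\<sigma> x y a) (\<sigma> x y b) (1/2)"
          unfolding mid by (rule loc) (use a b gap \<open>a \<le> b\<close> in auto)
        moreover have "seg x y (real k / N) = seg (seg x y a) (seg x y b) (1/2)"
          unfolding mid by (rule seg_reparam[OF x(1) y(1) a b half, symmetric])
        ultimately have "h k \<le> (1 - 1/2) * h (k - 1) + (1/2) * h (k + 1)"
          unfolding h_def a_def[symmetric] b_def[symmetric]
          using seg_conical[OF inp[OF a] inp[OF b] seg_pts[OF x(1) y(1) a] seg_pts[OF x(1) y(1) b] half]
          by simp
        then show ?thesis by simp
      qed
    qed (rule k)
    moreover have "0 \<le> h k"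
      unfolding h_def using node[OF k] by (intro dst_nonneg I inp seg_pts x(1) y(1))
    ultimately show ?thesis by simp
  qed
  have eq: "\<sigma> x y (k / N) = seg x y (k / N)" if "k \<le> N" for k :: nat
    using h0[OF that] dst_eq0[OF I inp[OF node[OF that]] seg_pts[OF x(1) y(1) node[OF that]]]
    by (simp add: h_def)
  define k where "k = nat \<lfloor>t * N\<rfloor>"
  have k: "real k \<le> t * N" "t * N < real k + 1" using t N by (auto simp: k_def)
  show ?thesis
  proof (cases "k < N")
    case True
    define l where "l = t * N - k"
    define a b where "a = real k / N" and "b = real (k + 1) / N"
    have l: "l \<in> {0..1}" using k by (auto simp: l_def)
    have tt: "t = (1 - l) * a + l * b"
      using N by (simp add: l_def a_def b_def field_simps)
    have a: "a \<in> {0..1}" and b: "b \<in> {0..1}" unfolding a_def b_def by (rule node; use True in simp)+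
    have ab: "a \<le> b" "b - a \<le> 2 / N" unfolding a_def b_def using N by (simp_all add: field_simps)
    have "\<sigma> x y t = seg (\<sigma> x y a) (\<sigma> x y b) l"
      unfolding tt by (rule loc) (use a b ab l in auto)
    also have "\<dots> = seg (seg x y a) (seg x y b) l"
      unfolding a_def b_def using eq[of k] eq[of "k + 1"] True by simp
    also have "\<dots> = seg x y t" unfolding tt by (rule seg_reparam[OF x(1) y(1) a b l])
    finally show ?thesis .
  next
    case False
    have "t * real N \<le> real N" using t N mult_right_mono[of t 1 "real N"] by simp
    moreover have "real N \<le> real k" using False by simp
    ultimately have "t * real N = real N" using k(1) by linarith
    then have "t = 1" using N by simp
    then show ?thesis using bicombing_end[OF cb xM yM] seg_endpoints[OF x(1) y(1)] by simp
  qed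
qed

text \<open>Covers open and closed balls at once. Contracting towards the centre moves every point of \<open>M\<close> into the open
ball, where both bicombings agree, and both depend continuously on the endpoints.\<close>

lemma ball_unique_bicombing:
  assumes M: "M \<subseteq> pts" and c: "c \<in> pts" and r: "0 < r"
    and inner: "\<And>z. z \<in> pts \<Longrightarrow> d c z < r \<Longrightarrow> z \<in> M" and outer: "\<And>z. z \<in> M \<Longrightarrow> d c z \<le> r"
    and clos: "\<And>x y t. x \<in> M \<Longrightarrow> y \<in> M \<Longrightarrow> t \<in> {0..1} \<Longrightarrow> seg x y t \<in> M"
  shows "has_unique_convex_bicombing M d"
proof -
  have I: "infnorm \<in> both_norms" by simp
  have cM: "c \<in> M" using inner[OF c] dst_refl[OF I c] r by simp
  have uniq: "\<sigma> x y t = seg x y t"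
    if cb: "convex_bicombing M d \<sigma>" and xM: "x \<in> M" and yM: "y \<in> M" and t: "t \<in> {0..1}" for \<sigma> x y t
  proof -
    have x: "x \<in> pts" and y: "y \<in> pts" using xM yM M by auto
    have close: "d (\<sigma> x y t) (seg x y t) \<le> (2 * r) * e" if e: "0 < e" "e < 1" for e
    proof -
      define x' y' where "x' = seg c x (1 - e)" and "y' = seg c y (1 - e)"
      have e': "1 - e \<in> {0..1}" and 01: "0 \<in> {0..1::real}" "1 \<in> {0..1::real}" using e by auto
      have toward: "seg c z (1 - e) \<in> pts" "d c (seg c z (1 - e)) < r" "d z (seg c z (1 - e)) \<le> e * r"
        if zM: "z \<in> M" for z
      proof -
        have z: "z \<in> pts" using zM M by auto
        show "seg c z (1 - e) \<in> pts" by (rule seg_pts[OF c z e'])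
        have 0: "0 \<le> d c z" by (rule dst_nonneg[OF I c z])
        have "d c (seg c z (1 - e)) = (1 - e) * d c z"
          using seg_geodesic[OF c z 01(1) e'] seg_endpoints[OF c z] e by simp
        also have "\<dots> \<le> (1 - e) * r" using outer[OF zM] e by (intro mult_left_mono) auto
        also have "\<dots> < r" using e r by simp
        finally show "d c (seg c z (1 - e)) < r" .
        have "d z (seg c z (1 - e)) = e * d c z"
          using seg_geodesic[OF c z 01(2) e'] seg_endpoints[OF c z] e by simp
        also have "\<dots> \<le> e * r" using outer[OF zM] e by (intro mult_left_mono) auto
        finally show "d z (seg c z (1 - e)) \<le> e * r" .
      qed
      have x': "x' \<in> pts" "d c x' < r" "d x x' \<le> e * r" unfolding x'_def by (rule toward[OF xM])+
      have y': "y' \<in> pts" "d c y' < r" "d y y' \<le> e * r" unfolding y'_def by (rule toward[OF yM])+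
      have x'M: "x' \<in> M" and y'M: "y' \<in> M" using inner x' y' by auto
      have same: "\<sigma> x' y' t = seg x' y' t"
        by (rule bicombing_unique_in_ball[OF cb M cM inner x'(1,2) y'(1,2) t])
      have avg: "(1 - t) * d x x' + t * d y y' \<le> e * r"
        using convex_bound_le[OF x'(3) y'(3), of "1 - t" t] t by simp
      have "d (\<sigma> x y t) (\<sigma> x' y' t) \<le> (1 - t) * d (\<sigma> x y 0) (\<sigma> x' y' 0) + t * d (\<sigma> x y 1) (\<sigma> x' y' 1)"
        using convex_onD[OF bicombing_convex[OF cb xM yM x'M y'M], of t 0 1] t by simp
      then have A: "d (\<sigma> x y t) (\<sigma> x' y' t) \<le> e * r"
        using bicombing_start[OF cb] bicombing_end[OF cb] avg xM yM x'M y'M by simp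
      have "d (seg x y t) (seg x' y' t) \<le> e * r"
        using seg_conical[OF x y x'(1) y'(1) t] avg by simp
      then have B: "d (seg x' y' t) (seg x y t) \<le> e * r"
        using dst_commute[OF I seg_pts[OF x y t] seg_pts[OF x'(1) y'(1) t]] by simp
      have "\<sigma> x y t \<in> pts" using bicombing_in[OF cb xM yM t] M by blast
      from dst_triangle[OF I this seg_pts[OF x'(1) y'(1) t] seg_pts[OF x y t]] A B same
      show ?thesis by (simp add: algebra_simps)
    qed
    have p: "\<sigma> x y t \<in> pts" using bicombing_in[OF cb xM yM t] M by blast
    have "d (\<sigma> x y t) (seg x y t) \<le> 0"
    proof (rule ccontr)
      assume "\<not> d (\<sigma> x y t) (seg x y t) \<le> 0"
      define D where "D = d (\<sigma> x y t) (seg x y t)"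
      have D: "D > 0" using \<open>\<not> _\<close> by (simp add: D_def)
      define e where "e = min (1/2) (D / (4 * r))"
      have e: "0 < e" "e < 1" using D r by (auto simp: e_def)
      have "D \<le> 2 * r * e" using close[OF e] by (simp add: D_def)
      also have "\<dots> \<le> 2 * r * (D / (4 * r))" using r by (intro mult_left_mono) (auto simp: e_def)
      also have "\<dots> = D / 2" using r by simp
      finally show False using D by simp
    qed
    then show ?thesis
      using dst_nonneg[OF I p seg_pts[OF x y t]] dst_eq0[OF I p seg_pts[OF x y t]] by simp
  qed
  show ?thesis
    unfolding has_unique_convex_bicombing_def
    using seg_bicombing[OF M clos] uniq by (intro conjI exI[of _ seg]) (simp, metis)
qed

text \<open>In the whole space all test points are available.\<close>

lemma whole_unique_bicombing: "has_unique_convex_bicombing pts d"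
proof -
  have uniq: "\<sigma> x y t = seg x y t"
    if cb: "convex_bicombing pts d \<sigma>" and "x \<in> pts" "y \<in> pts" and t: "t \<in> {0..1}" for \<sigma> x y t
  proof (rule bicombing_locally_seg[OF cb order_refl that(2,3) _ _ _ t])
    show "2 * d x y \<le> 2 * d x y + 1" by simp
    show "0 < 2 * d x y + 1" using dst_nonneg[of infnorm x y] that by simp
  qed
  show ?thesis
    unfolding has_unique_convex_bicombing_def
    using seg_bicombing[OF order_refl seg_pts] uniq by (intro conjI exI[of _ seg]) (simp, metis)
qed

text \<open>Balls are closed under affine segments, because the distance to the centre is convex along these.\<close>

theorem CUB_pts:
  assumes dp: "\<And>x y. x \<in> pts \<Longrightarrow> y \<in> pts \<Longrightarrow> dp x y = d x y"
    and out: "\<And>x y. x \<notin> pts \<or> y \<notin> pts \<Longrightarrow> dp x y = 0"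
  shows "CUB pts dp"
proof -
  have I: "infnorm \<in> both_norms" by simp
  have ms: "Metric_space pts dp"
  proof
    fix x y z
    show "0 \<le> dp x y" using dp out dst_nonneg[OF I] by (cases "x \<in> pts \<and> y \<in> pts") auto
    show "dp x y = dp y x"
      by (cases "x \<in> pts \<and> y \<in> pts") (use dp out dst_commute[OF I, of x y] in auto)
    show "x \<in> pts \<Longrightarrow> y \<in> pts \<Longrightarrow> dp x y = 0 \<longleftrightarrow> x = y" using dp dst_eq0[OF I] by simp
    show "x \<in> pts \<Longrightarrow> y \<in> pts \<Longrightarrow> z \<in> pts \<Longrightarrow> dp x z \<le> dp x y + dp y z"
      using dp dst_triangle[OF I] by simp
  qed
  then interpret Metric_space pts dp .
  have cong: "has_unique_convex_bicombing M dp" if "has_unique_convex_bicombing M d" "M \<subseteq> pts" for M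
  proof -
    have "dp x y = d x y" if "x \<in> M" "y \<in> M" for x y using dp that \<open>M \<subseteq> pts\<close> by blast
    then have "convex_bicombing M dp \<sigma> \<longleftrightarrow> convex_bicombing M d \<sigma>" for \<sigma>
      using convex_bicombing_cong[of M d \<sigma> dp] convex_bicombing_cong[of M dp \<sigma> d] by metis
    then show ?thesis using that by (simp add: has_unique_convex_bicombing_def)
  qed
  have seg_dist: "d c (seg x y t) \<le> max (d c x) (d c y)"
    if c: "c \<in> pts" and x: "x \<in> pts" and y: "y \<in> pts" and t: "t \<in> {0..1}" for c x y t
  proof -
    have "d c (seg x y t) \<le> (1 - t) * d c x + t * d c y"
      by (rule bicombing_distance_to_point[OF seg_bicombing[OF order_refl seg_pts] order_refl c x y t])
    also have "\<dots> \<le> max (d c x) (d c y)"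
      using convex_bound_le[of "d c x" "max (d c x) (d c y)" "d c y" "1 - t" t] t by simp
    finally show ?thesis .
  qed
  have balls: "has_unique_convex_bicombing (mball c r) dp" "has_unique_convex_bicombing (mcball c r) dp"
    if c: "c \<in> pts" and r: "0 < r" for c r
  proof -
    have "has_unique_convex_bicombing (mball c r) d"
    proof (rule ball_unique_bicombing[OF _ c r])
      fix x y t assume *: "x \<in> mball c r" "y \<in> mball c r" "t \<in> {0..1::real}"
      then show "seg x y t \<in> mball c r" using seg_dist[of c x y t] seg_pts[of x y t] dp by auto
    qed (use dp c in \<open>auto\<close>)
    then show "has_unique_convex_bicombing (mball c r) dp" by (rule cong) auto
    have "has_unique_convex_bicombing (mcball c r) d"
    proof (rule ball_unique_bicombing[OF _ c r])
      fix x y t assume *: "x \<in> mcball c r" "y \<in> mcball c r" "t \<in> {0..1::real}"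
      then show "seg x y t \<in> mcball c r" using seg_dist[of c x y t] seg_pts[of x y t] dp by auto
    qed (use dp c in \<open>auto\<close>)
    then show "has_unique_convex_bicombing (mcball c r) dp" by (rule cong) auto
  qed
  show ?thesis
    unfolding CUB_def using ms cong[OF whole_unique_bicombing] balls by blast
qed

end

section \<open>Flags of integer points\<close>

text \<open>A frame describes a flag of integer points: a starting point \<open>b\<close> with even coordinates, the direction
\<open>s i\<close> in which the \<open>i\<close>-th coordinate moves, and its rank \<open>r i\<close> in the order of the moves.\<close>

definition frame :: "real^'n \<Rightarrow> real^'n \<Rightarrow> ('n::finite \<Rightarrow> nat) \<Rightarrow> bool" where
  "frame b s r \<longleftrightarrow> (\<forall>i. \<exists>z::int. b $ i = 2 * of_int z) \<and> (\<forall>i. s $ i = 1 \<or> s $ i = -1) \<and>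
     bij_betw r UNIV {..<CARD('n)}"

text \<open>The \<open>k\<close>-th point of the flag, reached after the moves of rank less than \<open>k\<close>. For \<open>k \<le> n\<close> it has \<open>k\<close>
odd coordinates.\<close>

definition fvert :: "real^'n \<Rightarrow> real^'n \<Rightarrow> ('n::finite \<Rightarrow> nat) \<Rightarrow> nat \<Rightarrow> real^'n" where
  "fvert b s r k = (\<chi> i. b $ i + (if r i < k then s $ i else 0))"

text \<open>The vertices of the alcove of type \<open>ty\<close> that contains the flag, in unscaled coordinates. In type \<open>C\<close> the
flag spans the alcove. If the diagram has a fork at one end, the alcove also contains the mirror image of the
flag at that end: the point next to the end is the midpoint of an edge, and the reflection of the
end point in it takes its place among the vertices.\<close>

definition cvert :: "affine_type \<Rightarrow> real^'n \<Rightarrow> real^'n \<Rightarrow> ('n::finite \<Rightarrow> nat) \<Rightarrow> nat \<Rightarrow> real^'n" where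
  "cvert ty b s r k = (1/2) *\<^sub>R
     (if ty \<noteq> AffC \<and> k = 1 then 2 *\<^sub>R fvert b s r 1 - fvert b s r 0
      else if ty = AffD \<and> k = CARD('n) - 1 then 2 *\<^sub>R fvert b s r k - fvert b s r (CARD('n))
      else fvert b s r k)"

text \<open>The coordinates adapted to a frame, in which the flag spans
\<open>{1 \<ge> y\<^sub>0 \<ge> \<dots> \<ge> y\<^bsub>n-1\<^esub> \<ge> 0}\<close>, where \<open>y\<^sub>k\<close> belongs to the index of rank \<open>k\<close>. The point \<open>x\<close> is unscaled.\<close>

definition fcoord :: "real^'n \<Rightarrow> real^'n \<Rightarrow> real^'n \<Rightarrow> 'n::finite \<Rightarrow> real" where
  "fcoord b s x i = s $ i * (2 * x $ i - b $ i)"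

lemma frame_sgn: "frame b s r \<Longrightarrow> s $ i = 1 \<or> s $ i = -1"
  and frame_even: "frame b s r \<Longrightarrow> \<exists>z::int. b $ i = 2 * of_int z"
  and frame_bij: "frame b s r \<Longrightarrow> bij_betw r UNIV {..<CARD('n)}"
  for b s :: "real^'n::finite"
  by (auto simp: frame_def)

lemma frame_rank_less: "frame b s r \<Longrightarrow> r i < CARD('n)" for b s :: "real^'n::finite"
  using bij_betwE[OF frame_bij] by auto

lemma frame_rank_inj: "frame b s r \<Longrightarrow> r i = r j \<longleftrightarrow> i = j" for b s :: "real^'n::finite"
  using bij_betw_imp_inj_on[OF frame_bij] by (auto dest: injD)

lemma frame_rank_onto:
  fixes b s :: "real^'n::finite"
  assumes "frame b s r" "k < CARD('n)" obtains i where "r i = k"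
  using bij_betw_imp_surj_on[OF frame_bij[OF assms(1)]] assms(2) by (metis imageE lessThan_iff)

lemma exists_ranking:
  fixes u :: "'a \<Rightarrow> real"
  assumes "finite S"
  shows "\<exists>r. bij_betw r S {..<card S} \<and> (\<forall>i\<in>S. \<forall>j\<in>S. r i < r j \<longrightarrow> u j \<le> u i)"
  using assms
proof (induction S rule: finite_ranking_induct[where f = "\<lambda>i. - u i"])
  case empty then show ?case by (simp add: bij_betw_def)
next
  case (insert x S)
  show ?case
  proof (cases "x \<in> S")
    case True then show ?thesis using insert by (simp add: insert_absorb)
  next
    case False
    obtain r where r: "bij_betw r S {..<card S}" "\<forall>i\<in>S. \<forall>j\<in>S. r i < r j \<longrightarrow> u j \<le> u i"
      using insert.IH by blast
    have lt: "r i < card S" if "i \<in> S" for i using bij_betwE[OF r(1)] that by auto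
    have "bij_betw (r(x := card S)) {x} {card S}" by simp
    moreover have "bij_betw (r(x := card S)) S {..<card S}"
      using r(1) False by (subst bij_betw_cong[where g = r]) auto
    ultimately have "bij_betw (r(x := card S)) ({x} \<union> S) ({card S} \<union> {..<card S})"
      by (rule bij_betw_combine) simp
    then have "bij_betw (r(x := card S)) (insert x S) {..<card (insert x S)}"
      using False insert.hyps(1) by (simp add: lessThan_Suc Un_commute)
    moreover have "\<forall>i\<in>insert x S. \<forall>j\<in>insert x S. (r(x := card S)) i < (r(x := card S)) j \<longrightarrow> u j \<le> u i"
      using r(2) lt False insert.hyps(2) by (auto dest: less_asym')
    ultimately show ?thesis by blast
  qed
qed

text \<open>Take the nearest even integers as starting point and sort the coordinates by their distance to them.\<close>

lemma point_frame:
  fixes x :: "real^'n::finite"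
  obtains b s r where "frame b s r" "\<And>i. 0 \<le> fcoord b s x i" "\<And>i. fcoord b s x i \<le> 1"
    "\<And>i j. r i < r j \<Longrightarrow> fcoord b s x j \<le> fcoord b s x i"
proof -
  define b :: "real^'n" where "b = (\<chi> i. 2 * of_int (round (x $ i)))"
  define s :: "real^'n" where "s = (\<chi> i. if 2 * x $ i \<ge> b $ i then 1 else -1)"
  obtain r where r: "bij_betw r UNIV {..<CARD('n)}" "\<forall>i j. r i < r j \<longrightarrow> fcoord b s x j \<le> fcoord b s x i"
    using exists_ranking[of "UNIV :: 'n set" "fcoord b s x"] by auto
  have abs: "fcoord b s x i = \<bar>2 * x $ i - b $ i\<bar>" for i by (simp add: fcoord_def s_def)
  have "\<bar>2 * x $ i - b $ i\<bar> \<le> 1" for i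
    using of_int_round_abs_le[of "x $ i"] unfolding b_def vec_lambda_beta by linarith
  moreover have "frame b s r" using r(1) by (auto simp: frame_def b_def s_def)
  ultimately show thesis using that[of b s r] r(2) abs by auto
qed

text \<open>The adapted coordinates in decreasing order, completed by \<open>1\<close> at index \<open>0\<close> and by \<open>0\<close> at index \<open>n + 1\<close>.
Their successive differences are the barycentric coordinates with respect to the flag.\<close>

definition levels :: "('n::finite \<Rightarrow> nat) \<Rightarrow> ('n \<Rightarrow> real) \<Rightarrow> nat \<Rightarrow> real" where
  "levels r y k = (if k = 0 then 1 else if k \<le> CARD('n) then y (inv r (k - 1)) else 0)"

definition bary :: "('n::finite \<Rightarrow> nat) \<Rightarrow> ('n \<Rightarrow> real) \<Rightarrow> nat \<Rightarrow> real" where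
  "bary r y k = levels r y k - levels r y (Suc k)"

text \<open>Used with barycentric coordinates: the weights after index \<open>m\<close> add up to the coordinate of rank \<open>m\<close>.\<close>

lemma tail_telescope:
  fixes Z :: "nat \<Rightarrow> real"
  assumes "m \<le> n"
  shows "(\<Sum>k\<le>n. if m < k then Z k - Z (Suc k) else 0) = Z (Suc m) - Z (Suc n)"
  using assms
proof (induction n)
  case (Suc n)
  show ?case
  proof (cases "m \<le> n")
    case False
    then have "m = Suc n" using Suc.prems by simp
    then show ?thesis by (auto intro!: sum.neutral)
  qed (use Suc in simp)
qed auto

lemma levels_rank:
  fixes b s :: "real^'n::finite"
  assumes "frame b s r" shows "levels r y (Suc (r i)) = y i"
  using frame_rank_less[OF assms, of i] bij_betw_imp_inj_on[OF frame_bij[OF assms]]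
  by (simp add: levels_def)

lemma bary_sum: "(\<Sum>k\<le>CARD('n). bary (r :: 'n::finite \<Rightarrow> nat) y k) = 1"
  using sum_telescope[of "levels r y" "CARD('n)"] by (simp add: bary_def levels_def)

lemma fvert_combination:
  fixes b s :: "real^'n::finite"
  assumes f: "frame b s r" and u: "(\<Sum>k\<le>CARD('n). u k) = 1"
  shows "(\<Sum>k\<le>CARD('n). u k *\<^sub>R fvert b s r k) $ i = b $ i + s $ i * (\<Sum>k\<le>CARD('n). if r i < k then u k else 0)"
proof -
  have "(\<Sum>k\<le>CARD('n). u k *\<^sub>R fvert b s r k) $ i = (\<Sum>k\<le>CARD('n). u k * b $ i + s $ i * (if r i < k then u k else 0))"
    by (simp add: fvert_def algebra_simps cong: sum.cong if_cong) (intro sum.cong, auto simp: algebra_simps)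
  also have "\<dots> = (\<Sum>k\<le>CARD('n). u k) * b $ i + s $ i * (\<Sum>k\<le>CARD('n). if r i < k then u k else 0)"
    by (simp add: sum.distrib sum_distrib_left sum_distrib_right)
  finally show ?thesis using u by simp
qed

lemma bary_combination:
  fixes b s x :: "real^'n::finite"
  assumes f: "frame b s r"
  shows "(\<Sum>k\<le>CARD('n). bary r (fcoord b s x) k *\<^sub>R fvert b s r k) = 2 *\<^sub>R x"
proof (rule vec_eq_iff[THEN iffD2], rule allI)
  fix i
  have "(\<Sum>k\<le>CARD('n). if r i < k then bary r (fcoord b s x) k else 0) = fcoord b s x i"
    using tail_telescope[of "r i" "CARD('n)" "levels r (fcoord b s x)"] frame_rank_less[OF f, of i]
      levels_rank[OF f, of "fcoord b s x" i] by (simp add: bary_def levels_def cong: if_cong)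
  then show "(\<Sum>k\<le>CARD('n). bary r (fcoord b s x) k *\<^sub>R fvert b s r k) $ i = (2 *\<^sub>R x) $ i"
    using fvert_combination[OF f bary_sum[of r "fcoord b s x"], of i] frame_sgn[OF f, of i]
    by (auto simp: fcoord_def)
qed

lemma bary_nonneg:
  fixes b s :: "real^'n::finite"
  assumes f: "frame b s r" and "\<And>i. 0 \<le> y i" "\<And>i. y i \<le> 1" "\<And>i j. r i < r j \<Longrightarrow> y j \<le> y i"
    and k: "k \<le> CARD('n)"
  shows "0 \<le> bary r y k"
proof -
  have inv: "r (inv r m) = m" if "m < CARD('n)" for m
    using frame_bij[OF f] that by (metis bij_betw_imp_surj_on f_inv_into_f lessThan_iff)
  consider "k = 0" | "0 < k" "k < CARD('n)" | "k = CARD('n)" "0 < k" using k by linarith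
  then show ?thesis
  proof cases
    case 2
    then show ?thesis using assms(4)[of "inv r (k - 1)" "inv r k"] inv[of k] inv[of "k - 1"]
      by (simp add: bary_def levels_def)
  qed (use assms in \<open>auto simp: bary_def levels_def\<close>)
qed

section \<open>Alcoves\<close>

lemma mem_walls:
  "x \<in> \<Union>(walls ty) \<longleftrightarrow>
     (\<exists>i j. i \<noteq> j \<and> (x $ i + x $ j \<in> \<int> \<or> x $ i - x $ j \<in> \<int>)) \<or>
     (case ty of AffD \<Rightarrow> False | AffB \<Rightarrow> (\<exists>i. x $ i \<in> \<int>) | AffC \<Rightarrow> (\<exists>i. 2 * x $ i \<in> \<int>))"
proof -
  have half: "2 * a \<in> \<int> \<longleftrightarrow> (\<exists>k::int. a = of_int k / 2)" for a :: real
    by (auto elim!: Ints_cases simp: field_simps)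
  have int: "a \<in> \<int> \<longleftrightarrow> (\<exists>k::int. a = of_int k)" for a :: real by (auto simp: Ints_def)
  have pl: "x \<in> \<Union>{{x. x $ i + x $ j = of_int k} | i j k. i \<noteq> j} \<longleftrightarrow> (\<exists>i j. i \<noteq> j \<and> x $ i + x $ j \<in> \<int>)"
    unfolding int by blast
  have mi: "x \<in> \<Union>{{x. x $ i - x $ j = of_int k} | i j k. i \<noteq> j} \<longleftrightarrow> (\<exists>i j. i \<noteq> j \<and> x $ i - x $ j \<in> \<int>)"
    unfolding int by blast
  have B: "x \<in> \<Union>{{x. x $ i = of_int k} | i k. True} \<longleftrightarrow> (\<exists>i. x $ i \<in> \<int>)"
    unfolding int by blast
  have C: "x \<in> \<Union>{{x. x $ i = of_int k / 2} | i k. True} \<longleftrightarrow> (\<exists>i. 2 * x $ i \<in> \<int>)"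
    unfolding half by blast
  show ?thesis unfolding walls_def Union_Un_distrib Un_iff pl mi
    by (cases ty) (simp_all only: affine_type.case B C Union_empty empty_iff, blast+)
qed

text \<open>The translation by \<open>b/2\<close> and the sign changes \<open>s\<close> permute the walls.\<close>

lemma walls_frame:
  fixes b s x :: "real^'n::finite"
  assumes f: "frame b s r"
  shows "x \<in> \<Union>(walls ty) \<longleftrightarrow>
     (\<exists>i j. i \<noteq> j \<and> ((fcoord b s x i + fcoord b s x j) / 2 \<in> \<int> \<or> (fcoord b s x i - fcoord b s x j) / 2 \<in> \<int>)) \<or>
     (case ty of AffD \<Rightarrow> False | AffB \<Rightarrow> (\<exists>i. fcoord b s x i / 2 \<in> \<int>) | AffC \<Rightarrow> (\<exists>i. fcoord b s x i \<in> \<int>))"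
proof -
  define \<beta> where "\<beta> i = b $ i / 2" for i
  have \<beta>: "\<beta> i \<in> \<int>" for i using frame_even[OF f, of i] by (auto simp: \<beta>_def)
  have y: "fcoord b s x i / 2 = s $ i * (x $ i - \<beta> i)" for i by (simp add: fcoord_def \<beta>_def field_simps)
  have neg: "- a \<in> \<int> \<longleftrightarrow> a \<in> \<int>" for a :: real using Ints_minus[of a] Ints_minus[of "- a"] by auto
  have shift: "a - c \<in> \<int> \<longleftrightarrow> a \<in> \<int>" if "c \<in> \<int>" for a c :: real
    by (metis Ints_add Ints_diff diff_add_cancel that)
  have one: "fcoord b s x i / 2 \<in> \<int> \<longleftrightarrow> x $ i \<in> \<int>" for i
    unfolding y using frame_sgn[OF f, of i] neg[of "x $ i - \<beta> i"] shift[OF \<beta>, of "x $ i" i] by auto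
  have two: "fcoord b s x i \<in> \<int> \<longleftrightarrow> 2 * x $ i \<in> \<int>" for i
  proof -
    have "2 * \<beta> i \<in> \<int>" using \<beta> by simp
    from shift[OF this, of "2 * x $ i"] show ?thesis
      using frame_sgn[OF f, of i] neg[of "2 * x $ i - 2 * \<beta> i"] by (auto simp: fcoord_def \<beta>_def)
  qed
  have pair: "(fcoord b s x i + fcoord b s x j) / 2 \<in> \<int> \<or> (fcoord b s x i - fcoord b s x j) / 2 \<in> \<int> \<longleftrightarrow>
      x $ i + x $ j \<in> \<int> \<or> x $ i - x $ j \<in> \<int>" for i j
  proof -
    have P: "(x $ i - \<beta> i) + (x $ j - \<beta> j) \<in> \<int> \<longleftrightarrow> x $ i + x $ j \<in> \<int>"
      using shift[of "\<beta> i + \<beta> j" "x $ i + x $ j"] \<beta> by (simp add: algebra_simps)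
    have Q: "(x $ i - \<beta> i) - (x $ j - \<beta> j) \<in> \<int> \<longleftrightarrow> x $ i - x $ j \<in> \<int>"
      using shift[of "\<beta> i - \<beta> j" "x $ i - x $ j"] \<beta> by (simp add: algebra_simps)
    have e: "(fcoord b s x i + fcoord b s x j) / 2 = s $ i * (x $ i - \<beta> i) + s $ j * (x $ j - \<beta> j)"
      "(fcoord b s x i - fcoord b s x j) / 2 = s $ i * (x $ i - \<beta> i) - s $ j * (x $ j - \<beta> j)"
      using y[of i] y[of j] by (simp_all add: field_simps)
    define u v where "u = x $ i - \<beta> i" and "v = x $ j - \<beta> j"
    have "(s $ i * u + s $ j * v \<in> \<int> \<or> s $ i * u - s $ j * v \<in> \<int>) \<longleftrightarrow> (u + v \<in> \<int> \<or> u - v \<in> \<int>)"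
      using frame_sgn[OF f, of i] frame_sgn[OF f, of j] neg[of "u + v"] neg[of "u - v"] by auto
    then show ?thesis unfolding e using P Q by (simp add: u_def v_def)
  qed
  show ?thesis unfolding mem_walls pair one two ..
qed

text \<open>Each of these affine functions vanishes only on walls, so it keeps its sign on every connected set
that avoids the walls.\<close>

definition alcove_ineqs :: "affine_type \<Rightarrow> real^'n \<Rightarrow> real^'n \<Rightarrow> ('n::finite \<Rightarrow> nat) \<Rightarrow> (real^'n \<Rightarrow> real) set" where
  "alcove_ineqs ty b s r =
     (\<lambda>(i, j) x. fcoord b s x i - fcoord b s x j) ` {(i, j). r i < r j} \<union>
     (case ty of
        AffC \<Rightarrow> range (\<lambda>i x. fcoord b s x i) \<union> range (\<lambda>i x. 1 - fcoord b s x i)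
      | AffB \<Rightarrow> range (\<lambda>i x. fcoord b s x i) \<union> (\<lambda>(i, j) x. 2 - fcoord b s x i - fcoord b s x j) ` {(i, j). i \<noteq> j}
      | AffD \<Rightarrow> (\<lambda>(i, j) x. fcoord b s x i + fcoord b s x j) ` {(i, j). i \<noteq> j} \<union>
                (\<lambda>(i, j) x. 2 - fcoord b s x i - fcoord b s x j) ` {(i, j). i \<noteq> j})"

definition alcove :: "affine_type \<Rightarrow> real^'n \<Rightarrow> real^'n \<Rightarrow> ('n::finite \<Rightarrow> nat) \<Rightarrow> (real^'n) set" where
  "alcove ty b s r = {x. \<forall>g \<in> alcove_ineqs ty b s r. 0 < g x}"

lemma alcove_ineqs_all:
  "(\<forall>g \<in> alcove_ineqs ty b s r. P (g x)) \<longleftrightarrow>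
     (\<forall>i j. r i < r j \<longrightarrow> P (fcoord b s x i - fcoord b s x j)) \<and>
     (case ty of
        AffC \<Rightarrow> (\<forall>i. P (fcoord b s x i)) \<and> (\<forall>i. P (1 - fcoord b s x i))
      | AffB \<Rightarrow> (\<forall>i. P (fcoord b s x i)) \<and> (\<forall>i j. i \<noteq> j \<longrightarrow> P (2 - fcoord b s x i - fcoord b s x j))
      | AffD \<Rightarrow> (\<forall>i j. i \<noteq> j \<longrightarrow> P (fcoord b s x i + fcoord b s x j)) \<and>
                (\<forall>i j. i \<noteq> j \<longrightarrow> P (2 - fcoord b s x i - fcoord b s x j)))"
  by (cases ty) (auto simp: alcove_ineqs_def)

lemma finite_alcove_ineqs: "finite (alcove_ineqs ty b s r)"
  by (cases ty) (auto simp: alcove_ineqs_def)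

lemma fcoord_affine: "fcoord b s ((1 - t) *\<^sub>R u + t *\<^sub>R v) i = (1 - t) * fcoord b s u i + t * fcoord b s v i"
  by (simp add: fcoord_def algebra_simps)

lemma alcove_ineqs_affine:
  assumes "g \<in> alcove_ineqs ty b s r"
  shows "g ((1 - t) *\<^sub>R u + t *\<^sub>R v) = (1 - t) * g u + t * g v"
  using assms
  by (cases ty) (auto simp: alcove_ineqs_def fcoord_affine simp del: vector_add_component scaleR_conv_of_real, (simp add: algebra_simps)+)

lemma alcove_ineqs_continuous: "g \<in> alcove_ineqs ty b s r \<Longrightarrow> continuous_on UNIV g"
  by (cases ty) (auto simp: alcove_ineqs_def fcoord_def intro!: continuous_intros)

lemma open_alcove: "open (alcove ty b s r)"
proof -
  have "alcove ty b s r = (\<Inter>g \<in> alcove_ineqs ty b s r. {x. 0 < g x})" by (auto simp: alcove_def)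
  moreover have "open {x. 0 < g x}" if "g \<in> alcove_ineqs ty b s r" for g
    by (intro open_Collect_less continuous_on_const alcove_ineqs_continuous[OF that])
  ultimately show ?thesis by (simp add: finite_alcove_ineqs open_INT)
qed

lemma alcove_segment:
  assumes "p \<in> alcove ty b s r" and "\<And>g. g \<in> alcove_ineqs ty b s r \<Longrightarrow> 0 \<le> g v" and t: "0 < t" "t \<le> 1"
  shows "(1 - t) *\<^sub>R v + t *\<^sub>R p \<in> alcove ty b s r"
  using assms by (auto simp: alcove_def alcove_ineqs_affine intro!: add_nonneg_pos)

lemma convex_alcove: "convex (alcove ty b s r)"
  unfolding convex_alt
proof (intro ballI allI impI)
  fix x y and t :: real assume "x \<in> alcove ty b s r" "y \<in> alcove ty b s r" "0 \<le> t \<and> t \<le> 1"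
  then show "(1 - t) *\<^sub>R x + t *\<^sub>R y \<in> alcove ty b s r"
    using alcove_segment[of y ty b s r x t] by (cases "t = 0") (auto simp: alcove_def less_imp_le)
qed

lemma fcoord_of_point:
  fixes b s :: "real^'n::finite"
  assumes f: "frame b s r"
  shows "fcoord b s (\<chi> i. (b $ i + s $ i * y i) / 2) i = y i"
  using frame_sgn[OF f, of i] by (auto simp: fcoord_def field_simps)

lemma barycentre_in_alcove:
  fixes b s :: "real^'n::finite"
  assumes f: "frame b s r"
  shows "(\<chi> i. (b $ i + s $ i * (real (CARD('n) - r i) / (CARD('n) + 1))) / 2) \<in> alcove ty b s r" (is "?p \<in> _")
proof -
  define y where "y i = real (CARD('n) - r i) / (CARD('n) + 1)" for i
  have "fcoord b s ?p i = y i" for i unfolding y_def by (rule fcoord_of_point[OF f])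
  moreover have "0 < y i" "y i < 1" for i
    using frame_rank_less[OF f, of i] by (auto simp: y_def field_simps of_nat_diff)
  moreover have "y j < y i" if "r i < r j" for i j
    unfolding y_def using that frame_rank_less[OF f, of j]
    by (intro divide_strict_right_mono) (auto simp: of_nat_diff)
  moreover have "y i + y j < 2" "0 < y i + y j" for i j
    using calculation(2,3)[of i] calculation(2,3)[of j] by linarith+
  ultimately show ?thesis by (cases ty) (simp_all add: alcove_def alcove_ineqs_all algebra_simps)
qed

lemma not_even_integer: "0 < a \<Longrightarrow> a < 2 \<Longrightarrow> a / 2 \<notin> \<int>" for a :: real
  by (auto elim!: Ints_cases simp: field_simps)

lemma third_index:
  fixes i j :: "'n::finite"
  assumes "3 \<le> CARD('n)" obtains l where "l \<noteq> i" "l \<noteq> j"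
proof -
  have "card {i, j} \<le> 2" by (simp add: card_insert_if)
  then have "{i, j} \<noteq> UNIV" using assms by auto
  then show thesis using that by auto
qed

text \<open>In type \<open>D\<close> a coordinate may be negative, and in types \<open>B\<close> and \<open>D\<close> it may exceed \<open>1\<close>. Comparison with
another coordinate shows that differences in type \<open>D\<close>, and coordinates in type \<open>B\<close>, still stay below \<open>2\<close>. Here the lower
bounds on the rank enter.\<close>

lemma alcove_avoids_walls:
  fixes b s x :: "real^'n::finite"
  assumes f: "frame b s r" and adm: "admissible_rank ty CARD('n)" and x: "x \<in> alcove ty b s r"
  shows "x \<notin> \<Union>(walls ty)"
proof
  assume "x \<in> \<Union>(walls ty)"
  define y where "y = fcoord b s x"
  have ord: "y j < y i" if "r i < r j" for i j
    using x that by (auto simp: alcove_def alcove_ineqs_all y_def)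
  have bounds: "0 < y i + y j \<and> y i + y j < 2 \<and> y i - y j < 2" if ij: "i \<noteq> j" for i j
  proof (cases ty)
    case AffC
    then have "0 < y i" "y i < 1" "0 < y j" "y j < 1" using x by (auto simp: alcove_def alcove_ineqs_all y_def)
    then show ?thesis by linarith
  next
    case AffB
    then have "3 \<le> CARD('n)" using adm by (simp add: admissible_rank_def)
    have "0 < y i" "0 < y j" and "y i + y j < 2"
      using x ij AffB by (auto simp: alcove_def alcove_ineqs_all y_def algebra_simps)
    then show ?thesis by linarith
  next
    case AffD
    then have "3 \<le> CARD('n)" using adm by (simp add: admissible_rank_def)
    then obtain l where l: "l \<noteq> i" "l \<noteq> j" using third_index by blast
    have D: "0 < y k + y m \<and> y k + y m < 2" if "k \<noteq> m" for k m
      using x that AffD by (simp add: alcove_def alcove_ineqs_all y_def algebra_simps)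
    from D[OF l(1)] D[OF l(2)] D[OF ij] show ?thesis by linarith
  qed
  have pair: "(y i + y j) / 2 \<notin> \<int> \<and> (y i - y j) / 2 \<notin> \<int>" if ij: "i \<noteq> j" for i j
  proof
    show "(y i + y j) / 2 \<notin> \<int>" by (rule not_even_integer) (use bounds[OF ij] in auto)
    have "r i \<noteq> r j" using ij frame_rank_inj[OF f] by simp
    then consider "r i < r j" | "r j < r i" by linarith
    then show "(y i - y j) / 2 \<notin> \<int>"
    proof cases
      case 1
      then show ?thesis by (intro not_even_integer) (use ord[OF 1] bounds[OF ij] in auto)
    next
      case 2
      then have "(y j - y i) / 2 \<notin> \<int>"
        by (intro not_even_integer) (use ord[OF 2] bounds[of j i] ij in auto)
      moreover have "(y j - y i) / 2 = - ((y i - y j) / 2)" by (simp add: field_simps)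
      ultimately show ?thesis using Ints_minus by metis
    qed
  qed
  have rest: "case ty of AffD \<Rightarrow> False | AffB \<Rightarrow> (\<exists>i. y i / 2 \<in> \<int>) | AffC \<Rightarrow> (\<exists>i. y i \<in> \<int>)"
    using \<open>x \<in> \<Union>(walls ty)\<close> pair unfolding walls_frame[OF f] y_def by blast
  then show False
  proof (cases ty)
    case AffC
    have "y i \<notin> \<int>" for i
      using not_even_integer[of "2 * y i"] x AffC
      by (auto simp: alcove_def alcove_ineqs_all y_def elim!: Ints_cases)
    then show ?thesis using AffC rest by simp
  next
    case AffB
    have "y i / 2 \<notin> \<int>" for i
    proof (rule not_even_integer)
      show "0 < y i" using x AffB by (simp add: alcove_def alcove_ineqs_all y_def)
      have "3 \<le> CARD('n)" using adm AffB by (simp add: admissible_rank_def)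
      then obtain l where "l \<noteq> i" using third_index by blast
      then have "y l + y i < 2" "0 < y l" using bounds x AffB by (auto simp: alcove_def alcove_ineqs_all y_def)
      then show "y i < 2" by linarith
    qed
    then show ?thesis using AffB rest by simp
  qed auto
qed

lemma alcove_ineqs_zero_on_wall:
  fixes b s x :: "real^'n::finite"
  assumes f: "frame b s r" and g: "g \<in> alcove_ineqs ty b s r" and 0: "g x = 0"
  shows "x \<in> \<Union>(walls ty)"
proof -
  have "g x \<noteq> 0" if "x \<notin> \<Union>(walls ty)"
  proof -
    have "i \<noteq> j \<Longrightarrow> (fcoord b s x i + fcoord b s x j) / 2 \<notin> \<int>" "i \<noteq> j \<Longrightarrow> (fcoord b s x i - fcoord b s x j) / 2 \<notin> \<int>" for i j
      using that unfolding walls_frame[OF f] by blast+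
    then have P: "i \<noteq> j \<Longrightarrow> fcoord b s x i + fcoord b s x j \<noteq> 0" "i \<noteq> j \<Longrightarrow> fcoord b s x i + fcoord b s x j \<noteq> 2"
      "i \<noteq> j \<Longrightarrow> fcoord b s x i - fcoord b s x j \<noteq> 0" for i j
      by (metis Ints_0 div_0, metis Ints_1 div_self zero_neq_numeral, metis Ints_0 div_0)
    have Q: "fcoord b s x i \<noteq> 0" if "ty = AffB \<or> ty = AffC" for i
      using \<open>x \<notin> _\<close> that unfolding walls_frame[OF f] by (cases ty) (auto dest!: spec[of _ i])
    have R: "fcoord b s x i \<noteq> 1" if "ty = AffC" for i
      using \<open>x \<notin> _\<close> that unfolding walls_frame[OF f] by (auto dest!: spec[of _ i])
    have "\<forall>g \<in> alcove_ineqs ty b s r. g x \<noteq> 0"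
      unfolding alcove_ineqs_all[of ty b s r "\<lambda>a. a \<noteq> 0"]
    proof (intro conjI allI impI)
      show "fcoord b s x i - fcoord b s x j \<noteq> 0" if "r i < r j" for i j
        using P(3)[of i j] that by (cases "i = j") auto
      have T: "2 - fcoord b s x i - fcoord b s x j \<noteq> 0" if "i \<noteq> j" for i j
        using P(2)[OF that] by linarith
      have U: "1 - fcoord b s x i \<noteq> 0" if "ty = AffC" for i using R[OF that, of i] by linarith
      show "case ty of AffB \<Rightarrow> (\<forall>i. fcoord b s x i \<noteq> 0) \<and> (\<forall>i j. i \<noteq> j \<longrightarrow> 2 - fcoord b s x i - fcoord b s x j \<noteq> 0)
        | AffC \<Rightarrow> (\<forall>i. fcoord b s x i \<noteq> 0) \<and> (\<forall>i. 1 - fcoord b s x i \<noteq> 0)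
        | AffD \<Rightarrow> (\<forall>i j. i \<noteq> j \<longrightarrow> fcoord b s x i + fcoord b s x j \<noteq> 0) \<and>
                  (\<forall>i j. i \<noteq> j \<longrightarrow> 2 - fcoord b s x i - fcoord b s x j \<noteq> 0)"
        using P(1) Q T U by (cases ty) simp_all
    qed
    then show ?thesis using g by blast
  qed
  then show ?thesis using 0 by blast
qed

text \<open>A connected set that avoids the walls cannot change the sign of a function vanishing only on walls.\<close>

lemma alcove_component:
  fixes b s :: "real^'n::finite"
  assumes f: "frame b s r" and adm: "admissible_rank ty CARD('n)"
  shows "alcove ty b s r \<in> components (UNIV - \<Union>(walls ty))"
  unfolding in_components_maximal
proof (intro conjI allI impI)
  show "alcove ty b s r \<noteq> {}" using barycentre_in_alcove[OF f] by blast
  show "alcove ty b s r \<subseteq> UNIV - \<Union>(walls ty)" using alcove_avoids_walls[OF f adm] by blast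
  show "connected (alcove ty b s r)" by (rule convex_connected[OF convex_alcove])
  fix D assume "D \<noteq> {} \<and> alcove ty b s r \<subseteq> D \<and> D \<subseteq> UNIV - \<Union>(walls ty) \<and> connected D"
  then have D: "alcove ty b s r \<subseteq> D" "D \<inter> \<Union>(walls ty) = {}" "connected D" by auto
  obtain p where p: "p \<in> alcove ty b s r" using barycentre_in_alcove[OF f] by blast
  have "x \<in> alcove ty b s r" if x: "x \<in> D" for x
    unfolding alcove_def
  proof (intro CollectI ballI, rule ccontr)
    fix g assume g: "g \<in> alcove_ineqs ty b s r" "\<not> 0 < g x"
    have "connected (g ` D)"
      by (rule connected_continuous_image[OF continuous_on_subset[OF alcove_ineqs_continuous[OF g(1)]] D(3)]) simp
    moreover have "g x \<in> g ` D" "g p \<in> g ` D" using x p D(1) by auto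
    moreover have "g x \<le> 0" "0 \<le> g p" using p g by (auto simp: alcove_def less_imp_le)
    ultimately have "0 \<in> g ` D" using connectedD_interval by blast
    then obtain z where "z \<in> D" "g z = 0" by auto
    then show False using alcove_ineqs_zero_on_wall[OF f g(1)] D(2) by blast
  qed
  then show "D = alcove ty b s r" using D(1) by blast
qed

text \<open>The frame obtained by sorting satisfies the weak inequalities, and off the walls these are strict.\<close>

lemma components_are_alcoves:
  fixes C :: "(real^'n::finite) set"
  assumes adm: "admissible_rank ty CARD('n)" and C: "C \<in> components (UNIV - \<Union>(walls ty))"
  obtains b s r where "frame b s r" "C = alcove ty b s r"
proof -
  obtain x where x: "x \<in> C" "x \<notin> \<Union>(walls ty)"
    using in_components_nonempty[OF C] in_components_subset[OF C] by blast
  obtain b s r where f: "frame b s r" and y: "\<And>i. 0 \<le> fcoord b s x i" "\<And>i. fcoord b s x i \<le> 1"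
    "\<And>i j. r i < r j \<Longrightarrow> fcoord b s x j \<le> fcoord b s x i"
    using point_frame[of x] by blast
  have ne: "g x \<noteq> 0" if "g \<in> alcove_ineqs ty b s r" for g using alcove_ineqs_zero_on_wall[OF f that] x(2) by blast
  have y2: "0 \<le> fcoord b s x i + fcoord b s x j" "fcoord b s x i + fcoord b s x j \<le> 2" for i j
    using y(1,2)[of i] y(1,2)[of j] by linarith+
  have "\<forall>g \<in> alcove_ineqs ty b s r. 0 \<le> g x"
    unfolding alcove_ineqs_all[of ty b s r "\<lambda>a. 0 \<le> a"] using y y2 by (cases ty) (simp_all add: algebra_simps)
  then have "x \<in> alcove ty b s r" using ne by (auto simp: alcove_def order_less_le)
  moreover have "alcove ty b s r \<in> components (UNIV - \<Union>(walls ty))" by (rule alcove_component[OF f adm])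
  ultimately have "C = alcove ty b s r" using components_eq[OF C] x(1) by blast
  then show thesis using that f by blast
qed

definition cverts :: "affine_type \<Rightarrow> real^'n \<Rightarrow> real^'n \<Rightarrow> ('n::finite \<Rightarrow> nat) \<Rightarrow> (real^'n) set" where
  "cverts ty b s r = cvert ty b s r ` {..CARD('n)}"

text \<open>Reflecting the starting point of a flag in its second point: the coordinate of rank \<open>0\<close> approaches the same
odd integer from the other side.\<close>

definition flip0_base where "flip0_base b s r = (\<chi> i. if r i = 0 then b $ i + 2 * s $ i else b $ i)"
definition flip0_sign where "flip0_sign s r = (\<chi> i. if r i = (0::nat) then - s $ i else s $ i)"

text \<open>Reflecting the last point of a flag in the one before: the last coordinate moves in the opposite
direction.\<close>

definition flipn_sign where "flipn_sign s r = (\<chi> i::'n::finite. if r i = CARD('n) - 1 then - s $ i else s $ i)"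

lemma frame_flip0: "frame b s r \<Longrightarrow> frame (flip0_base b s r) (flip0_sign s r) r"
proof -
  assume f: "frame b s r"
  have "\<exists>z::int. flip0_base b s r $ i = 2 * of_int z" for i
  proof -
    obtain z :: int where "b $ i = 2 * of_int z" using frame_even[OF f] by blast
    moreover have "\<exists>m::int. s $ i = of_int m" using frame_sgn[OF f, of i] by (metis of_int_1 of_int_minus)
    then obtain m :: int where "s $ i = of_int m" by blast
    ultimately have "flip0_base b s r $ i = 2 * of_int (if r i = 0 then z + m else z)"
      by (simp add: flip0_base_def)
    then show ?thesis by blast
  qed
  then show ?thesis using f frame_sgn[OF f] unfolding frame_def by (auto simp: flip0_sign_def)
qed

lemma frame_flipn: "frame b s r \<Longrightarrow> frame b (flipn_sign s r) r"
  unfolding frame_def by (auto simp: flipn_sign_def)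

lemma fvert_flip0:
  "0 < k \<Longrightarrow> fvert (flip0_base b s r) (flip0_sign s r) r k = fvert b s r k"
  "fvert (flip0_base b s r) (flip0_sign s r) r 0 = 2 *\<^sub>R fvert b s r 1 - fvert b s r 0"
  by (auto simp: fvert_def flip0_base_def flip0_sign_def vec_eq_iff)

lemma fvert_flipn:
  fixes b s :: "real^'n::finite"
  assumes "frame b s r"
  shows "k < CARD('n) \<Longrightarrow> fvert b (flipn_sign s r) r k = fvert b s r k"
  and "fvert b (flipn_sign s r) r (CARD('n)) = 2 *\<^sub>R fvert b s r (CARD('n) - 1) - fvert b s r (CARD('n))"
  using frame_rank_less[OF assms]
  by (auto simp: fvert_def flipn_sign_def vec_eq_iff) (metis Suc_pred less_Suc_eq zero_less_card_finite)+

lemma cvert_flip0: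
  fixes b s :: "real^'n::finite"
  assumes ty: "ty \<noteq> AffC" and adm: "admissible_rank ty CARD('n)"
  shows "cvert ty (flip0_base b s r) (flip0_sign s r) r 0 = cvert ty b s r 1"
    "cvert ty (flip0_base b s r) (flip0_sign s r) r 1 = cvert ty b s r 0"
    "1 < k \<Longrightarrow> cvert ty (flip0_base b s r) (flip0_sign s r) r k = cvert ty b s r k"
  using assms by (auto simp: cvert_def fvert_flip0 admissible_rank_def split: affine_type.splits)

lemma cvert_flipn:
  fixes b s :: "real^'n::finite"
  assumes ty: "ty = AffD" and adm: "admissible_rank ty CARD('n)" and f: "frame b s r"
  shows "cvert ty b (flipn_sign s r) r (CARD('n)) = cvert ty b s r (CARD('n) - 1)"
    "cvert ty b (flipn_sign s r) r (CARD('n) - 1) = cvert ty b s r (CARD('n))"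
    "k < CARD('n) - 1 \<Longrightarrow> cvert ty b (flipn_sign s r) r k = cvert ty b s r k"
  using assms by (auto simp: cvert_def fvert_flipn[OF f] admissible_rank_def)

lemma cverts_flip0:
  fixes b s :: "real^'n::finite"
  assumes ty: "ty \<noteq> AffC" and adm: "admissible_rank ty CARD('n)"
  shows "cverts ty (flip0_base b s r) (flip0_sign s r) r = cverts ty b s r"
proof -
  have n: "1 \<le> CARD('n)" by simp
  have sw: "{..CARD('n)} = insert 0 (insert 1 {2..CARD('n)})" using n by auto
  have "cvert ty (flip0_base b s r) (flip0_sign s r) r ` {2..CARD('n)} = cvert ty b s r ` {2..CARD('n)}"
    using cvert_flip0(3)[OF assms] by (intro image_cong) auto
  then show ?thesis unfolding cverts_def sw image_insert cvert_flip0(1,2)[OF assms] by (simp add: insert_commute)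
qed

lemma cverts_flipn:
  fixes b s :: "real^'n::finite"
  assumes ty: "ty = AffD" and adm: "admissible_rank ty CARD('n)" and f: "frame b s r"
  shows "cverts ty b (flipn_sign s r) r = cverts ty b s r"
proof -
  have sw: "{..CARD('n)} = insert (CARD('n)) (insert (CARD('n) - 1) {..<CARD('n) - 1})" by auto
  have "cvert ty b (flipn_sign s r) r ` {..<CARD('n) - 1} = cvert ty b s r ` {..<CARD('n) - 1}"
    using cvert_flipn(3)[OF assms] by (intro image_cong) auto
  then show ?thesis unfolding cverts_def sw image_insert cvert_flipn(1,2)[OF assms] by (simp add: insert_commute)
qed

text \<open>The points of the flag that are not vertices of the alcove are midpoints of its edges.\<close>

lemma half_fvert_in_hull:
  fixes b s :: "real^'n::finite"
  assumes k: "k \<le> CARD('n)" and f: "frame b s r" and adm: "admissible_rank ty CARD('n)"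
  shows "(1/2) *\<^sub>R fvert b s r k \<in> convex hull (cverts ty b s r)"
proof -
  have in_hull: "cvert ty b s r j \<in> convex hull (cverts ty b s r)" if "j \<le> CARD('n)" for j
    using that by (intro hull_inc) (auto simp: cverts_def)
  have mid: "(1/2) *\<^sub>R u + (1/2) *\<^sub>R v \<in> convex hull (cverts ty b s r)"
    if "u \<in> convex hull (cverts ty b s r)" "v \<in> convex hull (cverts ty b s r)" for u v
    using that by (intro convexD convex_convex_hull) auto
  consider "ty \<noteq> AffC" "k = 1" | "ty = AffD" "k = CARD('n) - 1" "k \<noteq> 1"
    | "\<not> (ty \<noteq> AffC \<and> k = 1)" "\<not> (ty = AffD \<and> k = CARD('n) - 1)" by blast
  then show ?thesis
  proof cases
    case 1
    then have "(1/2) *\<^sub>R fvert b s r k = (1/2) *\<^sub>R cvert ty b s r 0 + (1/2) *\<^sub>R cvert ty b s r 1"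
      using adm by (auto simp: cvert_def admissible_rank_def vec_eq_iff field_simps split: affine_type.splits)
    then show ?thesis using mid in_hull 1 k by simp
  next
    case 2
    then have "(1/2) *\<^sub>R fvert b s r k = (1/2) *\<^sub>R cvert ty b s r (CARD('n) - 1) + (1/2) *\<^sub>R cvert ty b s r (CARD('n))"
      using adm by (auto simp: cvert_def admissible_rank_def vec_eq_iff field_simps)
    then show ?thesis using mid in_hull by simp
  next
    case 3
    then have "(1/2) *\<^sub>R fvert b s r k = cvert ty b s r k" by (auto simp: cvert_def)
    then show ?thesis using in_hull k by simp
  qed
qed

lemma sorted_in_hull:
  fixes b s :: "real^'n::finite"
  assumes f: "frame b s r" and adm: "admissible_rank ty CARD('n)"
    and y: "\<And>i. 0 \<le> fcoord b s x i" "\<And>i. fcoord b s x i \<le> 1" "\<And>i j. r i < r j \<Longrightarrow> fcoord b s x j \<le> fcoord b s x i"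
  shows "x \<in> convex hull (cverts ty b s r)"
proof -
  have "x = (\<Sum>k\<le>CARD('n). bary r (fcoord b s x) k *\<^sub>R ((1/2) *\<^sub>R fvert b s r k))"
    using arg_cong[OF bary_combination[OF f, of x], of "\<lambda>v. (1/2) *\<^sub>R v"]
    by (simp add: scaleR_sum_right)
  also have "\<dots> \<in> convex hull (cverts ty b s r)"
    using bary_sum[of r "fcoord b s x"] bary_nonneg[OF f y] half_fvert_in_hull[OF _ f adm]
    by (intro convex_sum convex_convex_hull) auto
  finally show ?thesis .
qed

text \<open>An alcove of type \<open>B\<close> or \<open>D\<close> is cut into two or four simplices of flags, related by reflections at the
ends, and the one containing \<open>x\<close> is found by reflecting at the top if the largest coordinate exceeds \<open>1\<close> and at the
bottom if the smallest is negative.\<close>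

lemma sorted_frame_same_alcove:
  fixes b s :: "real^'n::finite"
  assumes f: "frame b s r" and adm: "admissible_rank ty CARD('n)" and x: "x \<in> alcove ty b s r"
  obtains b' s' where "frame b' s' r" "cverts ty b' s' r = cverts ty b s r"
    "\<And>i. 0 \<le> fcoord b' s' x i" "\<And>i. fcoord b' s' x i \<le> 1" "\<And>i j. r i < r j \<Longrightarrow> fcoord b' s' x j \<le> fcoord b' s' x i"
proof -
  have ord: "fcoord b s x j < fcoord b s x i" if "r i < r j" for i j
    using x that by (auto simp: alcove_def alcove_ineqs_all)
  obtain i0 where i0: "r i0 = 0" using frame_rank_onto[OF f, of 0] by auto
  obtain il where il: "r il = CARD('n) - 1" using frame_rank_onto[OF f, of "CARD('n) - 1"] by auto
  \<comment> \<open>After a reflection at the top, if needed, all coordinates are at most \<open>1\<close>.\<close>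
  have "\<exists>b1 s1. frame b1 s1 r \<and> cverts ty b1 s1 r = cverts ty b s r \<and>
      (\<forall>i. fcoord b1 s1 x i \<le> 1) \<and> (\<forall>i j. r i < r j \<longrightarrow> fcoord b1 s1 x j \<le> fcoord b1 s1 x i) \<and>
      (ty \<noteq> AffD \<longrightarrow> (\<forall>i. 0 \<le> fcoord b1 s1 x i)) \<and> (ty = AffD \<longrightarrow> (\<forall>i j. i \<noteq> j \<longrightarrow> 0 \<le> fcoord b1 s1 x i + fcoord b1 s1 x j))"
  proof (cases "fcoord b s x i0 \<le> 1")
    case True
    have le1: "fcoord b s x i \<le> 1" for i
      using ord[of i0 i] i0 True frame_rank_inj[OF f, of i i0] by (cases "i = i0") force+
    have "ty \<noteq> AffD \<longrightarrow> (\<forall>i. 0 \<le> fcoord b s x i)" "ty = AffD \<longrightarrow> (\<forall>i j. i \<noteq> j \<longrightarrow> 0 \<le> fcoord b s x i + fcoord b s x j)"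
      using x by (cases ty; auto simp: alcove_def alcove_ineqs_all less_imp_le)+
    then show ?thesis using f le1 ord by (intro exI[of _ b] exI[of _ s]) (auto intro: less_imp_le)
  next
    case False
    then have ty: "ty \<noteq> AffC" using x by (auto simp: alcove_def alcove_ineqs_all less_imp_le)
    define b1 s1 where "b1 = flip0_base b s r" and "s1 = flip0_sign s r"
    have sum2: "fcoord b s x i + fcoord b s x j < 2" if "i \<noteq> j" for i j
      using x ty that by (cases ty) (auto simp: alcove_def alcove_ineqs_all algebra_simps)
    have y0: "fcoord b1 s1 x i0 = 2 - fcoord b s x i0"
      using i0 frame_sgn[OF f, of i0] by (auto simp: fcoord_def b1_def s1_def flip0_base_def flip0_sign_def)
    have yi: "fcoord b1 s1 x i = fcoord b s x i" if "i \<noteq> i0" for i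
      using that i0 frame_rank_inj[OF f, of i i0]
      by (simp add: fcoord_def b1_def s1_def flip0_base_def flip0_sign_def)
    have ri: "0 < r i" if "i \<noteq> i0" for i using that i0 frame_rank_inj[OF f, of i i0] by simp
    have le1: "fcoord b1 s1 x i \<le> 1" for i
    proof (cases "i = i0")
      case True then show ?thesis using y0 False by simp
    next
      case ne: False
      show ?thesis using sum2[OF ne] False yi[OF ne] by linarith
    qed
    have ord1: "fcoord b1 s1 x j \<le> fcoord b1 s1 x i" if "r i < r j" for i j
    proof -
      have j: "j \<noteq> i0" using that i0 by auto
      show ?thesis
      proof (cases "i = i0")
        case True
        then show ?thesis using sum2[OF j] y0 yi[OF j] by simp
      next
        case ne: False
        then show ?thesis using ord[OF that] yi[OF j] yi[OF ne] by simp
      qed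
    qed
    have B: "0 \<le> fcoord b1 s1 x i" if "ty = AffB" for i
    proof (cases "i = i0")
      case True
      have "3 \<le> CARD('n)" using adm that by (simp add: admissible_rank_def)
      then obtain l where l: "l \<noteq> i0" using third_index by blast
      have "0 < fcoord b s x l" using x that by (simp add: alcove_def alcove_ineqs_all)
      then show ?thesis using sum2[OF l] y0 True by simp
    next
      case False
      then show ?thesis using yi[OF False] x that by (simp add: alcove_def alcove_ineqs_all less_imp_le)
    qed
    have D: "0 \<le> fcoord b1 s1 x i + fcoord b1 s1 x j" if "ty = AffD" "i \<noteq> j" for i j
    proof -
      have pos: "0 < fcoord b s x i + fcoord b s x j" if "i \<noteq> j" for i j
        using x \<open>ty = AffD\<close> that by (simp add: alcove_def alcove_ineqs_all)
      have A: "0 \<le> fcoord b1 s1 x i0 + fcoord b1 s1 x j" if "j \<noteq> i0" for j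
      proof -
        have "3 \<le> CARD('n)" using adm \<open>ty = AffD\<close> by (simp add: admissible_rank_def)
        then obtain l where l: "l \<noteq> i0" "l \<noteq> j" using third_index by blast
        show ?thesis using sum2[OF l(1)] pos[OF l(2)] y0 yi[OF that] by linarith
      qed
      show ?thesis
      proof (cases "i = i0 \<or> j = i0")
        case True
        then show ?thesis using A[of i] A[of j] that(2) by (auto simp: add.commute)
      next
        case False
        then show ?thesis using pos[OF that(2)] yi by (simp add: less_imp_le)
      qed
    qed
    have "frame b1 s1 r" "cverts ty b1 s1 r = cverts ty b s r"
      unfolding b1_def s1_def by (rule frame_flip0[OF f], rule cverts_flip0[OF ty adm])
    moreover have "ty \<noteq> AffD \<longrightarrow> (\<forall>i. 0 \<le> fcoord b1 s1 x i)" using B ty by (cases ty) auto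
    ultimately show ?thesis using le1 ord1 D by blast
  qed
  then obtain b1 s1 where 1: "frame b1 s1 r" "cverts ty b1 s1 r = cverts ty b s r"
    "\<And>i. fcoord b1 s1 x i \<le> 1" "\<And>i j. r i < r j \<Longrightarrow> fcoord b1 s1 x j \<le> fcoord b1 s1 x i"
    "\<And>i. ty \<noteq> AffD \<Longrightarrow> 0 \<le> fcoord b1 s1 x i"
    "\<And>i j. ty = AffD \<Longrightarrow> i \<noteq> j \<Longrightarrow> 0 \<le> fcoord b1 s1 x i + fcoord b1 s1 x j"
    by (elim exE conjE) simp
  \<comment> \<open>Only in type \<open>D\<close> can the coordinate of the last rank be negative.\<close>
  show thesis
  proof (cases "0 \<le> fcoord b1 s1 x il")
    case True
    have "0 \<le> fcoord b1 s1 x i" for i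
    proof (cases "i = il")
      case False
      then have "r i < r il" using il frame_rank_less[OF f, of i] frame_rank_inj[OF f, of i il] by linarith
      then show ?thesis using 1(4) True by force
    qed (use True in simp)
    then show ?thesis using that[of b1 s1] 1 by blast
  next
    case False
    then have ty: "ty = AffD" using 1(5) by blast
    define s2 where "s2 = flipn_sign s1 r"
    have yl: "fcoord b1 s2 x il = - fcoord b1 s1 x il" using il by (simp add: fcoord_def s2_def flipn_sign_def)
    have ri: "r i < CARD('n) - 1" if "i \<noteq> il" for i
      using that il frame_rank_less[OF f, of i] frame_rank_inj[OF f, of i il] by linarith
    have yi: "fcoord b1 s2 x i = fcoord b1 s1 x i" if "i \<noteq> il" for i
      using ri[OF that] by (simp add: fcoord_def s2_def flipn_sign_def)
    have sum0: "0 \<le> fcoord b1 s1 x i + fcoord b1 s1 x il" if "i \<noteq> il" for i using 1(6)[OF ty that] .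
    have nn: "0 \<le> fcoord b1 s2 x i" for i
      using False yl yi[of i] sum0[of i] by (cases "i = il") auto
    have le1: "fcoord b1 s2 x i \<le> 1" for i
    proof (cases "i = il")
      case True
      have "4 \<le> CARD('n)" using adm ty by (simp add: admissible_rank_def)
      then obtain l where l: "l \<noteq> il" using third_index[of il il] by auto
      show ?thesis using sum0[OF l] 1(3)[of l] yl True by simp
    next
      case False then show ?thesis using yi 1(3) by simp
    qed
    have "fcoord b1 s2 x j \<le> fcoord b1 s2 x i" if "r i < r j" for i j
    proof -
      have i: "i \<noteq> il" using that il frame_rank_less[OF f, of j] by auto
      then show ?thesis using sum0[OF i] yl yi[OF i] yi[of j] 1(4)[OF that] by (cases "j = il") auto
    qed
    moreover have "frame b1 s2 r" unfolding s2_def by (rule frame_flipn[OF 1(1)])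
    moreover have "cverts ty b1 s2 r = cverts ty b s r"
      unfolding s2_def cverts_flipn[OF ty adm 1(1)] by (rule 1(2))
    ultimately show ?thesis using that[of b1 s2] nn le1 by blast
  qed
qed

lemma alcove_subset_hull:
  fixes b s :: "real^'n::finite"
  assumes "frame b s r" "admissible_rank ty CARD('n)"
  shows "alcove ty b s r \<subseteq> convex hull (cverts ty b s r)"
proof
  fix x assume "x \<in> alcove ty b s r"
  then obtain b' s' where *: "frame b' s' r" "cverts ty b' s' r = cverts ty b s r"
    "\<And>i. 0 \<le> fcoord b' s' x i" "\<And>i. fcoord b' s' x i \<le> 1" "\<And>i j. r i < r j \<Longrightarrow> fcoord b' s' x j \<le> fcoord b' s' x i"
    using sorted_frame_same_alcove[OF assms] by blast
  show "x \<in> convex hull (cverts ty b s r)"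
    using sorted_in_hull[OF *(1) assms(2) *(3-5)] *(2) by simp
qed

lemma fcoord_cvert:
  fixes b s :: "real^'n::finite"
  assumes f: "frame b s r"
  shows "fcoord b s (cvert ty b s r k) i =
     (if ty \<noteq> AffC \<and> k = 1 then (if r i = 0 then 2 else 0)
      else if ty = AffD \<and> k = CARD('n) - 1 then (if r i < k then 1 else -1)
      else if r i < k then 1 else 0)"
  using frame_sgn[OF f, of i] frame_rank_less[OF f, of i]
  by (auto simp: fcoord_def cvert_def fvert_def field_simps)

text \<open>The vertices satisfy the closed inequalities, hence are limits of interior points of the alcove.\<close>

lemma alcove_ineqs_cvert_nonneg:
  fixes b s :: "real^'n::finite"
  assumes f: "frame b s r" and adm: "admissible_rank ty CARD('n)"
    and k: "k \<le> CARD('n)" and g: "g \<in> alcove_ineqs ty b s r"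
  shows "0 \<le> g (cvert ty b s r k)"
proof -
  have inj: "r i = r j \<longleftrightarrow> i = j" and lt: "r i < CARD('n)" for i j
    using frame_rank_inj[OF f] frame_rank_less[OF f] by auto
  have first: "r i = 0 \<Longrightarrow> r j = 0 \<Longrightarrow> i = j" for i j using inj[of i j] by simp
  have last: "\<not> r i < CARD('n) - Suc 0 \<Longrightarrow> \<not> r j < CARD('n) - Suc 0 \<Longrightarrow> i = j" for i j
    using inj[of i j] lt[of i] lt[of j] by linarith
  have "\<forall>g \<in> alcove_ineqs ty b s r. 0 \<le> g (cvert ty b s r k)"
    unfolding alcove_ineqs_all[of ty b s r "\<lambda>a. 0 \<le> a"] fcoord_cvert[OF f]
    using adm
    by (cases ty) (auto simp: admissible_rank_def split: if_splits dest: first last)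
  then show ?thesis using g by blast
qed

lemma closure_alcove:
  fixes b s :: "real^'n::finite"
  assumes f: "frame b s r" and adm: "admissible_rank ty CARD('n)"
  shows "closure (alcove ty b s r) = convex hull (cverts ty b s r)"
proof
  show "closure (alcove ty b s r) \<subseteq> convex hull (cverts ty b s r)"
    by (rule closure_minimal[OF alcove_subset_hull[OF assms]])
      (simp add: compact_imp_closed finite_imp_compact_convex_hull cverts_def)
  have "cverts ty b s r \<subseteq> closure (alcove ty b s r)"
  proof
    fix v assume "v \<in> cverts ty b s r"
    then obtain k where k: "k \<le> CARD('n)" "v = cvert ty b s r k" by (auto simp: cverts_def)
    obtain p where p: "p \<in> alcove ty b s r" using barycentre_in_alcove[OF f] by blast
    show "v \<in> closure (alcove ty b s r)"
    proof (cases "v = p")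
      case True then show ?thesis using p closure_subset by blast
    next
      case False
      have "open_segment v p \<subseteq> alcove ty b s r"
        using alcove_segment[OF p, of v] alcove_ineqs_cvert_nonneg[OF f adm k(1)] k(2)
        by (auto simp: in_segment)
      from closure_mono[OF this] show ?thesis using False by auto
    qed
  qed
  then show "convex hull (cverts ty b s r) \<subseteq> closure (alcove ty b s r)"
    by (intro hull_minimal convex_closure convex_alcove)
qed

text \<open>The hull of these at most \<open>n + 1\<close> points contains a nonempty open set.\<close>

lemma cverts_independent:
  fixes b s :: "real^'n::finite"
  assumes f: "frame b s r" and adm: "admissible_rank ty CARD('n)"
  shows "\<not> affine_dependent (cverts ty b s r)" "card (cverts ty b s r) = CARD('n) + 1"
proof -
  have fin: "finite (cverts ty b s r)" by (simp add: cverts_def)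
  have "alcove ty b s r \<noteq> {}" using barycentre_in_alcove[OF f, of ty] by blast
  then have "int CARD('n) = aff_dim (alcove ty b s r)"
    using aff_dim_open[OF open_alcove, of ty b s r] by simp
  also have "\<dots> \<le> aff_dim (cverts ty b s r)"
    using aff_dim_subset[OF alcove_subset_hull[OF assms]] by (simp add: aff_dim_convex_hull)
  finally have lo: "int CARD('n) \<le> aff_dim (cverts ty b s r)" .
  have hi: "aff_dim (cverts ty b s r) \<le> int (card (cverts ty b s r)) - 1" using aff_dim_le_card[OF fin] by simp
  have "card (cverts ty b s r) \<le> CARD('n) + 1"
    unfolding cverts_def using card_image_le[of "{..CARD('n)}"] by force
  then show "card (cverts ty b s r) = CARD('n) + 1" using lo hi by linarith
  then show "\<not> affine_dependent (cverts ty b s r)"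
    unfolding affine_independent_iff_card using fin lo hi by simp
qed

text \<open>The chambers are the affinely independent vertex sets of the alcoves, so all of their points are extreme.\<close>

theorem coxeter_complex_frames:
  assumes adm: "admissible_rank ty CARD('n::finite)"
  shows "(coxeter_complex ty :: (real^'n) set set) =
     {S. S \<noteq> {} \<and> (\<exists>b s r. frame b s r \<and> S \<subseteq> cverts ty b s r)}"
proof -
  have ext: "{v. v extreme_point_of closure (alcove ty b s r)} = cverts ty b s r" if "frame b s r"
    for b s :: "real^'n" and r
    unfolding closure_alcove[OF that adm]
    using extreme_point_of_convex_hull_affine_independent[OF cverts_independent(1)[OF that adm]] by blast
  show ?thesis
    unfolding coxeter_complex_def
  proof (intro Collect_cong conj_cong refl iffI)
    fix S :: "(real^'n) set"
    assume "\<exists>C\<in>components (UNIV - \<Union>(walls ty)). S \<subseteq> {v. v extreme_point_of closure C}"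
    then obtain C where C: "C \<in> components (UNIV - \<Union>(walls ty))" "S \<subseteq> {v. v extreme_point_of closure C}" by blast
    obtain b s r where "frame b s r" "C = alcove ty b s r" using components_are_alcoves[OF adm C(1)] .
    then show "\<exists>b s r. frame b s r \<and> S \<subseteq> cverts ty b s r" using ext C(2) by blast
  next
    fix S :: "(real^'n) set"
    assume "\<exists>b s r. frame b s r \<and> S \<subseteq> cverts ty b s r"
    then obtain b s r where f: "frame b s r" "S \<subseteq> cverts ty b s r" by blast
    then show "\<exists>C\<in>components (UNIV - \<Union>(walls ty)). S \<subseteq> {v. v extreme_point_of closure C}"
      using alcove_component[OF f(1) adm] ext[OF f(1)] by (intro bexI[of _ "alcove ty b s r"]) auto
  qed
qed

section \<open>Types of the vertices and galleries\<close>

lemma half_b_int: "frame b s r \<Longrightarrow> b $ i / 2 \<in> \<int>"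
  using frame_even[of b s r i] by auto

lemma not_half_int:
  fixes a c :: real assumes "a \<in> \<int>" "c = 1 \<or> c = -1" shows "a + c / 2 \<notin> \<int>"
proof
  assume "a + c / 2 \<in> \<int>"
  then have "c / 2 \<in> \<int>" using assms(1) by (metis Ints_diff add_diff_cancel_left')
  then have "1 / 2 \<in> (\<int> :: real set)" using assms(2) Ints_minus[of "c / 2"] by auto
  then show False using not_even_integer[of 1] by simp
qed

lemma parity_switch:
  fixes a c :: real assumes "a \<in> \<int>" "c = 1 \<or> c = -1" shows "(a + c) / 2 \<in> \<int> \<longleftrightarrow> a / 2 \<notin> \<int>"
proof -
  obtain m :: int where m: "a = of_int m" using assms(1) by (auto elim: Ints_cases)
  have half: "of_int k / 2 \<in> (\<int> :: real set) \<longleftrightarrow> even k" for k :: int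
  proof
    assume "of_int k / 2 \<in> (\<int> :: real set)"
    then obtain z :: int where "real_of_int k / 2 = of_int z" by (auto elim: Ints_cases)
    then have "real_of_int k = of_int (2 * z)" by simp
    then have "k = 2 * z" using of_int_eq_iff by blast
    then show "even k" by simp
  qed (auto elim!: evenE)
  from assms(2) obtain e :: int where e: "c = of_int e" "odd e"
    using that[of 1] that[of "-1"] by auto
  show ?thesis using half[of "m + e"] half[of m] e by (simp add: m)
qed

lemma card_rank_less:
  fixes b s :: "real^'n::finite"
  assumes f: "frame b s r" and k: "k \<le> CARD('n)" shows "card {i. r i < k} = k"
proof -
  have "r ` {i. r i < k} = {..<k}"
    using frame_rank_onto[OF f] k by (auto, metis image_iff mem_Collect_eq order_less_le_trans)
  moreover have "inj_on r {i. r i < k}" using frame_rank_inj[OF f] by (auto intro: inj_onI)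
  ultimately show ?thesis using card_image by fastforce
qed

lemma half_fvert_Ints:
  fixes b s :: "real^'n::finite"
  assumes f: "frame b s r" shows "fvert b s r k $ i / 2 \<in> \<int> \<longleftrightarrow> \<not> r i < k"
  using half_b_int[OF f, of i] not_half_int[OF half_b_int[OF f, of i] frame_sgn[OF f, of i]]
  by (simp add: fvert_def add_divide_distrib)

definition first_fork_index :: "affine_type \<Rightarrow> nat \<Rightarrow> bool" where "first_fork_index ty k \<longleftrightarrow> ty \<noteq> AffC \<and> k \<le> 1"
definition last_fork_index :: "affine_type \<Rightarrow> nat \<Rightarrow> nat \<Rightarrow> bool" where "last_fork_index ty n k \<longleftrightarrow> ty = AffD \<and> n - 1 \<le> k"

lemma coxeter_type_regular:
  fixes b s :: "real^'n::finite"
  assumes f: "frame b s r" and adm: "admissible_rank ty CARD('n)" and k: "k \<le> CARD('n)"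
    and reg: "\<not> first_fork_index ty k" "\<not> last_fork_index ty CARD('n) k"
  shows "coxeter_type ty (cvert ty b s r k) = k"
proof -
  have c: "cvert ty b s r k = (1/2) *\<^sub>R fvert b s r k"
    using reg by (auto simp: cvert_def first_fork_index_def last_fork_index_def)
  have "card {i. cvert ty b s r k $ i \<notin> \<int>} = k"
    unfolding c using half_fvert_Ints[OF f, of k] card_rank_less[OF f k] by simp
  then show ?thesis using reg k by (auto simp: coxeter_type_def first_fork_index_def last_fork_index_def Let_def)
qed

text \<open>Both vertices have integer coordinates, and their coordinate sums differ by one.\<close>

lemma coxeter_type_fork0:
  fixes b s :: "real^'n::finite"
  assumes f: "frame b s r" and adm: "admissible_rank ty CARD('n)" and ty: "ty \<noteq> AffC"
  shows "{coxeter_type ty (cvert ty b s r 0), coxeter_type ty (cvert ty b s r 1)} = {0, 1}"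
proof -
  have n: "3 \<le> CARD('n)" using adm ty by (cases ty) (auto simp: admissible_rank_def)
  obtain i0 where i0: "r i0 = 0" using frame_rank_onto[OF f, of 0] by auto
  have r0: "r i = 0 \<longleftrightarrow> i = i0" for i using i0 frame_rank_inj[OF f, of i i0] by auto
  have c0: "cvert ty b s r 0 $ i = b $ i / 2" for i
    using n by (simp add: cvert_def fvert_def)
  have c1: "cvert ty b s r 1 $ i = b $ i / 2 + (if i = i0 then s $ i0 else 0)" for i
    using ty by (simp add: cvert_def fvert_def field_simps r0)
  have "s $ i0 \<in> \<int>" using frame_sgn[OF f, of i0] by auto
  then have ints: "{i. cvert ty b s r 0 $ i \<notin> \<int>} = {}" "{i. cvert ty b s r 1 $ i \<notin> \<int>} = {}"
    unfolding c0 c1 using half_b_int[OF f] by auto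
  have B: "(\<Sum>i\<in>UNIV. b $ i / 2) \<in> \<int>" using half_b_int[OF f] by (intro Ints_sum) auto
  have "(\<Sum>i\<in>UNIV. cvert ty b s r 1 $ i) = (\<Sum>i\<in>UNIV. b $ i / 2) + s $ i0"
    unfolding c1 by (simp add: sum.distrib)
  then show ?thesis
    using parity_switch[OF B frame_sgn[OF f, of i0]] ints ty
    by (auto simp: coxeter_type_def Let_def c0)
qed

text \<open>All coordinates of both vertices are half-integers, and their sums differ by one.\<close>

lemma coxeter_type_forkn:
  fixes b s :: "real^'n::finite"
  assumes f: "frame b s r" and adm: "admissible_rank ty CARD('n)" and ty: "ty = AffD"
  shows "{coxeter_type ty (cvert ty b s r (CARD('n) - 1)), coxeter_type ty (cvert ty b s r (CARD('n)))}
    = {CARD('n) - 1, CARD('n)}"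
proof -
  have n: "4 \<le> CARD('n)" using adm ty by (auto simp: admissible_rank_def)
  obtain il where il: "r il = CARD('n) - 1" using frame_rank_onto[OF f, of "CARD('n) - 1"] by auto
  have rl: "r i < CARD('n) - 1 \<longleftrightarrow> i \<noteq> il" for i
    using il frame_rank_inj[OF f, of i il] frame_rank_less[OF f, of i] by linarith
  have cn: "cvert ty b s r (CARD('n)) $ i = b $ i / 2 + s $ i / 2" for i
    using n frame_rank_less[OF f, of i] by (simp add: cvert_def fvert_def field_simps)
  have cl: "cvert ty b s r (CARD('n) - 1) $ i = b $ i / 2 + (if i = il then - s $ i else s $ i) / 2" for i
  proof -
    have "CARD('n) - 1 \<noteq> 1" using n by simp
    then show ?thesis
      using rl[of i] il frame_rank_less[OF f, of i] unfolding cvert_def fvert_def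
      by (cases "i = il") (simp_all add: ty field_simps)
  qed
  have ints: "{i. cvert ty b s r (CARD('n)) $ i \<notin> \<int>} = UNIV"
    unfolding cn using not_half_int[OF half_b_int[OF f] frame_sgn[OF f]] by auto
  have "cvert ty b s r (CARD('n) - 1) $ i \<notin> \<int>" for i
    unfolding cl by (rule not_half_int[OF half_b_int[OF f]]) (use frame_sgn[OF f, of i] in auto)
  then have intl: "{i. cvert ty b s r (CARD('n) - 1) $ i \<notin> \<int>} = UNIV" by blast
  define Q where "Q = (\<Sum>i\<in>UNIV. b $ i / 2 + s $ i / 2 - 1/2)"
  have "b $ i / 2 + s $ i / 2 - 1/2 \<in> \<int>" for i
    using half_b_int[OF f, of i] frame_sgn[OF f, of i] by (auto simp: diff_divide_distrib)
  then have Q: "Q \<in> \<int>" unfolding Q_def by (intro Ints_sum) auto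
  have "(\<Sum>i\<in>UNIV. cvert ty b s r (CARD('n) - 1) $ i - 1/2)
      = (\<Sum>i\<in>UNIV. (b $ i / 2 + s $ i / 2 - 1/2) + (if i = il then - s $ il else 0))"
    unfolding cl by (intro sum.cong) (auto simp: field_simps)
  also have "\<dots> = Q + (- s $ il)" by (simp only: sum.distrib Q_def) simp
  finally have l: "(\<Sum>i\<in>UNIV. cvert ty b s r (CARD('n) - 1) $ i - 1/2) = Q + (- s $ il)" .
  have m: "- s $ il = 1 \<or> - s $ il = -1" using frame_sgn[OF f, of il] by auto
  have tn: "coxeter_type ty (cvert ty b s r (CARD('n))) = (if Q / 2 \<in> \<int> then CARD('n) else CARD('n) - 1)"
  proof -
    have "(\<Sum>i\<in>UNIV. cvert ty b s r (CARD('n)) $ i - 1/2) = Q" unfolding cn Q_def ..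
    then show ?thesis unfolding coxeter_type_def Let_def ints using ty n by simp
  qed
  have tl: "coxeter_type ty (cvert ty b s r (CARD('n) - 1))
      = (if (Q + (- s $ il)) / 2 \<in> \<int> then CARD('n) else CARD('n) - 1)"
    unfolding coxeter_type_def Let_def intl l using ty n by simp
  show ?thesis unfolding tn tl parity_switch[OF Q m] by auto
qed

lemma coxeter_type_range:
  fixes b s :: "real^'n::finite"
  assumes f: "frame b s r" and adm: "admissible_rank ty CARD('n)"
  shows "(\<lambda>k. coxeter_type ty (cvert ty b s r k)) ` {..CARD('n)} = {..CARD('n)}"
proof -
  define c where "c k = coxeter_type ty (cvert ty b s r k)" for k
  have reg: "c k = k" if "k \<le> CARD('n)" "\<not> first_fork_index ty k" "\<not> last_fork_index ty CARD('n) k" for k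
    unfolding c_def by (rule coxeter_type_regular[OF f adm that])
  have f0: "{c 0, c 1} = {0, 1}" if "ty \<noteq> AffC" unfolding c_def by (rule coxeter_type_fork0[OF f adm that])
  have fn: "{c (CARD('n) - 1), c (CARD('n))} = {CARD('n) - 1, CARD('n)}" if "ty = AffD"
    unfolding c_def by (rule coxeter_type_forkn[OF f adm that])
  have n1: "1 \<le> CARD('n)" by simp
  show ?thesis
    unfolding c_def[symmetric]
  proof (intro equalityI subsetI)
    fix m assume "m \<in> c ` {..CARD('n)}"
    then obtain k where k: "k \<le> CARD('n)" "m = c k" by auto
    consider "first_fork_index ty k" | "last_fork_index ty CARD('n) k" | "\<not> first_fork_index ty k" "\<not> last_fork_index ty CARD('n) k" by blast
    then show "m \<in> {..CARD('n)}"
    proof cases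
      case 1
      then have "c k \<in> {0, 1}" using f0 by (auto simp: first_fork_index_def le_Suc_eq)
      then show ?thesis using k n1 by auto
    next
      case 2
      then have "k = CARD('n) - 1 \<or> k = CARD('n)" "ty = AffD" using k by (auto simp: last_fork_index_def)
      then have "c k \<in> {CARD('n) - 1, CARD('n)}" using fn by blast
      then show ?thesis using k by auto
    qed (use k reg in auto)
  next
    fix m assume m: "m \<in> {..CARD('n)}"
    consider "first_fork_index ty m" | "last_fork_index ty CARD('n) m" | "\<not> first_fork_index ty m" "\<not> last_fork_index ty CARD('n) m" by blast
    then show "m \<in> c ` {..CARD('n)}"
    proof cases
      case 1
      then have "m \<in> {c 0, c 1}" using f0 by (auto simp: first_fork_index_def le_Suc_eq)
      then show ?thesis using n1 by auto
    next
      case 2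
      then have "m = CARD('n) - 1 \<or> m = CARD('n)" "ty = AffD" using m by (auto simp: last_fork_index_def)
      then have "m \<in> {c (CARD('n) - 1), c (CARD('n))}" using fn by auto
      then show ?thesis by auto
    next
      case 3
      then show ?thesis using m reg by (intro image_eqI[of _ _ m]) auto
    qed
  qed
qed

lemma coxeter_type_bij:
  fixes b s :: "real^'n::finite"
  assumes f: "frame b s r" and adm: "admissible_rank ty CARD('n)"
  shows "bij_betw (coxeter_type ty) (cverts ty b s r) {..CARD('n)}"
proof -
  have im: "coxeter_type ty ` cverts ty b s r = {..CARD('n)}"
    using coxeter_type_range[OF assms] by (simp add: cverts_def image_image)
  have fin: "finite (cverts ty b s r)" by (simp add: cverts_def)
  have "card (cverts ty b s r) \<le> CARD('n) + 1"
    unfolding cverts_def using card_image_le[of "{..CARD('n)}"] by force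
  moreover have "card (coxeter_type ty ` cverts ty b s r) = CARD('n) + 1" using im by simp
  ultimately have "card (coxeter_type ty ` cverts ty b s r) = card (cverts ty b s r)"
    using card_image_le[OF fin, of "coxeter_type ty"] by linarith
  then have "inj_on (coxeter_type ty) (cverts ty b s r)" by (rule eq_card_imp_inj_on[OF fin])
  then show ?thesis using im by (simp add: bij_betw_def)
qed

lemma frame_permute:
  fixes b s :: "real^'n::finite"
  assumes f: "frame b s r" and p: "p permutes {..<CARD('n)}" shows "frame b s (p \<circ> r)"
  using f bij_betw_trans[OF frame_bij[OF f] permutes_imp_bij[OF p]] by (simp add: frame_def)

lemma frame_transpose:
  fixes b s :: "real^'n::finite"
  assumes f: "frame b s r" and "j < CARD('n)" "k < CARD('n)" shows "frame b s (Transposition.transpose j k \<circ> r)"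
  by (rule frame_permute[OF f]) (use assms in \<open>auto intro: permutes_swap_id\<close>)

text \<open>Three elementary moves connect all frames: exchanging two consecutive ranks, reflecting at the top, and
reflecting at the bottom. Each of them changes a single point of the flag. Exchanges generate all orders;
after moving an index to the last rank, a reflection at the bottom changes its sign; after moving it to rank
\<open>0\<close>, a reflection at the top shifts its base coordinate by \<open>2\<close>.\<close>

lemma gallery_induct:
  fixes b s b' s' :: "real^'n::finite"
  assumes f: "frame b s r" and P: "P b s r"
    and swap: "\<And>b s r k. frame b s r \<Longrightarrow> P b s r \<Longrightarrow> Suc k < CARD('n) \<Longrightarrow>
      P b s (Transposition.transpose k (Suc k) \<circ> r)"
    and flip0: "\<And>b s r. frame b s r \<Longrightarrow> P b s r \<Longrightarrow> P (flip0_base b s r) (flip0_sign s r) r"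
    and flipn: "\<And>b s r. frame b s r \<Longrightarrow> P b s r \<Longrightarrow> P b (flipn_sign s r) r"
    and f': "frame b' s' r'"
  shows "P b' s' r'"
proof -
  have transp: "P b s (Transposition.transpose a c \<circ> r)"
    if "frame b s r" "P b s r" "a < c" "c < CARD('n)" for a c b s r
    using that
  proof (induction "c - a" arbitrary: c r)
    case (Suc d)
    show ?case
    proof (cases "c = Suc a")
      case True then show ?thesis using swap Suc.prems by simp
    next
      case False
      then obtain c' where c: "c = Suc c'" "a < c'" using Suc.prems by (cases c) auto
      let ?t = "Transposition.transpose c' (Suc c')"
      have fr: "frame b s (?t \<circ> r)" using Suc.prems c by (intro frame_transpose) auto
      have "P b s (?t \<circ> r)" using swap Suc.prems c by simp
      then have "P b s (Transposition.transpose a c' \<circ> (?t \<circ> r))"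
        using Suc.hyps(1)[of c' "?t \<circ> r"] fr Suc.hyps(2) Suc.prems c by simp
      moreover have "frame b s (Transposition.transpose a c' \<circ> (?t \<circ> r))"
        using fr Suc.prems c by (intro frame_transpose) auto
      ultimately have "P b s (?t \<circ> (Transposition.transpose a c' \<circ> (?t \<circ> r)))"
        using swap Suc.prems c by simp
      moreover have "?t \<circ> (Transposition.transpose a c' \<circ> (?t \<circ> r)) = Transposition.transpose a c \<circ> r"
        using c by (auto simp: fun_eq_iff Transposition.transpose_def)
      ultimately show ?thesis by simp
    qed
  qed simp
  have perm: "P b s r'" if fr: "frame b s r" and P: "P b s r" and r': "frame b s r'" for b s r r'
  proof -
    define p where "p k = (if k < CARD('n) then r' (inv r k) else k)" for k
    have inv: "bij_betw (inv r) {..<CARD('n)} UNIV" using bij_betw_inv_into[OF frame_bij[OF fr]] .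
    have "bij_betw (r' \<circ> inv r) {..<CARD('n)} {..<CARD('n)}"
      by (rule bij_betw_trans[OF inv frame_bij[OF r']])
    then have "bij_betw p {..<CARD('n)} {..<CARD('n)}"
      by (subst bij_betw_cong[where g = "r' \<circ> inv r"]) (auto simp: p_def)
    then have p: "p permutes {..<CARD('n)}" by (intro bij_imp_permutes) (auto simp: p_def)
    have "inj r" using bij_betw_imp_inj_on[OF frame_bij[OF fr]] .
    then have pr: "p \<circ> r = r'" using frame_rank_less[OF fr] by (auto simp: fun_eq_iff p_def)
    have "P b s (p \<circ> r)"
      using p finite_lessThan
    proof (induction p rule: permutes_induct)
      case id then show ?case using P by simp
    next
      case (swap a c q)
      have fq: "frame b s (q \<circ> r)" by (rule frame_permute[OF fr swap.hyps(4)])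
      have "P b s (Transposition.transpose a c \<circ> (q \<circ> r))"
      proof (cases "a < c")
        case True
        then show ?thesis using swap.hyps by (intro transp[OF fq swap.IH]) auto
      next
        case False
        then have "P b s (Transposition.transpose c a \<circ> (q \<circ> r))"
          using swap.hyps by (intro transp[OF fq swap.IH]) auto
        then show ?thesis unfolding Transposition.transpose_commute[of a c] .
      qed
      then show ?case unfolding comp_assoc .
    qed
    then show ?thesis unfolding pr .
  qed
  have at_rank: "\<exists>r1. frame b s r1 \<and> r1 i = k" if "frame b s r" "k < CARD('n)"
    for b s :: "real^'n" and r i k
    using frame_transpose[OF that(1), of "r i" k] frame_rank_less[OF that(1), of i] that(2)
    by (intro exI[of _ "Transposition.transpose (r i) k \<circ> r"]) simp
  have sgn1: "P b (\<chi> j. if j = i then - s $ j else s $ j) r'"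
    if fr: "frame b s r" and P: "P b s r" and fr': "frame b (\<chi> j. if j = i then - s $ j else s $ j) r'"
    for b s r r' i
  proof -
    obtain r1 where r1: "frame b s r1" "r1 i = CARD('n) - 1"
      using at_rank[OF fr, where i = i and k = "CARD('n) - 1"] by auto
    have "flipn_sign s r1 = (\<chi> j. if j = i then - s $ j else s $ j)"
      using frame_rank_inj[OF r1(1), of _ i] r1(2) by (simp add: flipn_sign_def vec_eq_iff)
    then show ?thesis
      using flipn[OF r1(1) perm[OF fr P r1(1)]] perm[OF frame_flipn[OF r1(1)] _ ] fr' by metis
  qed
  have sgn: "P b s' r'" if fr: "frame b s r" and P: "P b s r" and fr': "frame b s' r'" for b s r s' r'
  proof -
    have "frame b (\<chi> j. if j \<in> S then s' $ j else s $ j) r' \<and> P b (\<chi> j. if j \<in> S then s' $ j else s $ j) r'"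
      if "finite S" for S
      using that
    proof (induction S)
      case empty
      have "frame b s r'" using fr fr' by (simp add: frame_def)
      then show ?case using perm[OF fr P] by simp
    next
      case (insert i S)
      let ?s = "\<chi> j. if j \<in> S then s' $ j else s $ j"
      let ?s' = "\<chi> j. if j \<in> insert i S then s' $ j else s $ j"
      have fr2: "frame b ?s' r'" using fr fr' by (simp add: frame_def)
      show ?case
      proof (cases "s' $ i = s $ i")
        case True
        then have "?s' = ?s" by (auto simp: vec_eq_iff)
        then show ?thesis using insert.IH by simp
      next
        case False
        then have "s' $ i = - s $ i" using frame_sgn[OF fr, of i] frame_sgn[OF fr', of i] by auto
        then have "?s' = (\<chi> j. if j = i then - ?s $ j else ?s $ j)" using insert.hyps by (auto simp: vec_eq_iff)
        then show ?thesis using sgn1[of b ?s r' i r'] insert.IH fr2 by metis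
      qed
    qed
    from this[of UNIV] show ?thesis by simp
  qed
  \<comment> \<open>By the previous steps only the base point matters.\<close>
  define R where "R b \<longleftrightarrow> (\<forall>s r. frame b s r \<longrightarrow> P b s r)" for b
  have base1: "R (\<chi> j. if j = i then b $ j + 2 * c else b $ j)"
    if fr: "frame b s r" and R: "R b" and c: "c = 1 \<or> c = -1" for b s r i c
    unfolding R_def
  proof (intro allI impI)
    fix s' r' assume fr': "frame (\<chi> j. if j = i then b $ j + 2 * c else b $ j) s' r'"
    obtain r1 where r1: "frame b s r1" "r1 i = 0"
      using at_rank[OF fr, where i = i and k = 0] by auto
    define s1 :: "real^'n" where "s1 = (\<chi> j. c)"
    have f1: "frame b s1 r1" using r1(1) c by (simp add: frame_def s1_def)
    have "flip0_base b s1 r1 = (\<chi> j. if j = i then b $ j + 2 * c else b $ j)"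
      using frame_rank_inj[OF r1(1), of _ i] r1(2) by (simp add: flip0_base_def vec_eq_iff s1_def)
    then show "P (\<chi> j. if j = i then b $ j + 2 * c else b $ j) s' r'"
      using sgn[OF frame_flip0[OF f1] flip0[OF f1]] f1 R fr' by (auto simp: R_def)
  qed
  have base2: "R (\<chi> j. if j = i then b $ j + 2 * of_int m else b $ j)"
    if fr: "frame b s r" and R: "R b" for b s r i and m :: int
  proof -
    have fr2: "frame (\<chi> j. if j = i then b $ j + 2 * of_int k else b $ j) s r" for k :: int
      using fr unfolding frame_def by (auto, metis distrib_left of_int_add)
    show ?thesis
    proof (induction m rule: int_induct[where k = 0])
      case base
      have "(\<chi> j. if j = i then b $ j + 2 * of_int 0 else b $ j) = b" by (simp add: vec_eq_iff)
      then show ?case using R by simp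
    next
      case (step1 m)
      have "(\<chi> j. if j = i then b $ j + 2 * of_int (m + 1) else b $ j) =
        (\<chi> j. if j = i then (\<chi> j. if j = i then b $ j + 2 * of_int m else b $ j) $ j + 2 * 1
           else (\<chi> j. if j = i then b $ j + 2 * of_int m else b $ j) $ j)" by (simp add: vec_eq_iff)
      then show ?case using base1[OF fr2[of m] step1(2), of 1] by simp
    next
      case (step2 m)
      have "(\<chi> j. if j = i then b $ j + 2 * of_int (m - 1) else b $ j) =
        (\<chi> j. if j = i then (\<chi> j. if j = i then b $ j + 2 * of_int m else b $ j) $ j + 2 * (- 1)
           else (\<chi> j. if j = i then b $ j + 2 * of_int m else b $ j) $ j)" by (simp add: vec_eq_iff)
      then show ?case using base1[OF fr2[of m] step2(2), of "-1"] by simp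
    qed
  qed
  have "frame (\<chi> j. if j \<in> S then b' $ j else b $ j) s r \<and> R (\<chi> j. if j \<in> S then b' $ j else b $ j)"
    if "finite S" for S
    using that
  proof (induction S)
    case empty
    then show ?case using f sgn[OF f P] by (auto simp: R_def)
  next
    case (insert i S)
    let ?b = "\<chi> j. if j \<in> S then b' $ j else b $ j"
    obtain z z' :: int where z: "b $ i = 2 * of_int z" "b' $ i = 2 * of_int z'"
      using frame_even[OF f] frame_even[OF f'] by metis
    have "(\<chi> j. if j \<in> insert i S then b' $ j else b $ j) =
      (\<chi> j. if j = i then ?b $ j + 2 * of_int (z' - z) else ?b $ j)"
      using insert.hyps z by (auto simp: vec_eq_iff)
    moreover have "frame (\<chi> j. if j \<in> insert i S then b' $ j else b $ j) s r"
      using f f' by (simp add: frame_def)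
    ultimately show ?case using base2[of ?b s r i "z' - z"] insert.IH by metis
  qed
  from this[of UNIV] show ?thesis using f' by (simp add: R_def)
qed

lemma agree_off_one_point:
  assumes "bij_betw l1 V L" "bij_betw l2 V L" and eq: "\<And>v. v \<in> V \<Longrightarrow> v \<noteq> x \<Longrightarrow> l1 v = l2 v" and v: "v \<in> V"
  shows "l1 v = l2 v"
proof (cases "v = x")
  case True
  have "l1 ` (V - {x}) = l2 ` (V - {x})" using eq by (intro image_cong) auto
  moreover have "l1 ` (V - {x}) = L - {l1 x}" "l2 ` (V - {x}) = L - {l2 x}"
    using assms(1,2) v True by (auto simp: bij_betw_def inj_on_def)
  moreover have "l1 x \<in> L" "l2 x \<in> L" using assms(1,2) v True by (auto simp: bij_betw_def)
  ultimately have "l1 x = l2 x" by (metis Diff_iff singletonD singletonI)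
  then show ?thesis using True by simp
qed (use assms in blast)

lemma fvert_swap:
  "j \<noteq> Suc k \<Longrightarrow> fvert b s (Transposition.transpose k (Suc k) \<circ> r) j = fvert b s r j"
  by (auto simp: fvert_def vec_eq_iff Transposition.transpose_def)

text \<open>A labelling of a chamber is determined by its values on a panel, and an elementary move changes at most one
vertex of the chamber: the reflections at a fork do not change the chamber at all.\<close>

lemma labels_agree:
  fixes b s b' s' :: "real^'n::finite"
  assumes adm: "admissible_rank ty CARD('n)"
    and l1: "\<And>(b::real^'n) s r. frame b s r \<Longrightarrow> bij_betw l1 (cverts ty b s r) {..CARD('n)}"
    and l2: "\<And>(b::real^'n) s r. frame b s r \<Longrightarrow> bij_betw l2 (cverts ty b s r) {..CARD('n)}"
    and f: "frame b s r" and eq: "\<And>v. v \<in> cverts ty b s r \<Longrightarrow> l1 v = l2 v"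
    and f': "frame b' s' r'" and v: "v \<in> cverts ty b' s' r'"
  shows "l1 v = l2 v"
proof -
  define P where "P b s r \<longleftrightarrow> (\<forall>v \<in> cverts ty b s r. l1 v = l2 v)" for b s :: "real^'n" and r
  have step: "P b2 s2 r2" if P: "P b1 s1 r1" and f2: "frame b2 s2 r2"
    and m: "\<And>j. j \<le> CARD('n) \<Longrightarrow> j \<noteq> m \<Longrightarrow> cvert ty b2 s2 r2 j = cvert ty b1 s1 r1 j"
    for b1 s1 b2 s2 :: "real^'n" and r1 r2 m
    unfolding P_def
  proof
    fix v assume "v \<in> cverts ty b2 s2 r2"
    then show "l1 v = l2 v"
    proof (rule agree_off_one_point[OF l1[OF f2] l2[OF f2], rotated])
      fix v assume v: "v \<in> cverts ty b2 s2 r2" "v \<noteq> cvert ty b2 s2 r2 m"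
      then obtain j where "j \<le> CARD('n)" "j \<noteq> m" "v = cvert ty b2 s2 r2 j" by (auto simp: cverts_def)
      then have "v \<in> cverts ty b1 s1 r1" using m by (auto simp: cverts_def)
      then show "l1 v = l2 v" using P by (auto simp: P_def)
    qed
  qed
  have n: "CARD('n) \<noteq> 0" by simp
  have "P b' s' r'"
  proof (rule gallery_induct[where P = P, OF f _ _ _ _ f'])
    show "P b s r" using eq by (simp add: P_def)
    fix b s :: "real^'n" and r assume fr: "frame b s r" and P: "P b s r"
    show "P b s (Transposition.transpose k (Suc k) \<circ> r)" if k: "Suc k < CARD('n)" for k
    proof (rule step[OF P frame_transpose[OF fr _ k], where m = "Suc k"])
      show "cvert ty b s (Transposition.transpose k (Suc k) \<circ> r) j = cvert ty b s r j"
        if "j \<le> CARD('n)" "j \<noteq> Suc k" for j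
      proof -
        have "CARD('n) \<noteq> Suc k" "0 \<noteq> Suc k" using k by auto
        then show ?thesis
          using fvert_swap[OF that(2), of b s r] fvert_swap[of 0 k b s r]
            fvert_swap[of "CARD('n)" k b s r] that(2)
          by (auto simp: cvert_def)
      qed
    qed (use k in simp)
    show "P (flip0_base b s r) (flip0_sign s r) r"
    proof (cases "ty = AffC")
      case True
      show ?thesis
        by (rule step[OF P frame_flip0[OF fr], where m = 0]) (use True in \<open>simp add: cvert_def fvert_flip0\<close>)
    next
      case False then show ?thesis using P cverts_flip0[OF False adm] by (simp add: P_def)
    qed
    show "P b (flipn_sign s r) r"
    proof (cases "ty = AffD")
      case True then show ?thesis using P cverts_flipn[OF True adm fr] by (simp add: P_def)
    next
      case False
      show ?thesis
      proof (rule step[OF P frame_flipn[OF fr], where m = "CARD('n)"])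
        fix j assume "j \<le> CARD('n)" "j \<noteq> CARD('n)"
        then have j: "j < CARD('n)" by simp
        then have "fvert b (flipn_sign s r) r j = fvert b s r j" "fvert b (flipn_sign s r) r 0 = fvert b s r 0"
          using fvert_flipn(1)[OF fr] by auto
        moreover have "fvert b (flipn_sign s r) r 1 = fvert b s r 1" if "j = 1"
          using fvert_flipn(1)[OF fr] j that by simp
        ultimately show "cvert ty b (flipn_sign s r) r j = cvert ty b s r j"
          using False by (auto simp: cvert_def)
      qed
    qed
  qed
  then show ?thesis using v by (simp add: P_def)
qed

section \<open>Subdivision of the Coxeter complex\<close>

text \<open>The simplex of the Coxeter complex whose barycentre is the integer point \<open>w\<close>, scaled by \<open>1/2\<close>: a vertex, or
the edge joining the two leaves of a fork. In types \<open>B\<close> and \<open>D\<close> the points with exactly one odd coordinate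
are midpoints of such edges, and in type \<open>D\<close> also those with exactly one even coordinate; the edge is parallel to
that coordinate axis.\<close>

definition carrier :: "affine_type \<Rightarrow> real^'n \<Rightarrow> (real^'n::finite) set" where
  "carrier ty w = (let J = {i. w $ i / 2 \<notin> \<int>} in
     if ty \<noteq> AffC \<and> card J = 1 then (\<lambda>(i, c). (1/2) *\<^sub>R (w + axis i c)) ` (J \<times> {1, -1})
     else if ty = AffD \<and> card J = CARD('n) - 1 then (\<lambda>(i, c). (1/2) *\<^sub>R (w + axis i c)) ` ((- J) \<times> {1, -1})
     else {(1/2) *\<^sub>R w})"

lemma carrier_fvert:
  fixes b s :: "real^'n::finite"
  assumes f: "frame b s r" and adm: "admissible_rank ty CARD('n)" and k: "k \<le> CARD('n)"
  shows "carrier ty (fvert b s r k) =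
    (if ty \<noteq> AffC \<and> k = 1 then {cvert ty b s r 0, cvert ty b s r 1}
     else if ty = AffD \<and> k = CARD('n) - 1 then {cvert ty b s r (CARD('n) - 1), cvert ty b s r (CARD('n))}
     else {(1/2) *\<^sub>R fvert b s r k})"
proof -
  have J: "{i. fvert b s r k $ i / 2 \<notin> \<int>} = {i. r i < k}" using half_fvert_Ints[OF f] by simp
  have cJ: "card {i. r i < k} = k" by (rule card_rank_less[OF f k])
  consider "ty \<noteq> AffC" "k = 1" | "ty = AffD" "k = CARD('n) - 1" "k \<noteq> 1"
    | "\<not> (ty \<noteq> AffC \<and> k = 1)" "\<not> (ty = AffD \<and> k = CARD('n) - 1)" by blast
  then show ?thesis
  proof cases
    case 1
    then have n: "3 \<le> CARD('n)" using adm by (cases ty) (auto simp: admissible_rank_def)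
    obtain i0 where i0: "r i0 = 0" using frame_rank_onto[OF f, of 0] by auto
    have r0: "r i = 0 \<longleftrightarrow> i = i0" for i using i0 frame_rank_inj[OF f, of i i0] by auto
    have "cvert ty b s r 0 = (1/2) *\<^sub>R (fvert b s r k + axis i0 (- s $ i0))"
      using 1 n by (auto simp: cvert_def fvert_def vec_eq_iff axis_def r0)
    moreover have "cvert ty b s r 1 = (1/2) *\<^sub>R (fvert b s r k + axis i0 (s $ i0))"
      using 1 n by (auto simp: cvert_def fvert_def vec_eq_iff axis_def r0)
    moreover have "carrier ty (fvert b s r k) =
      {(1/2) *\<^sub>R (fvert b s r k + axis i0 1), (1/2) *\<^sub>R (fvert b s r k + axis i0 (-1))}"
      unfolding carrier_def J using 1 by (simp add: r0)
    ultimately have "carrier ty (fvert b s r k) = {cvert ty b s r 0, cvert ty b s r 1}"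
      using frame_sgn[OF f, of i0] by (elim disjE) (simp_all only: insert_commute minus_minus)
    then show ?thesis using 1 by simp
  next
    case 2
    then have n: "4 \<le> CARD('n)" using adm by (auto simp: admissible_rank_def)
    obtain il where il: "r il = CARD('n) - 1" using frame_rank_onto[OF f, of "CARD('n) - 1"] by auto
    have rl: "r i < CARD('n) - Suc 0 \<longleftrightarrow> i \<noteq> il" and lt: "r i < CARD('n)" for i
      using il frame_rank_inj[OF f, of i il] frame_rank_less[OF f, of i] by auto
    have comp: "- {i. r i < k} = {il}" using 2 rl by auto
    have "cvert ty b s r (CARD('n) - 1) = (1/2) *\<^sub>R (fvert b s r k + axis il (- s $ il))"
      using 2 n by (auto simp: cvert_def fvert_def vec_eq_iff axis_def rl lt)
    moreover have "cvert ty b s r (CARD('n)) = (1/2) *\<^sub>R (fvert b s r k + axis il (s $ il))"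
      using 2 n by (auto simp: cvert_def fvert_def vec_eq_iff axis_def rl lt)
    moreover have "carrier ty (fvert b s r k) =
      {(1/2) *\<^sub>R (fvert b s r k + axis il 1), (1/2) *\<^sub>R (fvert b s r k + axis il (-1))}"
      unfolding carrier_def J Let_def cJ comp using 2 by simp
    ultimately have "carrier ty (fvert b s r k) = {cvert ty b s r (CARD('n) - 1), cvert ty b s r (CARD('n))}"
      using frame_sgn[OF f, of il] by (elim disjE) (simp_all only: insert_commute minus_minus)
    then show ?thesis using 2 by simp
  next
    case 3
    then show ?thesis unfolding carrier_def J Let_def cJ by auto
  qed
qed

text \<open>Inverse of \<open>carrier\<close>: the barycentre, scaled by \<open>2\<close>.\<close>

definition position :: "(real^'n::finite) set \<Rightarrow> real^'n" where
  "position E = (2 / card E) *\<^sub>R \<Sum>E"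

lemma position_carrier:
  fixes b s :: "real^'n::finite"
  assumes f: "frame b s r" and adm: "admissible_rank ty CARD('n)" and k: "k \<le> CARD('n)"
  shows "position (carrier ty (fvert b s r k)) = fvert b s r k"
proof -
  consider "ty \<noteq> AffC" "k = 1" | "ty = AffD" "k = CARD('n) - 1" "k \<noteq> 1"
    | "\<not> (ty \<noteq> AffC \<and> k = 1)" "\<not> (ty = AffD \<and> k = CARD('n) - 1)" by blast
  then show ?thesis
  proof cases
    case 1
    have "cvert ty b s r 0 \<noteq> cvert ty b s r 1"
      using coxeter_type_fork0[OF f adm 1(1)] by (auto simp: doubleton_eq_iff)
    moreover have "cvert ty b s r 0 + cvert ty b s r 1 = fvert b s r k"
      using 1 adm by (auto simp: cvert_def admissible_rank_def vec_eq_iff field_simps split: affine_type.splits)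
    ultimately show ?thesis unfolding carrier_fvert[OF assms] position_def using 1 by simp
  next
    case 2
    have "cvert ty b s r (CARD('n) - 1) \<noteq> cvert ty b s r (CARD('n))"
      using coxeter_type_forkn[OF f adm 2(1)] adm 2(1)
      by (auto simp: doubleton_eq_iff admissible_rank_def)
    moreover have "cvert ty b s r (CARD('n) - 1) + cvert ty b s r (CARD('n)) = fvert b s r k"
      using 2 adm by (auto simp: cvert_def admissible_rank_def vec_eq_iff field_simps)
    ultimately show ?thesis unfolding carrier_fvert[OF assms] position_def using 2 by simp
  next
    case 3
    then show ?thesis unfolding carrier_fvert[OF assms] position_def by auto
  qed
qed

lemma carrier_subset_cverts:
  fixes b s :: "real^'n::finite"
  assumes f: "frame b s r" and adm: "admissible_rank ty CARD('n)" and k: "k \<le> CARD('n)"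
  shows "carrier ty (fvert b s r k) \<subseteq> cverts ty b s r" "carrier ty (fvert b s r k) \<noteq> {}"
proof -
  have "(1/2) *\<^sub>R fvert b s r k = cvert ty b s r k"
    if "\<not> (ty \<noteq> AffC \<and> k = 1)" "\<not> (ty = AffD \<and> k = CARD('n) - 1)"
    using that by (auto simp: cvert_def)
  then show "carrier ty (fvert b s r k) \<subseteq> cverts ty b s r"
    unfolding carrier_fvert[OF assms] using k by (auto simp: cverts_def)
  show "carrier ty (fvert b s r k) \<noteq> {}"
    unfolding carrier_fvert[OF assms] by auto
qed

text \<open>The subdivision type is the number of odd coordinates.\<close>

lemma carrier_types:
  fixes b s :: "real^'n::finite"
  assumes f: "frame b s r" and adm: "admissible_rank ty CARD('n)" and k: "k \<le> CARD('n)"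
  shows "subdivision_type ty CARD('n) (coxeter_type ty) (carrier ty (fvert b s r k)) = k"
    and "(\<exists>v. carrier ty (fvert b s r k) = {v}) \<or>
      coxeter_type ty ` carrier ty (fvert b s r k) \<in> forks ty CARD('n)"
proof -
  define T where "T = coxeter_type ty ` carrier ty (fvert b s r k)"
  have st: "subdivision_type ty CARD('n) (coxeter_type ty) (carrier ty (fvert b s r k)) =
     (if ty \<noteq> AffC \<and> T = {0, 1} then 1
      else if ty \<noteq> AffC \<and> T \<subseteq> {0, 1} then 0
      else if ty = AffD \<and> T = {CARD('n) - 1, CARD('n)} then CARD('n) - 1
      else if ty = AffD \<and> T \<subseteq> {CARD('n) - 1, CARD('n)} then CARD('n)
      else the_elem T)" unfolding subdivision_type_def T_def ..
  have n3: "ty \<noteq> AffC \<Longrightarrow> 3 \<le> CARD('n)" and n4: "ty = AffD \<Longrightarrow> 4 \<le> CARD('n)"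
    using adm by (cases ty; auto simp: admissible_rank_def)+
  have reg: "T = {coxeter_type ty (cvert ty b s r k)}"
    if "\<not> (ty \<noteq> AffC \<and> k = 1)" "\<not> (ty = AffD \<and> k = CARD('n) - 1)"
    unfolding T_def carrier_fvert[OF assms] using that by (auto simp: cvert_def)
  have single: "carrier ty (fvert b s r k) = {(1/2) *\<^sub>R fvert b s r k}"
    if "\<not> (ty \<noteq> AffC \<and> k = 1)" "\<not> (ty = AffD \<and> k = CARD('n) - 1)"
    unfolding carrier_fvert[OF assms] using that by auto
  have h0: "first_fork_index ty k \<Longrightarrow> ty \<noteq> AffC \<and> (k = 1 \<or> k = 0)" by (auto simp: first_fork_index_def)
  have hn: "last_fork_index ty CARD('n) k \<Longrightarrow> ty = AffD \<and> (k = CARD('n) - 1 \<or> k = CARD('n))"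
    using k by (auto simp: last_fork_index_def)
  consider (a) "ty \<noteq> AffC" "k = 1" | (b) "ty = AffD" "k = CARD('n) - 1" "k \<noteq> 1"
    | (c) "ty \<noteq> AffC" "k = 0" | (d) "ty = AffD" "k = CARD('n)"
    | (e) "\<not> first_fork_index ty k" "\<not> last_fork_index ty CARD('n) k"
    using h0 hn by blast
  then have "subdivision_type ty CARD('n) (coxeter_type ty) (carrier ty (fvert b s r k)) = k \<and>
    ((\<exists>v. carrier ty (fvert b s r k) = {v}) \<or> T \<in> forks ty CARD('n))"
  proof cases
    case a
    have "T = {0, 1}"
      using coxeter_type_fork0[OF f adm a(1)] a unfolding T_def carrier_fvert[OF assms] by simp
    then show ?thesis unfolding st using a by (cases ty) (auto simp: forks_def)
  next
    case b
    have "T = {CARD('n) - 1, CARD('n)}"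
      using coxeter_type_forkn[OF f adm b(1)] b unfolding T_def carrier_fvert[OF assms] by simp
    moreover have "{CARD('n) - 1, CARD('n)} \<noteq> {0, 1}" "\<not> {CARD('n) - 1, CARD('n)} \<subseteq> {0, 1}"
      using n4[OF b(1)] by (auto simp: doubleton_eq_iff)
    ultimately show ?thesis unfolding st using b by (simp add: forks_def)
  next
    case c
    have n: "\<not> (ty = AffD \<and> k = CARD('n) - 1)" using c n4 by auto
    have "coxeter_type ty (cvert ty b s r 0) \<in> {0, 1}" using coxeter_type_fork0[OF f adm c(1)] by blast
    then have "T \<noteq> {0, 1}" "T \<subseteq> {0, 1}" using reg n c by auto
    then show ?thesis unfolding st using c single[OF _ n] by simp
  next
    case d
    have n: "\<not> (ty \<noteq> AffC \<and> k = 1)" "\<not> (ty = AffD \<and> k = CARD('n) - 1)" using d n4 by auto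
    have t: "coxeter_type ty (cvert ty b s r (CARD('n))) \<in> {CARD('n) - 1, CARD('n)}"
      using coxeter_type_forkn[OF f adm d(1)] by blast
    have T: "T = {coxeter_type ty (cvert ty b s r (CARD('n)))}" using reg[OF n] d by simp
    have "T \<noteq> {0, 1}" "\<not> T \<subseteq> {0, 1}" "T \<noteq> {CARD('n) - 1, CARD('n)}" "T \<subseteq> {CARD('n) - 1, CARD('n)}"
      using t n4[OF d(1)] unfolding T by auto
    then show ?thesis unfolding st using d single[OF n] by simp
  next
    case e
    have n: "\<not> (ty \<noteq> AffC \<and> k = 1)" "\<not> (ty = AffD \<and> k = CARD('n) - 1)"
      using e by (auto simp: first_fork_index_def last_fork_index_def)
    have T: "T = {k}" using reg[OF n] coxeter_type_regular[OF f adm k e] by simp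
    then show ?thesis
      unfolding st using e k single[OF n] by (auto simp: first_fork_index_def last_fork_index_def)
  qed
  then show "subdivision_type ty CARD('n) (coxeter_type ty) (carrier ty (fvert b s r k)) = k"
    "(\<exists>v. carrier ty (fvert b s r k) = {v}) \<or>
      coxeter_type ty ` carrier ty (fvert b s r k) \<in> forks ty CARD('n)"
    by (auto simp: T_def)
qed

section \<open>Uniqueness of barycentric coordinates\<close>

lemma fvert_inj:
  fixes b s :: "real^'n::finite"
  assumes f: "frame b s r" shows "inj_on (fvert b s r) {..CARD('n)}"
proof (rule inj_onI)
  fix j k assume jk: "j \<in> {..CARD('n)}" "k \<in> {..CARD('n)}" and eq: "fvert b s r j = fvert b s r k"
  have "{i. r i < j} = {i. r i < k}" using half_fvert_Ints[OF f] eq by (metis (no_types, lifting))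
  then show "j = k" using card_rank_less[OF f] jk by (metis atMost_iff)
qed

lemma fvert_Ints:
  fixes b s :: "real^'n::finite"
  assumes f: "frame b s r" shows "fvert b s r k $ i \<in> \<int>"
  using frame_even[OF f, of i] frame_sgn[OF f, of i] by (auto simp: fvert_def)

text \<open>The order complex of \<open>\<int>\<^sup>n\<close>, where an even coordinate lies below the two adjacent odd ones, is a product of
subdivided lines. A point \<open>p\<close> given by barycentric coordinates \<open>u\<^sub>0, \<dots>, u\<^sub>n\<close> on a flag corresponds to the step
function on \<open>[0, 1]\<close> that takes the value of the \<open>k\<close>-th point of the flag on an interval of length \<open>u\<^sub>k\<close>. Here
\<open>level_compatible p v t\<close> characterises the value \<open>v\<close> of this function at time \<open>t\<close> in terms of \<open>p\<close> alone.\<close>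

definition level_compatible :: "real^'n \<Rightarrow> real^'n \<Rightarrow> real \<Rightarrow> bool" where
  "level_compatible p v t \<longleftrightarrow> (\<forall>i::'n::finite. \<bar>p $ i - v $ i\<bar> < (if v $ i / 2 \<in> \<int> then 1 - t else t))"

text \<open>Two candidates differ by less than \<open>2\<close> in coordinates of equal parity and by less than \<open>1\<close> in the others.\<close>

lemma level_compatible_unique:
  assumes v: "\<And>i. v $ i \<in> \<int>" and w: "\<And>i. w $ i \<in> \<int>" and t: "0 < t" "t < 1"
    and c: "level_compatible p v t" "level_compatible p w t"
  shows "v = w"
proof (rule vec_eq_iff[THEN iffD2], rule allI)
  fix i
  obtain m k :: int where m: "v $ i = of_int m" "w $ i = of_int k"
    using v[of i] w[of i] by (auto elim!: Ints_cases)
  have half: "real_of_int z / 2 \<in> \<int> \<longleftrightarrow> even z" for z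
  proof
    assume "real_of_int z / 2 \<in> \<int>"
    then obtain y :: int where "real_of_int z / 2 = of_int y" by (auto elim: Ints_cases)
    then have "real_of_int z = of_int (2 * y)" by simp
    then have "z = 2 * y" using of_int_eq_iff by blast
    then show "even z" by simp
  qed (auto elim!: evenE)
  have a: "\<bar>p $ i - m\<bar> < (if even m then 1 - t else t)" "\<bar>p $ i - k\<bar> < (if even k then 1 - t else t)"
    using c(1)[unfolded level_compatible_def, rule_format, of i]
      c(2)[unfolded level_compatible_def, rule_format, of i] unfolding m half by simp_all
  have "m = k"
  proof (cases "even m = even k")
    case True
    then have "\<bar>real_of_int m - real_of_int k\<bar> < 2" using a t by (auto split: if_splits)
    then have "\<bar>m - k\<bar> < 2" by linarith
    then show ?thesis using True by presburger
  next
    case False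
    then have "\<bar>real_of_int m - real_of_int k\<bar> < 1" using a by (auto split: if_splits)
    then show ?thesis by linarith
  qed
  then show "v $ i = w $ i" using m by simp
qed

definition level_set :: "real^'n \<Rightarrow> real^'n::finite \<Rightarrow> real set" where
  "level_set p v = {t. 0 < t \<and> t < 1 \<and> level_compatible p v t}"

lemma open_level_set: "open (level_set p v)"
proof -
  have "level_set p v = {0<..<1} \<inter> (\<Inter>i. {t. \<bar>p $ i - v $ i\<bar> < (if v $ i / 2 \<in> \<int> then 1 - t else t)})"
    by (auto simp: level_set_def level_compatible_def)
  moreover have "open {t. \<bar>p $ i - v $ i\<bar> < (if v $ i / 2 \<in> \<int> then 1 - t else t)}" for i
    by (cases "v $ i / 2 \<in> \<int>") (simp_all add: open_Collect_less continuous_intros)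
  ultimately show ?thesis by (simp add: open_INT open_Int)
qed

text \<open>At a time when the step function takes the value of the \<open>k\<close>-th point, consider one coordinate. If it has already
moved, the \<open>k\<close>-th point differs from \<open>p\<close> in it by the total weight of the points before the move; otherwise, by the
total weight of the points after the move.\<close>

lemma level_set_interval:
  fixes b s :: "real^'n::finite"
  assumes f: "frame b s r" and nonneg: "\<And>k. 0 \<le> u k" and sum1: "(\<Sum>k\<le>CARD('n). u k) = 1"
    and p: "p = (\<Sum>k\<le>CARD('n). u k *\<^sub>R fvert b s r k)" and k: "k \<le> CARD('n)"
  shows "{(\<Sum>j<k. u j)<..<(\<Sum>j<Suc k. u j)} \<subseteq> level_set p (fvert b s r k)"
proof
  fix t assume t: "t \<in> {(\<Sum>j<k. u j)<..<(\<Sum>j<Suc k. u j)}"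
  have split: "(\<Sum>j\<le>CARD('n). if m < j then u j else 0) = 1 - (\<Sum>j<Suc m. u j)" if "m \<le> CARD('n)" for m
  proof -
    have "(\<Sum>j\<le>CARD('n). u j) = (\<Sum>j\<le>CARD('n). if m < j then u j else 0) + (\<Sum>j\<le>CARD('n). if j < Suc m then u j else 0)"
      unfolding sum.distrib[symmetric] by (intro sum.cong) auto
    also have "(\<Sum>j\<le>CARD('n). if j < Suc m then u j else 0) = (\<Sum>j<Suc m. u j)"
      using that by (intro sum.mono_neutral_cong_right) auto
    finally show ?thesis using sum1 by simp
  qed
  have mono: "(\<Sum>j<m. u j) \<le> (\<Sum>j<m'. u j)" if "m \<le> m'" for m m'
    using that nonneg by (intro sum_mono2) auto
  have 0: "0 \<le> (\<Sum>j<k. u j)" using nonneg by (intro sum_nonneg) auto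
  have 1: "(\<Sum>j<Suc k. u j) \<le> 1" using split[OF k] sum_nonneg[of "{..CARD('n)}" "\<lambda>j. if k < j then u j else 0"] nonneg
    by (simp add: sum_nonneg)
  have "level_compatible p (fvert b s r k) t"
    unfolding level_compatible_def
  proof
    fix i
    have ri: "r i < CARD('n)" by (rule frame_rank_less[OF f])
    define tl where "tl = (\<Sum>j<Suc (r i). u j)"
    have pi: "p $ i = b $ i + s $ i * (1 - tl)"
      unfolding p fvert_combination[OF f sum1] tl_def using split[of "r i"] ri by simp
    have tl: "0 \<le> tl" "tl \<le> 1" unfolding tl_def
      using nonneg mono[of "Suc (r i)" "Suc CARD('n)"] ri sum1 by (auto intro: sum_nonneg simp: lessThan_Suc_atMost)
    show "\<bar>p $ i - fvert b s r k $ i\<bar> < (if fvert b s r k $ i / 2 \<in> \<int> then 1 - t else t)"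
    proof (cases "r i < k")
      case True
      then have "tl \<le> (\<Sum>j<k. u j)" unfolding tl_def by (intro mono) simp
      moreover have "\<bar>p $ i - fvert b s r k $ i\<bar> = tl"
        using frame_sgn[OF f, of i] True tl by (auto simp: pi fvert_def)
      ultimately show ?thesis using t True half_fvert_Ints[OF f, of k i] by simp
    next
      case False
      then have "(\<Sum>j<Suc k. u j) \<le> tl" unfolding tl_def by (intro mono) simp
      moreover have "\<bar>p $ i - fvert b s r k $ i\<bar> = 1 - tl"
        using frame_sgn[OF f, of i] False tl by (auto simp: pi fvert_def)
      ultimately show ?thesis using t False half_fvert_Ints[OF f, of k i] by simp
    qed
  qed
  then show "t \<in> level_set p (fvert b s r k)" using t 0 1 by (auto simp: level_set_def)
qed

lemma barycentric_le_measure: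
  fixes b s :: "real^'n::finite"
  assumes f: "frame b s r" and nonneg: "\<And>v. 0 \<le> c v"
    and out: "\<And>v. v \<notin> fvert b s r ` {..CARD('n)} \<Longrightarrow> c v = 0"
    and sum1: "(\<Sum>k\<le>CARD('n). c (fvert b s r k)) = 1"
    and p: "p = (\<Sum>k\<le>CARD('n). c (fvert b s r k) *\<^sub>R fvert b s r k)"
  shows "c v \<le> measure lborel (level_set p v)"
proof (cases "v \<in> fvert b s r ` {..CARD('n)}")
  case False
  then show ?thesis using out by simp
next
  case True
  then obtain k where k: "k \<le> CARD('n)" "v = fvert b s r k" by auto
  define A where "A m = (\<Sum>j<m. c (fvert b s r j))" for m
  have sub: "{A k<..<A (Suc k)} \<subseteq> level_set p v"
    unfolding A_def k(2) by (rule level_set_interval[OF f _ sum1 p k(1)]) (rule nonneg)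
  have "emeasure lborel (level_set p v) \<le> emeasure lborel {0<..<1::real}"
    by (intro emeasure_mono) (auto simp: level_set_def)
  then have fin: "emeasure lborel (level_set p v) < \<infinity>" using ennreal_less_top[of 1] by (simp add: order_le_less_trans)
  have "A (Suc k) - A k = measure lborel {A k<..<A (Suc k)}"
    using nonneg by (simp add: A_def)
  also have "\<dots> \<le> measure lborel (level_set p v)"
    using fin sub by (intro measure_mono_fmeasurable) (auto intro!: fmeasurableI borel_open open_level_set)
  finally show ?thesis by (simp add: A_def k(2))
qed

text \<open>A barycentric coordinate is bounded by the length of the set of times at which the step function takes the
corresponding value. These sets are disjoint in \<open>(0, 1)\<close> and the coordinates add up to \<open>1\<close>, so the bound is
attained; and it depends on the point only, not on the flag.\<close>

theorem barycentric_unique: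
  fixes b s b' s' :: "real^'n::finite"
  assumes f: "frame b s r" and c: "\<And>v. 0 \<le> c v" "\<And>v. v \<notin> fvert b s r ` {..CARD('n)} \<Longrightarrow> c v = 0"
      "(\<Sum>k\<le>CARD('n). c (fvert b s r k)) = 1"
    and f': "frame b' s' r'" and c': "\<And>v. 0 \<le> c' v" "\<And>v. v \<notin> fvert b' s' r' ` {..CARD('n)} \<Longrightarrow> c' v = 0"
      "(\<Sum>k\<le>CARD('n). c' (fvert b' s' r' k)) = 1"
    and eq: "(\<Sum>k\<le>CARD('n). c (fvert b s r k) *\<^sub>R fvert b s r k)
      = (\<Sum>k\<le>CARD('n). c' (fvert b' s' r' k) *\<^sub>R fvert b' s' r' k)"
  shows "c = c'"
proof -
  define p where "p = (\<Sum>k\<le>CARD('n). c (fvert b s r k) *\<^sub>R fvert b s r k)"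
  define W where "W = fvert b s r ` {..CARD('n)} \<union> fvert b' s' r' ` {..CARD('n)}"
  define m where "m v = measure lborel (level_set p v)" for v
  have finW: "finite W" by (simp add: W_def)
  have le: "c v \<le> m v" for v
    unfolding m_def by (rule barycentric_le_measure[OF f c(1,2) c(3) p_def])
  have p': "p = (\<Sum>k\<le>CARD('n). c' (fvert b' s' r' k) *\<^sub>R fvert b' s' r' k)" using eq by (simp add: p_def)
  have le': "c' v \<le> m v" for v
    unfolding m_def by (rule barycentric_le_measure[OF f' c'(1,2) c'(3) p'])
  have int: "v $ i \<in> \<int>" if "v \<in> W" for v i using that fvert_Ints[OF f] fvert_Ints[OF f'] by (auto simp: W_def)
  have fin: "emeasure lborel (level_set p v) \<noteq> \<infinity>" for v
  proof -
    have "emeasure lborel (level_set p v) \<le> emeasure lborel {0<..<1::real}"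
      by (intro emeasure_mono) (auto simp: level_set_def)
    then show ?thesis by (auto simp: top_unique)
  qed
  have disj: "disjoint_family_on (level_set p) W"
    unfolding disjoint_family_on_def level_set_def using level_compatible_unique[OF int int] by blast
  have "(\<Sum>v\<in>W. m v) = measure lborel (\<Union>v\<in>W. level_set p v)"
    unfolding m_def
    by (rule measure_finite_Union[symmetric, OF finW _ disj fin]) (auto intro!: borel_open open_level_set)
  also have "\<dots> \<le> measure lborel {0<..<1::real}"
    by (rule measure_mono_fmeasurable)
      (auto simp: level_set_def[of p] intro!: fmeasurableI sets.finite_UN finW borel_open open_level_set[unfolded level_set_def])
  finally have total: "(\<Sum>v\<in>W. m v) \<le> 1" by simp
  have tight: "g v = m v" if "\<And>v. g v \<le> m v" "(\<Sum>v\<in>W. g v) = 1" "v \<in> W" for g v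
  proof (rule ccontr)
    assume "g v \<noteq> m v"
    then have "(\<Sum>v\<in>W. g v) < (\<Sum>v\<in>W. m v)"
      using that finW by (intro sum_strict_mono_ex1) (auto simp: order_less_le)
    then show False using total that by simp
  qed
  have "(\<Sum>v\<in>W. c v) = (\<Sum>v\<in>fvert b s r ` {..CARD('n)}. c v)"
    using finW c(2) by (intro sum.mono_neutral_right) (auto simp: W_def)
  then have s1: "(\<Sum>v\<in>W. c v) = 1" using c(3) by (simp add: sum.reindex[OF fvert_inj[OF f]])
  have "(\<Sum>v\<in>W. c' v) = (\<Sum>v\<in>fvert b' s' r' ` {..CARD('n)}. c' v)"
    using finW c'(2) by (intro sum.mono_neutral_right) (auto simp: W_def)
  then have s2: "(\<Sum>v\<in>W. c' v) = 1" using c'(3) by (simp add: sum.reindex[OF fvert_inj[OF f']])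
  show ?thesis
  proof
    fix v show "c v = c' v"
    proof (cases "v \<in> W")
      case True
      then show ?thesis using tight[OF le s1] tight[OF le' s2] by simp
    next
      case False
      then show ?thesis using c(2)[of v] c'(2)[of v] by (simp add: W_def)
    qed
  qed
qed

section \<open>Type-preserving isomorphisms of apartments\<close>

lemma simplicial_iso_mem:
  assumes "simplicial_iso \<phi> K L" "S \<subseteq> \<Union>K" shows "S \<in> K \<longleftrightarrow> \<phi> ` S \<in> L"
proof -
  have inj: "inj_on \<phi> (\<Union>K)" and im: "(\<lambda>S. \<phi> ` S) ` K = L"
    using assms(1) by (auto simp: simplicial_iso_def bij_betw_def)
  show ?thesis
  proof
    assume "\<phi> ` S \<in> L"
    then obtain S' where S': "S' \<in> K" "\<phi> ` S' = \<phi> ` S" using im by (metis imageE)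
    then have "S' = S" using inj_on_image_eq_iff[OF inj, of S' S] assms(2) by blast
    then show "S \<in> K" using S' by simp
  qed (use im in blast)
qed

lemma simplicial_iso_vertex: "simplicial_iso \<phi> K L \<Longrightarrow> v \<in> \<Union>K \<Longrightarrow> \<phi> v \<in> \<Union>L"
  unfolding simplicial_iso_def using bij_betwE by blast

lemma simplicial_iso_comp:
  assumes "simplicial_iso \<phi> K L" "simplicial_iso \<psi> L M" shows "simplicial_iso (\<psi> \<circ> \<phi>) K M"
proof -
  have "(\<lambda>S. (\<psi> \<circ> \<phi>) ` S) ` K = (\<lambda>S. \<psi> ` S) ` ((\<lambda>S. \<phi> ` S) ` K)" by (simp add: image_image image_comp)
  then show ?thesis using assms bij_betw_trans by (auto simp: simplicial_iso_def)
qed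

lemma simplicial_iso_inv:
  assumes "simplicial_iso \<phi> K L" shows "simplicial_iso (inv_into (\<Union>K) \<phi>) L K"
proof -
  have bij: "bij_betw \<phi> (\<Union>K) (\<Union>L)" and im: "(\<lambda>S. \<phi> ` S) ` K = L"
    using assms by (auto simp: simplicial_iso_def)
  have "inv_into (\<Union>K) \<phi> ` (\<phi> ` S) = S" if "S \<in> K" for S
    using bij_betw_imp_inj_on[OF bij] that by (intro inv_into_image_cancel) auto
  then have "(\<lambda>S. inv_into (\<Union>K) \<phi> ` S) ` L = K"
    unfolding im[symmetric] image_image by simp
  then show ?thesis using bij_betw_inv_into[OF bij] by (simp add: simplicial_iso_def)
qed

lemma closed_simplex_mono:
  assumes "S \<subseteq> T" "finite T" shows "closed_simplex S \<subseteq> closed_simplex T"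
proof
  fix x assume x: "x \<in> closed_simplex S"
  then have "(\<Sum>v\<in>T. x v) = (\<Sum>v\<in>S. x v)"
    using assms by (intro sum.mono_neutral_right) (auto simp: closed_simplex_def)
  then show "x \<in> closed_simplex T" using x assms by (auto simp: closed_simplex_def)
qed

lemma vertex_in_closed_simplex:
  assumes "finite S" "v \<in> S" shows "(\<lambda>w. if w = v then 1 else 0) \<in> closed_simplex S"
  using assms by (simp add: closed_simplex_def)

lemma closed_simplex_inj:
  assumes "finite S" "finite T" "closed_simplex S = closed_simplex T" shows "S = T"
proof -
  have "S \<subseteq> T" if "finite S" "closed_simplex S \<subseteq> closed_simplex T" for S T :: "'a set"
  proof
    fix v assume "v \<in> S"
    then have "(\<lambda>w. if w = v then 1 else 0) \<in> closed_simplex T"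
      using vertex_in_closed_simplex[OF that(1)] that(2) by blast
    then have "(if v = v then 1 else 0 :: real) = 0" if "v \<notin> T" using that unfolding closed_simplex_def by blast
    then show "v \<in> T" by auto
  qed
  then show ?thesis using assms by blast
qed

text \<open>A system \<open>\<A>\<close> of apartments is fixed. The parameter \<open>dim\<close> carries the index type of the coordinates, which does
not occur in the types of the other parameters.\<close>

locale typed_building =
  fixes ty :: affine_type and K :: "'v set set" and \<tau> :: "'v \<Rightarrow> nat" and \<A> :: "'v set set set"
    and dim :: "'n::finite itself"
  assumes adm: "admissible_rank ty CARD('n)"
    and ne: "K \<noteq> {}" and cover: "\<Union>\<A> = K"
    and apartment: "A \<in> \<A> \<Longrightarrow> \<exists>\<phi>. simplicial_iso \<phi> A (coxeter_complex ty :: (real^'n) set set) \<and>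
                     (\<forall>v\<in>\<Union>A. \<tau> v = coxeter_type ty (\<phi> v))"
    and two_simplices: "S \<in> K \<Longrightarrow> T \<in> K \<Longrightarrow> \<exists>A\<in>\<A>. S \<in> A \<and> T \<in> A"
    and exchange: "A \<in> \<A> \<Longrightarrow> A' \<in> \<A> \<Longrightarrow> S \<in> A \<inter> A' \<Longrightarrow> T \<in> A \<inter> A' \<Longrightarrow>
           \<exists>\<psi>. simplicial_iso \<psi> A A' \<and> (\<forall>v \<in> S \<union> T. \<psi> v = v)"
begin

abbreviation \<Sigma> :: "(real^'n) set set" where "\<Sigma> \<equiv> coxeter_complex ty"

lemma \<Sigma>_iff: "S \<in> \<Sigma> \<longleftrightarrow> S \<noteq> {} \<and> (\<exists>b s r. frame b s r \<and> S \<subseteq> cverts ty b s r)"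
  unfolding coxeter_complex_frames[OF adm] by simp

definition typed_iso :: "'v set set \<Rightarrow> ('v \<Rightarrow> real^'n) \<Rightarrow> bool" where
  "typed_iso A \<phi> \<longleftrightarrow> simplicial_iso \<phi> A \<Sigma> \<and> (\<forall>v\<in>\<Union>A. \<tau> v = coxeter_type ty (\<phi> v))"

lemma typed_iso_mem: "typed_iso A \<phi> \<Longrightarrow> S \<subseteq> \<Union>A \<Longrightarrow> S \<in> A \<longleftrightarrow> \<phi> ` S \<in> \<Sigma>"
  unfolding typed_iso_def using simplicial_iso_mem by blast

lemma typed_iso_inj: "typed_iso A \<phi> \<Longrightarrow> inj_on \<phi> (\<Union>A)"
  unfolding typed_iso_def simplicial_iso_def bij_betw_def by blast

lemma typed_iso_bij: "typed_iso A \<phi> \<Longrightarrow> bij_betw \<phi> (\<Union>A) (\<Union>\<Sigma>)"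
  unfolding typed_iso_def simplicial_iso_def by blast

lemma typed_iso_types: "typed_iso A \<phi> \<Longrightarrow> S \<subseteq> \<Union>A \<Longrightarrow> \<tau> ` S = coxeter_type ty ` \<phi> ` S"
  unfolding typed_iso_def image_image by (intro image_cong) auto

lemma typed_iso_frame:
  assumes "typed_iso A \<phi>" "S \<in> A"
  obtains b s r where "frame b s r" "\<phi> ` S \<subseteq> cverts ty b s r"
  using typed_iso_mem[OF assms(1), of S] assms(2) \<Sigma>_iff by auto

lemma apartment_subset:
  assumes "A \<in> \<A>" "S \<in> A" "T \<subseteq> S" "T \<noteq> {}" shows "T \<in> A"
proof -
  obtain \<phi> where \<phi>: "typed_iso A \<phi>" using apartment[OF assms(1)] by (auto simp: typed_iso_def)
  obtain b s r where "frame b s r" "\<phi> ` S \<subseteq> cverts ty b s r" using typed_iso_frame[OF \<phi> assms(2)] .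
  then have "\<phi> ` T \<in> \<Sigma>" unfolding \<Sigma>_iff using assms(3,4) by blast
  moreover have "T \<subseteq> \<Union>A" using assms by blast
  ultimately show ?thesis using typed_iso_mem[OF \<phi>] by blast
qed

lemma apartment_simplices: "A \<in> \<A> \<Longrightarrow> S \<in> A \<Longrightarrow> S \<in> K" using cover by blast

lemma simplex_nonempty: "A \<in> \<A> \<Longrightarrow> S \<in> A \<Longrightarrow> S \<noteq> {}"
proof -
  assume "A \<in> \<A>" "S \<in> A"
  moreover obtain \<phi> where "typed_iso A \<phi>" using apartment[OF \<open>A \<in> \<A>\<close>] by (auto simp: typed_iso_def)
  ultimately have "\<phi> ` S \<in> \<Sigma>" using typed_iso_mem[of A \<phi> S] by blast
  then show "S \<noteq> {}" unfolding \<Sigma>_iff by auto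
qed

definition is_chamber :: "'v set set \<Rightarrow> 'v set \<Rightarrow> bool" where
  "is_chamber A C \<longleftrightarrow> C \<in> A \<and> finite C \<and> card C = CARD('n) + 1"

lemma full_simplex:
  assumes "S \<in> \<Sigma>" "card S = CARD('n) + 1"
  obtains b s r where "frame b s r" "S = cverts ty b s r"
proof -
  obtain b s r where f: "frame b s r" "S \<subseteq> cverts ty b s r" using assms \<Sigma>_iff by blast
  then have "S = cverts ty b s r"
    using cverts_independent(2)[OF f(1) adm] assms(2) by (intro card_subset_eq) (auto simp: cverts_def)
  then show thesis using that f by blast
qed

lemma cverts_in_\<Sigma>: "frame b s r \<Longrightarrow> cverts ty b s r \<in> \<Sigma>"
  unfolding \<Sigma>_iff by (auto simp: cverts_def)

text \<open>A simplex is part of the vertex set of an alcove, and the whole of it is a chamber of \<open>A\<close>.\<close>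

lemma simplex_in_chamber:
  assumes A: "A \<in> \<A>" and S: "S \<in> A" obtains C where "is_chamber A C" "S \<subseteq> C"
proof -
  obtain \<phi> where \<phi>: "typed_iso A \<phi>" using apartment[OF A] by (auto simp: typed_iso_def)
  obtain b s r where f: "frame b s r" "\<phi> ` S \<subseteq> cverts ty b s r" using typed_iso_frame[OF \<phi> S] .
  have V: "cverts ty b s r \<in> \<Sigma>" by (rule cverts_in_\<Sigma>[OF f(1)])
  obtain C where C: "C \<in> A" "\<phi> ` C = cverts ty b s r"
    using \<phi> V unfolding typed_iso_def simplicial_iso_def by (metis imageE)
  have inj: "inj_on \<phi> C" using inj_on_subset[OF typed_iso_inj[OF \<phi>]] C(1) by blast
  have "card C = CARD('n) + 1"
    using card_image[OF inj] C(2) cverts_independent(2)[OF f(1) adm] by simp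
  moreover from this have "finite C" using card.infinite by fastforce
  moreover have "S \<subseteq> C"
    using f(2) C inj_on_image_subset_iff[OF typed_iso_inj[OF \<phi>], of S C] S by blast
  ultimately show thesis using that C(1) by (auto simp: is_chamber_def)
qed

lemma chamber_in_other: "is_chamber A C \<Longrightarrow> C \<in> B \<Longrightarrow> is_chamber B C"
  by (simp add: is_chamber_def)

text \<open>Transported to the Coxeter complex, the types of \<open>A\<close> and those pulled back from \<open>B\<close> are two labellings that
are bijective on every chamber and agree on \<open>C\<close>.\<close>

lemma exchange_preserves_types:
  assumes A: "A \<in> \<A>" and B: "B \<in> \<A>" and C: "is_chamber A C"
    and \<psi>: "simplicial_iso \<psi> A B" and fx: "\<And>v. v \<in> C \<Longrightarrow> \<psi> v = v" and v: "v \<in> \<Union>A"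
  shows "\<tau> (\<psi> v) = \<tau> v"
proof -
  obtain \<phi> where \<phi>: "typed_iso A \<phi>" using apartment[OF A] by (auto simp: typed_iso_def)
  obtain \<phi>' where \<phi>': "typed_iso B \<phi>'" using apartment[OF B] by (auto simp: typed_iso_def)
  \<comment> \<open>The automorphism of the Coxeter complex induced by \<open>\<psi>\<close>.\<close>
  define \<theta> where "\<theta> = \<phi>' \<circ> \<psi> \<circ> inv_into (\<Union>A) \<phi>"
  have \<theta>: "simplicial_iso \<theta> \<Sigma> \<Sigma>"
    unfolding \<theta>_def
    using simplicial_iso_comp[OF simplicial_iso_inv simplicial_iso_comp[OF \<psi>]] \<phi> \<phi>'
    by (auto simp: typed_iso_def comp_assoc)
  have inv: "inv_into (\<Union>A) \<phi> (\<phi> v) = v" if "v \<in> \<Union>A" for v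
    using typed_iso_inj[OF \<phi>] that by simp
  have l2: "bij_betw (coxeter_type ty \<circ> \<theta>) (cverts ty b s r) {..CARD('n)}" if f: "frame b s r" for b s r
  proof -
    have V: "cverts ty b s r \<in> \<Sigma>" by (rule cverts_in_\<Sigma>[OF f])
    have inj: "inj_on \<theta> (cverts ty b s r)"
      using \<theta> V unfolding simplicial_iso_def bij_betw_def by (meson Sup_upper inj_on_subset)
    have "\<theta> ` cverts ty b s r \<in> \<Sigma>" using \<theta> V unfolding simplicial_iso_def by blast
    moreover have "card (\<theta> ` cverts ty b s r) = CARD('n) + 1"
      using card_image[OF inj] cverts_independent(2)[OF f adm] by simp
    ultimately obtain b' s' r' where f': "frame b' s' r'" "\<theta> ` cverts ty b s r = cverts ty b' s' r'"
      by (rule full_simplex)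
    have "bij_betw \<theta> (cverts ty b s r) (cverts ty b' s' r')" using inj f'(2) by (simp add: bij_betw_def)
    then show ?thesis using coxeter_type_bij[OF f'(1) adm] bij_betw_trans by blast
  qed
  have CA: "C \<in> A" and cC: "card C = CARD('n) + 1" using C by (auto simp: is_chamber_def)
  have "inj_on \<phi> C" using inj_on_subset[OF typed_iso_inj[OF \<phi>]] CA by blast
  then have "card (\<phi> ` C) = CARD('n) + 1" using cC by (simp add: card_image)
  moreover have "\<phi> ` C \<in> \<Sigma>" using typed_iso_mem[OF \<phi>, of C] CA by blast
  ultimately obtain b s r where f: "frame b s r" "\<phi> ` C = cverts ty b s r" using full_simplex by blast
  have agree: "coxeter_type ty u = (coxeter_type ty \<circ> \<theta>) u" if "u \<in> cverts ty b s r" for u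
  proof -
    obtain w where w: "w \<in> C" "u = \<phi> w" using \<open>u \<in> _\<close> unfolding f(2)[symmetric] by (rule imageE)
    have wA: "w \<in> \<Union>A" using w(1) CA by blast
    have "w \<in> \<Union>B" using simplicial_iso_vertex[OF \<psi> wA] fx[OF w(1)] by simp
    then have "coxeter_type ty (\<phi>' w) = \<tau> w" "coxeter_type ty (\<phi> w) = \<tau> w"
      using \<phi> \<phi>' wA by (auto simp: typed_iso_def)
    then show ?thesis using w fx[OF w(1)] inv[OF wA] by (simp add: \<theta>_def)
  qed
  obtain S where S: "S \<in> A" "v \<in> S" using v by blast
  obtain b' s' r' where f': "frame b' s' r'" "\<phi> ` S \<subseteq> cverts ty b' s' r'" using typed_iso_frame[OF \<phi> S(1)] .
  have "coxeter_type ty (\<phi> v) = (coxeter_type ty \<circ> \<theta>) (\<phi> v)"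
    by (rule labels_agree[OF adm coxeter_type_bij[OF _ adm] l2 f(1) agree f'(1)]) (use f'(2) S in auto)
  moreover have "\<tau> v = coxeter_type ty (\<phi> v)" using \<phi> v by (auto simp: typed_iso_def)
  moreover have "\<tau> (\<psi> v) = coxeter_type ty (\<phi>' (\<psi> v))"
    using \<phi>' simplicial_iso_vertex[OF \<psi> v] by (auto simp: typed_iso_def)
  ultimately show ?thesis using inv[OF v] by (simp add: \<theta>_def)
qed

text \<open>Pass through an apartment \<open>E\<close> that contains a chamber of \<open>A\<close> around \<open>S\<close> and a chamber of \<open>B\<close> around \<open>T\<close>.
Both steps fix a chamber, so they preserve types.\<close>

lemma typed_exchange:
  assumes A: "A \<in> \<A>" and B: "B \<in> \<A>" and S: "S \<in> A \<inter> B" and T: "T \<in> A \<inter> B"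
  obtains \<psi> where "simplicial_iso \<psi> A B" "\<And>v. v \<in> S \<union> T \<Longrightarrow> \<psi> v = v" "\<And>v. v \<in> \<Union>A \<Longrightarrow> \<tau> (\<psi> v) = \<tau> v"
proof -
  obtain C where C: "is_chamber A C" "S \<subseteq> C" using simplex_in_chamber[OF A] S by blast
  obtain D where D: "is_chamber B D" "T \<subseteq> D" using simplex_in_chamber[OF B] T by blast
  have "C \<in> K" "D \<in> K" using C D apartment_simplices A B by (auto simp: is_chamber_def)
  then obtain E where E: "E \<in> \<A>" "C \<in> E" "D \<in> E" using two_simplices by blast
  have SE: "S \<in> E" and TE: "T \<in> E"
    using apartment_subset[OF E(1)] E C(2) D(2) S T simplex_nonempty[OF A] by blast+
  obtain \<psi>1 where 1: "simplicial_iso \<psi>1 A E" "\<forall>v\<in>C \<union> T. \<psi>1 v = v"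
    using exchange[OF A E(1), of C T] C E T TE by (auto simp: is_chamber_def)
  obtain \<psi>2 where 2: "simplicial_iso \<psi>2 E B" "\<forall>v\<in>D \<union> S. \<psi>2 v = v"
    using exchange[OF E(1) B, of D S] D E S SE by (auto simp: is_chamber_def)
  have t1: "\<tau> (\<psi>1 v) = \<tau> v" if "v \<in> \<Union>A" for v
    by (rule exchange_preserves_types[OF A E(1) C(1) 1(1) _ that]) (use 1(2) in blast)
  have t2: "\<tau> (\<psi>2 v) = \<tau> v" if "v \<in> \<Union>E" for v
    by (rule exchange_preserves_types[OF E(1) B chamber_in_other[OF D(1) E(3)] 2(1) _ that]) (use 2(2) in blast)
  show thesis
  proof (rule that)
    show "simplicial_iso (\<psi>2 \<circ> \<psi>1) A B" by (rule simplicial_iso_comp[OF 1(1) 2(1)])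
    show "(\<psi>2 \<circ> \<psi>1) v = v" if "v \<in> S \<union> T" for v using that 1(2) 2(2) C(2) D(2) by auto
    show "\<tau> ((\<psi>2 \<circ> \<psi>1) v) = \<tau> v" if "v \<in> \<Union>A" for v
      using t1[OF that] t2[OF simplicial_iso_vertex[OF 1(1) that]] by simp
  qed
qed

end

section \<open>Subdivision of an apartment\<close>

lemma subdivision_type_cong:
  "\<tau> ` e = \<sigma> ` e' \<Longrightarrow> subdivision_type ty n \<tau> e = subdivision_type ty n \<sigma> e'"
  by (simp add: subdivision_type_def)

text \<open>Both leaves of a fork receive the same type in the subdivision, so a simplex of the subdivision contains at
most one of them.\<close>

lemma subdivision_type_leaf0:
  assumes "ty \<noteq> AffC" "\<tau> v \<in> {0, 1}" shows "subdivision_type ty n \<tau> {v} = 0"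
proof -
  have "\<tau> ` {v} \<noteq> {0, 1}" "\<tau> ` {v} \<subseteq> {0, 1}" using assms(2) by auto
  then show ?thesis unfolding subdivision_type_def using assms(1) by simp
qed

lemma subdivision_type_leafn:
  assumes "ty = AffD" "4 \<le> n" "\<tau> v \<in> {n - 1, n}" shows "subdivision_type ty n \<tau> {v} = n"
proof -
  have "\<tau> ` {v} \<noteq> {0, 1}" "\<not> \<tau> ` {v} \<subseteq> {0, 1}" "\<tau> ` {v} \<noteq> {n - 1, n}" "\<tau> ` {v} \<subseteq> {n - 1, n}"
    using assms(2,3) by auto
  then show ?thesis unfolding subdivision_type_def using assms(1,2) by auto
qed

context typed_building begin

abbreviation "subd N \<equiv> subdivision ty N K \<tau>"
abbreviation "stype N \<equiv> subdivision_type ty N \<tau>"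

lemma typed_iso_type: "typed_iso A \<phi> \<Longrightarrow> v \<in> \<Union>A \<Longrightarrow> \<tau> v = coxeter_type ty (\<phi> v)"
  unfolding typed_iso_def by blast

definition vertex_at :: "'v set set \<Rightarrow> ('v \<Rightarrow> real^'n) \<Rightarrow> real^'n \<Rightarrow> 'v set" where
  "vertex_at A \<phi> w = inv_into (\<Union>A) \<phi> ` carrier ty w"

definition flag_simplex :: "'v set set \<Rightarrow> ('v \<Rightarrow> real^'n) \<Rightarrow> real^'n \<Rightarrow> real^'n \<Rightarrow> ('n \<Rightarrow> nat) \<Rightarrow> 'v set set" where
  "flag_simplex A \<phi> b s r = (\<lambda>k. vertex_at A \<phi> (fvert b s r k)) ` {..CARD('n)}"

lemma cverts_image:
  assumes \<phi>: "typed_iso A \<phi>" and f: "frame b s r" shows "cverts ty b s r \<subseteq> \<phi> ` \<Union>A"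
proof -
  have "cverts ty b s r \<subseteq> \<Union>\<Sigma>" using cverts_in_\<Sigma>[OF f] by blast
  then show ?thesis unfolding bij_betw_imp_surj_on[OF typed_iso_bij[OF \<phi>]] .
qed

lemma vertex_at_image:
  assumes \<phi>: "typed_iso A \<phi>" and f: "frame b s r" and k: "k \<le> CARD('n)"
  shows "\<phi> ` vertex_at A \<phi> (fvert b s r k) = carrier ty (fvert b s r k)"
    "vertex_at A \<phi> (fvert b s r k) \<subseteq> \<Union>A" "vertex_at A \<phi> (fvert b s r k) \<in> A"
proof -
  note c = carrier_subset_cverts[OF f adm k]
  have sub: "carrier ty (fvert b s r k) \<subseteq> \<phi> ` \<Union>A" using c(1) cverts_image[OF \<phi> f] by blast
  show im: "\<phi> ` vertex_at A \<phi> (fvert b s r k) = carrier ty (fvert b s r k)"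
    unfolding vertex_at_def by (rule image_inv_into_cancel[OF HOL.refl sub])
  show sA: "vertex_at A \<phi> (fvert b s r k) \<subseteq> \<Union>A"
    unfolding vertex_at_def using sub by (auto intro!: inv_into_into)
  show "vertex_at A \<phi> (fvert b s r k) \<in> A"
    unfolding typed_iso_mem[OF \<phi> sA] im \<Sigma>_iff using c f by blast
qed

lemma vertex_at_types:
  assumes \<phi>: "typed_iso A \<phi>" and f: "frame b s r" and k: "k \<le> CARD('n)"
  shows "\<tau> ` vertex_at A \<phi> (fvert b s r k) = coxeter_type ty ` carrier ty (fvert b s r k)"
    "stype CARD('n) (vertex_at A \<phi> (fvert b s r k)) = k"
proof -
  show 1: "\<tau> ` vertex_at A \<phi> (fvert b s r k) = coxeter_type ty ` carrier ty (fvert b s r k)"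
    unfolding typed_iso_types[OF \<phi> vertex_at_image(2)[OF assms]] vertex_at_image(1)[OF assms] ..
  show "stype CARD('n) (vertex_at A \<phi> (fvert b s r k)) = k"
    unfolding subdivision_type_cong[OF 1] by (rule carrier_types(1)[OF f adm k])
qed

lemma flag_simplex_in_subdivision:
  assumes A: "A \<in> \<A>" and \<phi>: "typed_iso A \<phi>" and f: "frame b s r"
  shows "flag_simplex A \<phi> b s r \<in> subd CARD('n)" "\<Union>(flag_simplex A \<phi> b s r) \<in> A"
proof -
  have im: "\<phi> ` \<Union>(flag_simplex A \<phi> b s r) = (\<Union>k\<le>CARD('n). carrier ty (fvert b s r k))"
    unfolding flag_simplex_def image_Union image_image using vertex_at_image(1)[OF \<phi> f] by auto
  have sub: "\<Union>(flag_simplex A \<phi> b s r) \<subseteq> \<Union>A" unfolding flag_simplex_def using vertex_at_image(2)[OF \<phi> f] by auto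
  have "(\<Union>k\<le>CARD('n). carrier ty (fvert b s r k)) \<noteq> {}"
    using carrier_subset_cverts(2)[OF f adm, of 0] by blast
  moreover have "(\<Union>k\<le>CARD('n). carrier ty (fvert b s r k)) \<subseteq> cverts ty b s r"
    by (rule UN_least, rule carrier_subset_cverts(1)[OF f adm]) simp
  ultimately have "\<phi> ` \<Union>(flag_simplex A \<phi> b s r) \<in> \<Sigma>" unfolding \<Sigma>_iff im using f by blast
  then show U: "\<Union>(flag_simplex A \<phi> b s r) \<in> A" using typed_iso_mem[OF \<phi> sub] by blast
  have "vertex_at A \<phi> (fvert b s r k) \<in> subdivision_vertices ty CARD('n) K \<tau>" if k: "k \<le> CARD('n)" for k
  proof -
    have "(\<exists>v. vertex_at A \<phi> (fvert b s r k) = {v}) \<or> \<tau> ` vertex_at A \<phi> (fvert b s r k) \<in> forks ty CARD('n)"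
      using carrier_types(2)[OF f adm k] unfolding vertex_at_types(1)[OF \<phi> f k] by (auto simp: vertex_at_def)
    then show ?thesis
      using apartment_simplices[OF A vertex_at_image(3)[OF \<phi> f k]] by (simp add: subdivision_vertices_def)
  qed
  moreover have "inj_on (stype CARD('n)) (flag_simplex A \<phi> b s r)"
    unfolding flag_simplex_def by (rule inj_onI) (auto simp: vertex_at_types(2)[OF \<phi> f])
  moreover have "flag_simplex A \<phi> b s r \<noteq> {}" by (auto simp: flag_simplex_def)
  ultimately show "flag_simplex A \<phi> b s r \<in> subd CARD('n)"
    unfolding subdivision_def using apartment_simplices[OF A U] by (auto simp: flag_simplex_def)
qed

lemma subdivision_subset:
  assumes A: "A \<in> \<A>" and S: "S \<in> subd CARD('n)" "\<Union>S \<in> A" and T: "T \<subseteq> S" "T \<noteq> {}"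
  shows "T \<in> subd CARD('n)" "\<Union>T \<in> A"
proof -
  have sub: "S \<subseteq> subdivision_vertices ty CARD('n) K \<tau>" and inj: "inj_on (stype CARD('n)) S"
    using S(1) by (auto simp: subdivision_def)
  obtain E where E: "E \<in> T" using T(2) by blast
  then have "E \<in> K" using sub T(1) by (auto simp: subdivision_vertices_def)
  then have "E \<noteq> {}" using cover simplex_nonempty by blast
  then show UT: "\<Union>T \<in> A" using T E by (intro apartment_subset[OF A S(2)]) auto
  show "T \<in> subd CARD('n)"
    unfolding subdivision_def
    using T sub inj_on_subset[OF inj T(1)] apartment_simplices[OF A UT] by auto
qed

text \<open>The converse of \<open>flag_simplex_in_subdivision\<close>. A simplex of the subdivision lies in some chamber and contains
at most one leaf of each fork. After reflecting the frame at the corresponding end, this is the leaf on the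
flag, and every vertex of the simplex is a point of the flag.\<close>

lemma cell_frame:
  assumes A: "A \<in> \<A>" and \<phi>: "typed_iso A \<phi>" and S: "S \<in> subd CARD('n)" "\<Union>S \<in> A"
  obtains b s r where "frame b s r" "S \<subseteq> flag_simplex A \<phi> b s r"
proof -
  have SV: "S \<subseteq> subdivision_vertices ty CARD('n) K \<tau>" and inj: "inj_on (stype CARD('n)) S"
    using S(1) by (auto simp: subdivision_def)
  define g where "g = inv_into (\<Union>A) \<phi>"
  have n3: "ty \<noteq> AffC \<Longrightarrow> 3 \<le> CARD('n)" and n4: "ty = AffD \<Longrightarrow> 4 \<le> CARD('n)"
    using adm by (cases ty; auto simp: admissible_rank_def)+
  have g\<phi>: "g (\<phi> v) = v" if "v \<in> \<Union>A" for v unfolding g_def using typed_iso_inj[OF \<phi>] that by simp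
  have \<phi>g: "\<phi> (g u) = u" "g u \<in> \<Union>A" if "u \<in> cverts ty b s r" "frame b s r" for u b s r
  proof -
    have u: "u \<in> \<phi> ` \<Union>A" using cverts_image[OF \<phi> that(2)] that(1) by (rule subsetD)
    show "\<phi> (g u) = u" "g u \<in> \<Union>A"
      unfolding g_def by (rule f_inv_into_f[OF u], rule inv_into_into[OF u])
  qed
  have cv: "cvert ty b s r k \<in> cverts ty b s r" if "k \<le> CARD('n)" for b s :: "real^'n" and r k
    unfolding cverts_def using that by (intro imageI) simp
  have type_g: "\<tau> (g (cvert ty b s r k)) = coxeter_type ty (cvert ty b s r k)"
    if "frame b s r" "k \<le> CARD('n)" for b s r k
    using typed_iso_type[OF \<phi> \<phi>g(2)[OF cv[OF that(2)] that(1)]]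
    unfolding \<phi>g(1)[OF cv[OF that(2)] that(1)] .
  have sing0: "stype CARD('n) {g (cvert ty b s r 0)} = stype CARD('n) {g (cvert ty b s r 1)}" if f: "frame b s r" and ty: "ty \<noteq> AffC" for b s r
  proof -
    have "coxeter_type ty (cvert ty b s r 0) \<in> {0,1}" "coxeter_type ty (cvert ty b s r 1) \<in> {0,1}"
      using coxeter_type_fork0[OF f adm ty] by blast+
    then have "\<tau> (g (cvert ty b s r 0)) \<in> {0,1}" "\<tau> (g (cvert ty b s r 1)) \<in> {0,1}"
      using type_g[OF f, of 0] type_g[OF f, of 1] by (simp_all add: Suc_le_eq)
    then show ?thesis using subdivision_type_leaf0[OF ty] by metis
  qed
  have singn: "stype CARD('n) {g (cvert ty b s r (CARD('n) - 1))} = stype CARD('n) {g (cvert ty b s r (CARD('n)))}"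
    if f: "frame b s r" and ty: "ty = AffD" for b s r
  proof -
    have "coxeter_type ty (cvert ty b s r (CARD('n) - 1)) \<in> {CARD('n) - 1, CARD('n)}"
      "coxeter_type ty (cvert ty b s r (CARD('n))) \<in> {CARD('n) - 1, CARD('n)}"
      using coxeter_type_forkn[OF f adm ty] by blast+
    then have "\<tau> (g (cvert ty b s r (CARD('n) - 1))) \<in> {CARD('n) - 1, CARD('n)}"
      "\<tau> (g (cvert ty b s r (CARD('n)))) \<in> {CARD('n) - 1, CARD('n)}"
      using type_g[OF f, of "CARD('n) - 1"] type_g[OF f, of "CARD('n)"] by simp_all
    then show ?thesis using subdivision_type_leafn[OF ty n4[OF ty]] by metis
  qed
  have g_neq: "g u \<noteq> g v" if "frame b s r" "u \<in> cverts ty b s r" "v \<in> cverts ty b s r" "u \<noteq> v" for u v b s r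
    using \<phi>g[OF that(2,1)] \<phi>g[OF that(3,1)] that(4) by metis
  have neq0: "g (cvert ty b s r 0) \<noteq> g (cvert ty b s r 1)" if f: "frame b s r" and ty: "ty \<noteq> AffC" for b s r
    by (rule g_neq[OF f cv cv]) (use coxeter_type_fork0[OF f adm ty] in \<open>auto simp: doubleton_eq_iff Suc_le_eq\<close>)
  have neqn: "g (cvert ty b s r (CARD('n) - 1)) \<noteq> g (cvert ty b s r (CARD('n)))"
    if f: "frame b s r" and ty: "ty = AffD" for b s r
    by (rule g_neq[OF f cv cv])
      (use coxeter_type_forkn[OF f adm ty] n4[OF ty] in \<open>auto simp: doubleton_eq_iff\<close>)
  \<comment> \<open>Reflect the frame, so that the leaves outside the flag do not occur in \<open>S\<close>.\<close>
  obtain b0 s0 r where f0: "frame b0 s0 r" "\<phi> ` \<Union>S \<subseteq> cverts ty b0 s0 r"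
    using typed_iso_frame[OF \<phi> S(2)] .
  have "\<exists>b s. frame b s r \<and> cverts ty b s r = cverts ty b0 s0 r \<and> (ty \<noteq> AffC \<longrightarrow> {g (cvert ty b s r 1)} \<notin> S)"
  proof (cases "ty \<noteq> AffC \<and> {g (cvert ty b0 s0 r 1)} \<in> S")
    case True
    then have ty: "ty \<noteq> AffC" and mem: "{g (cvert ty b0 s0 r 1)} \<in> S" by auto
    have "{g (cvert ty b0 s0 r 0)} \<notin> S"
      using inj_onD[OF inj sing0[OF f0(1) ty] _ mem] neq0[OF f0(1) ty] by auto
    then show ?thesis
      using frame_flip0[OF f0(1)] cverts_flip0[OF ty adm, of b0 s0 r] cvert_flip0(2)[OF ty adm, of b0 s0 r]
      by (intro exI[of _ "flip0_base b0 s0 r"] exI[of _ "flip0_sign s0 r"]) simp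
  next
    case False then show ?thesis using f0(1) by blast
  qed
  then obtain b s1 where f1: "frame b s1 r" "cverts ty b s1 r = cverts ty b0 s0 r"
    and no1: "ty \<noteq> AffC \<Longrightarrow> {g (cvert ty b s1 r 1)} \<notin> S" by blast
  have "\<exists>s. frame b s r \<and> cverts ty b s r = cverts ty b0 s0 r \<and> (ty \<noteq> AffC \<longrightarrow> {g (cvert ty b s r 1)} \<notin> S)
     \<and> (ty = AffD \<longrightarrow> {g (cvert ty b s r (CARD('n) - 1))} \<notin> S)"
  proof (cases "ty = AffD \<and> {g (cvert ty b s1 r (CARD('n) - 1))} \<in> S")
    case True
    then have ty: "ty = AffD" and mem: "{g (cvert ty b s1 r (CARD('n) - 1))} \<in> S" by auto
    have "{g (cvert ty b s1 r (CARD('n)))} \<notin> S"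
      using inj_onD[OF inj singn[OF f1(1) ty] mem] neqn[OF f1(1) ty] by auto
    then have "{g (cvert ty b (flipn_sign s1 r) r (CARD('n) - 1))} \<notin> S"
      unfolding cvert_flipn(2)[OF ty adm f1(1)] .
    moreover have "cvert ty b (flipn_sign s1 r) r 1 = cvert ty b s1 r 1"
      using n4[OF ty] by (intro cvert_flipn(3)[OF ty adm f1(1)]) simp
    moreover have "cverts ty b (flipn_sign s1 r) r = cverts ty b0 s0 r"
      unfolding cverts_flipn[OF ty adm f1(1)] by (rule f1(2))
    ultimately show ?thesis
      using frame_flipn[OF f1(1)] no1 by metis
  next
    case False then show ?thesis using f1 no1 by blast
  qed
  then obtain s where f: "frame b s r" "cverts ty b s r = cverts ty b0 s0 r"
    and no1: "ty \<noteq> AffC \<Longrightarrow> {g (cvert ty b s r 1)} \<notin> S"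
    and non: "ty = AffD \<Longrightarrow> {g (cvert ty b s r (CARD('n) - 1))} \<notin> S" by blast
  have sub: "\<phi> ` \<Union>S \<subseteq> cverts ty b s r" using f0(2) f(2) by simp
  have tinj: "inj_on (coxeter_type ty) (cverts ty b s r)"
    using coxeter_type_bij[OF f(1) adm] by (simp add: bij_betw_def)
  have sv_eq: "E = vertex_at A \<phi> (fvert b s r k)" if "E \<in> S" "\<phi> ` E = carrier ty (fvert b s r k)" for E k
  proof -
    have "g ` \<phi> ` E = E" using g\<phi> S(2) that(1) by (force simp: image_image)
    then show ?thesis using that(2) by (simp add: vertex_at_def g_def)
  qed
  have "E \<in> flag_simplex A \<phi> b s r" if E: "E \<in> S" for E
  proof -
    have EA: "E \<subseteq> \<Union>A" and E\<phi>: "\<phi> ` E \<subseteq> cverts ty b s r" using E S(2) sub by auto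
    have tE: "\<tau> ` E = coxeter_type ty ` \<phi> ` E" by (rule typed_iso_types[OF \<phi> EA])
    have "(\<exists>v. E = {v}) \<or> \<tau> ` E \<in> forks ty CARD('n)" using SV E by (auto simp: subdivision_vertices_def)
    then consider (single) v where "E = {v}" | (fork0) "ty \<noteq> AffC" "\<tau> ` E = {0, 1}"
      | (forkn) "ty = AffD" "\<tau> ` E = {CARD('n) - 1, CARD('n)}"
      by (cases ty) (auto simp: forks_def)
    then have "\<exists>k\<le>CARD('n). \<phi> ` E = carrier ty (fvert b s r k)"
    proof cases
      case single
      then obtain k where k: "k \<le> CARD('n)" "\<phi> v = cvert ty b s r k" using E\<phi> by (auto simp: cverts_def)
      have v: "v = g (cvert ty b s r k)" using g\<phi>[of v] EA single k(2) by auto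
      have "\<not> (ty \<noteq> AffC \<and> k = 1)" "\<not> (ty = AffD \<and> k = CARD('n) - 1)"
        using no1 non E single v by auto
      then have "carrier ty (fvert b s r k) = {cvert ty b s r k}"
        unfolding carrier_fvert[OF f(1) adm k(1)] by (auto simp: cvert_def)
      then show ?thesis using k single by auto
    next
      case fork0
      let ?V = "{cvert ty b s r 0, cvert ty b s r 1}"
      have "coxeter_type ty ` \<phi> ` E = coxeter_type ty ` ?V"
        using coxeter_type_fork0[OF f(1) adm fork0(1)] fork0(2) tE by simp
      moreover have "?V \<subseteq> cverts ty b s r" by (auto intro!: cv simp: Suc_le_eq)
      ultimately have "\<phi> ` E = ?V" using inj_on_image_eq_iff[OF tinj E\<phi>] by blast
      moreover have "carrier ty (fvert b s r 1) = ?V"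
        using fork0 carrier_fvert[OF f(1) adm, of 1] by (simp add: Suc_le_eq)
      ultimately show ?thesis by (intro exI[of _ 1]) (simp add: Suc_le_eq)
    next
      case forkn
      let ?V = "{cvert ty b s r (CARD('n) - 1), cvert ty b s r (CARD('n))}"
      have "coxeter_type ty ` \<phi> ` E = coxeter_type ty ` ?V"
        using coxeter_type_forkn[OF f(1) adm forkn(1)] forkn(2) tE by simp
      moreover have "?V \<subseteq> cverts ty b s r" by (auto intro!: cv)
      ultimately have "\<phi> ` E = ?V" using inj_on_image_eq_iff[OF tinj E\<phi>] by blast
      moreover have "carrier ty (fvert b s r (CARD('n) - 1)) = ?V"
      proof -
        have "CARD('n) - 1 \<noteq> 1" using n4[OF forkn(1)] by simp
        then show ?thesis by (subst carrier_fvert[OF f(1) adm]) (simp_all add: forkn(1))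
      qed
      ultimately show ?thesis by (intro exI[of _ "CARD('n) - 1"]) simp
    qed
    then show ?thesis using sv_eq[OF E] by (auto simp: flag_simplex_def)
  qed
  then show thesis using that[OF f(1)] by blast
qed

end

section \<open>Charts of the apartments\<close>

text \<open>These sums are the coordinates of a point of an ordered simplex, as in \<open>simplex_coord\<close>, but indexed by all
thresholds \<open>j\<close> and not only by the types that occur in \<open>S\<close>.\<close>

definition upper_sum :: "('a \<Rightarrow> nat) \<Rightarrow> 'a set \<Rightarrow> nat \<Rightarrow> ('a \<Rightarrow> real) \<Rightarrow> real" where
  "upper_sum \<tau> S j x = (\<Sum>w | w \<in> S \<and> j < \<tau> w. x w)"

lemma simplex_coord_upper_sum:
  assumes "x \<in> closed_simplex S"
  shows "simplex_coord \<tau> S v x = (if \<tau> v = 0 then 1 else upper_sum \<tau> S (\<tau> v - 1) x)"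
proof (cases "\<tau> v = 0")
  case True
  then show ?thesis using assms by (simp add: simplex_coord_def closed_simplex_def)
next
  case False
  then have "{w \<in> S. \<tau> v \<le> \<tau> w} = {w \<in> S. \<tau> v - 1 < \<tau> w}" by auto
  then show ?thesis using False by (simp add: simplex_coord_def upper_sum_def)
qed

text \<open>A threshold \<open>j\<close> gives the same sum as the least type above \<open>j\<close> that occurs in \<open>S\<close>.\<close>

lemma simplex_dist_upper_sum:
  assumes x: "x \<in> closed_simplex S" and y: "y \<in> closed_simplex S"
    and fin: "finite S" and ne: "S \<noteq> {}" and le: "\<And>w. w \<in> S \<Longrightarrow> \<tau> w \<le> n" and n: "0 < n"
  shows "simplex_dist \<tau> S x y = Sup ((\<lambda>j. \<bar>upper_sum \<tau> S j x - upper_sum \<tau> S j y\<bar>) ` {..<n})"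
proof -
  define D where "D j = \<bar>upper_sum \<tau> S j x - upper_sum \<tau> S j y\<bar>" for j
  define E where "E v = \<bar>simplex_coord \<tau> S v x - simplex_coord \<tau> S v y\<bar>" for v
  have E: "E v = (if \<tau> v = 0 then 0 else D (\<tau> v - 1))" for v
    using simplex_coord_upper_sum[OF x, of \<tau> v] simplex_coord_upper_sum[OF y, of \<tau> v] by (simp add: E_def D_def)
  have finD: "finite (D ` {..<n})" and neD: "D ` {..<n} \<noteq> {}" and finE: "finite (E ` S)" and neE: "E ` S \<noteq> {}"
    using fin ne n by auto
  have "Max (E ` S) = Max (D ` {..<n})"
  proof (rule antisym)
    show "Max (E ` S) \<le> Max (D ` {..<n})"
    proof (rule Max.boundedI[OF finE neE])
      fix e assume "e \<in> E ` S"
      then obtain v where v: "v \<in> S" "e = E v" by blast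
      show "e \<le> Max (D ` {..<n})"
      proof (cases "\<tau> v = 0")
        case True
        have "0 \<le> D 0" by (simp add: D_def)
        also have "D 0 \<le> Max (D ` {..<n})" using n by (intro Max_ge[OF finD]) auto
        finally show ?thesis using True v E by simp
      next
        case False
        then have "\<tau> v - 1 < n" using le[OF v(1)] by simp
        then show ?thesis using False v E by (intro Max_ge[OF finD]) auto
      qed
    qed
    show "Max (D ` {..<n}) \<le> Max (E ` S)"
    proof (rule Max.boundedI[OF finD neD])
      fix e assume "e \<in> D ` {..<n}"
      then obtain j where j: "j < n" "e = D j" by blast
      define T where "T = {w \<in> S. j < \<tau> w}"
      show "e \<le> Max (E ` S)"
      proof (cases "T = {}")
        case True
        then have "upper_sum \<tau> S j z = 0" for z unfolding upper_sum_def T_def by (metis sum.empty)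
        then have "e = 0" using j by (simp add: D_def)
        obtain v where v: "v \<in> S" using ne by blast
        have "0 \<le> E v" by (simp add: E_def)
        also have "E v \<le> Max (E ` S)" using v by (intro Max_ge[OF finE]) auto
        finally show ?thesis using \<open>e = 0\<close> by simp
      next
        case False
        have "finite T" using fin by (simp add: T_def)
        then obtain v where v: "v \<in> T" "\<And>w. w \<in> T \<Longrightarrow> \<tau> v \<le> \<tau> w"
          using False ex_min_if_finite[of "\<tau> ` T"] by (metis (no_types, lifting) arg_min_if_finite(1) arg_min_least)
        then have vS: "v \<in> S" "j < \<tau> v" by (auto simp: T_def)
        have "{w \<in> S. \<tau> v - 1 < \<tau> w} = {w \<in> S. j < \<tau> w}"
          using v(2) vS(2) by (force simp: T_def)
        then have "D (\<tau> v - 1) = D j" by (simp add: D_def upper_sum_def)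
        then have "e = E v" using j vS E by simp
        then show ?thesis using vS by (intro Max_ge[OF finE]) auto
      qed
    qed
  qed
  then show ?thesis
    unfolding simplex_dist_def E_def[symmetric] D_def[symmetric] cSup_eq_Max[OF finD neD] by simp
qed

context typed_building begin

text \<open>On every simplex, the affine extension of the map that sends a vertex of the subdivision to its position.
Summing over the support of \<open>x\<close> makes the map independent of the simplex
containing \<open>x\<close>.\<close>

definition chart_map :: "('v \<Rightarrow> real^'n) \<Rightarrow> ('v set \<Rightarrow> real) \<Rightarrow> real^'n" where
  "chart_map \<phi> x = (\<Sum>E | x E \<noteq> 0. x E *\<^sub>R position (\<phi> ` E))"

definition cells :: "nat \<Rightarrow> 'v set set \<Rightarrow> ('v set \<Rightarrow> real) set set" where
  "cells N A = closed_simplex ` {S \<in> subd N. \<Union>S \<in> A}"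

definition charts :: "(('v set \<Rightarrow> real) set set \<times> (('v set \<Rightarrow> real) \<Rightarrow> real^'n)) set" where
  "charts = {(cells CARD('n) A, chart_map \<phi>) | A \<phi>. A \<in> \<A> \<and> typed_iso A \<phi>}"

lemma vertex_at_inj:
  assumes \<phi>: "typed_iso A \<phi>" and f: "frame b s r"
  shows "inj_on (\<lambda>k. vertex_at A \<phi> (fvert b s r k)) {..CARD('n)}"
  by (rule inj_onI) (metis atMost_iff vertex_at_types(2)[OF \<phi> f])

lemma finite_flag_simplex: "finite (flag_simplex A \<phi> b s r)" by (simp add: flag_simplex_def)

lemma flag_simplex_sum:
  assumes \<phi>: "typed_iso A \<phi>" and f: "frame b s r"
  shows "(\<Sum>E\<in>flag_simplex A \<phi> b s r. h E) = (\<Sum>k\<le>CARD('n). h (vertex_at A \<phi> (fvert b s r k)))"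
  unfolding flag_simplex_def by (simp add: sum.reindex[OF vertex_at_inj[OF assms]])

lemma position_vertex_at:
  assumes \<phi>: "typed_iso A \<phi>" and f: "frame b s r" and k: "k \<le> CARD('n)"
  shows "position (\<phi> ` vertex_at A \<phi> (fvert b s r k)) = fvert b s r k"
  unfolding vertex_at_image(1)[OF assms] by (rule position_carrier[OF f adm k])

lemma flag_simplex_coords:
  assumes \<phi>: "typed_iso A \<phi>" and f: "frame b s r" and S: "S \<subseteq> flag_simplex A \<phi> b s r"
    and x: "x \<in> closed_simplex S"
  shows "(\<Sum>k\<le>CARD('n). x (vertex_at A \<phi> (fvert b s r k))) = 1"
    and "chart_map \<phi> x = (\<Sum>k\<le>CARD('n). x (vertex_at A \<phi> (fvert b s r k)) *\<^sub>R fvert b s r k)"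
    and "E \<notin> flag_simplex A \<phi> b s r \<Longrightarrow> x E = 0" and "0 \<le> x E"
proof -
  have x': "x \<in> closed_simplex (flag_simplex A \<phi> b s r)" using closed_simplex_mono[OF S finite_flag_simplex] x by blast
  then show 0: "E \<notin> flag_simplex A \<phi> b s r \<Longrightarrow> x E = 0" and "0 \<le> x E" for E by (auto simp: closed_simplex_def)
  show "(\<Sum>k\<le>CARD('n). x (vertex_at A \<phi> (fvert b s r k))) = 1"
    using x' by (simp add: closed_simplex_def flag_simplex_sum[OF \<phi> f])
  have "chart_map \<phi> x = (\<Sum>E\<in>flag_simplex A \<phi> b s r. x E *\<^sub>R position (\<phi> ` E))"
    unfolding chart_map_def using 0 finite_flag_simplex by (intro sum.mono_neutral_left) auto
  then show "chart_map \<phi> x = (\<Sum>k\<le>CARD('n). x (vertex_at A \<phi> (fvert b s r k)) *\<^sub>R fvert b s r k)"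
    unfolding flag_simplex_sum[OF \<phi> f] using position_vertex_at[OF \<phi> f] by simp
qed

lemma chart_map_coord:
  assumes \<phi>: "typed_iso A \<phi>" and f: "frame b s r" and S: "S \<subseteq> flag_simplex A \<phi> b s r"
    and x: "x \<in> closed_simplex S"
  shows "chart_map \<phi> x $ i = b $ i + s $ i * upper_sum (stype CARD('n)) S (r i) x"
proof -
  have "(\<Sum>k\<le>CARD('n). if r i < k then x (vertex_at A \<phi> (fvert b s r k)) else 0)
      = (\<Sum>E\<in>flag_simplex A \<phi> b s r. if r i < stype CARD('n) E then x E else 0)"
    unfolding flag_simplex_sum[OF \<phi> f] by (intro sum.cong) (auto simp: vertex_at_types(2)[OF \<phi> f])
  also have "\<dots> = (\<Sum>E\<in>S. if r i < stype CARD('n) E then x E else 0)"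
    using S x finite_flag_simplex by (intro sum.mono_neutral_right) (auto simp: closed_simplex_def)
  also have "\<dots> = upper_sum (stype CARD('n)) S (r i) x"
    unfolding upper_sum_def using finite_subset[OF S finite_flag_simplex]
    by (simp add: sum.inter_filter[symmetric])
  finally show ?thesis
    unfolding flag_simplex_coords(2)[OF assms] fvert_combination[OF f flag_simplex_coords(1)[OF assms]] by simp
qed

text \<open>Up to translation and signs, the coordinates of a point are its upper sums in the order of the ranks. So
distances inside a simplex only depend on the types of its vertices and not on the chart.\<close>

lemma chart_map_norms:
  assumes \<phi>: "typed_iso A \<phi>" and f: "frame b s r" and S: "S \<subseteq> flag_simplex A \<phi> b s r"
    and x: "x \<in> closed_simplex S" and y: "y \<in> closed_simplex S"
  shows "norm (chart_map \<phi> x - chart_map \<phi> y) =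
      sqrt (\<Sum>j<CARD('n). (upper_sum (stype CARD('n)) S j x - upper_sum (stype CARD('n)) S j y)\<^sup>2)"
    and "infnorm (chart_map \<phi> x - chart_map \<phi> y) =
      Sup ((\<lambda>j. \<bar>upper_sum (stype CARD('n)) S j x - upper_sum (stype CARD('n)) S j y\<bar>) ` {..<CARD('n)})"
proof -
  define D where "D j = upper_sum (stype CARD('n)) S j x - upper_sum (stype CARD('n)) S j y" for j
  have c: "(chart_map \<phi> x - chart_map \<phi> y) $ i = s $ i * D (r i)" for i
    unfolding vector_minus_component chart_map_coord[OF \<phi> f S x] chart_map_coord[OF \<phi> f S y] D_def
    by (simp add: algebra_simps)
  have abs: "\<bar>s $ i * D (r i)\<bar> = \<bar>D (r i)\<bar>" for i using frame_sgn[OF f, of i] by auto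
  have "norm (chart_map \<phi> x - chart_map \<phi> y) = sqrt (\<Sum>i\<in>UNIV. (D (r i))\<^sup>2)"
    unfolding norm_vec_def L2_set_def c real_norm_def abs by simp
  also have "(\<Sum>i\<in>UNIV. (D (r i))\<^sup>2) = (\<Sum>j<CARD('n). (D j)\<^sup>2)"
    by (rule sum.reindex_bij_betw[OF frame_bij[OF f]])
  finally show "norm (chart_map \<phi> x - chart_map \<phi> y) =
      sqrt (\<Sum>j<CARD('n). (upper_sum (stype CARD('n)) S j x - upper_sum (stype CARD('n)) S j y)\<^sup>2)"
    unfolding D_def .
  have "{\<bar>D (r i)\<bar> |i. True} = (\<lambda>j. \<bar>D j\<bar>) ` r ` UNIV" by blast
  then have "infnorm (chart_map \<phi> x - chart_map \<phi> y) = Sup ((\<lambda>j. \<bar>D j\<bar>) ` r ` UNIV)"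
    unfolding infnorm_cart c abs by simp
  also have "r ` UNIV = {..<CARD('n)}" using bij_betw_imp_surj_on[OF frame_bij[OF f]] .
  finally show "infnorm (chart_map \<phi> x - chart_map \<phi> y) =
      Sup ((\<lambda>j. \<bar>upper_sum (stype CARD('n)) S j x - upper_sum (stype CARD('n)) S j y\<bar>) ` {..<CARD('n)})"
    unfolding D_def .
qed

lemma simplex_dist_chart:
  assumes A: "A \<in> \<A>" and \<phi>: "typed_iso A \<phi>" and S: "S \<in> subd CARD('n)" "\<Union>S \<in> A"
    and x: "x \<in> closed_simplex S" and y: "y \<in> closed_simplex S"
  shows "simplex_dist (stype CARD('n)) S x y = infnorm (chart_map \<phi> x - chart_map \<phi> y)"
proof -
  obtain b s r where f: "frame b s r" "S \<subseteq> flag_simplex A \<phi> b s r" using cell_frame[OF A \<phi> S] .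
  have "stype CARD('n) w \<le> CARD('n)" if "w \<in> S" for w
    using that f(2) vertex_at_types(2)[OF \<phi> f(1)] by (auto simp: flag_simplex_def)
  moreover have "S \<noteq> {}" using S(1) by (simp add: subdivision_def)
  ultimately show ?thesis
    unfolding chart_map_norms(2)[OF \<phi> f x y] using finite_subset[OF f(2) finite_flag_simplex]
    by (intro simplex_dist_upper_sum x y) auto
qed

lemma point_in_flag_simplex:
  assumes A: "A \<in> \<A>" and \<phi>: "typed_iso A \<phi>"
  obtains b s r x where "frame b s r" "x \<in> closed_simplex (flag_simplex A \<phi> b s r)" "chart_map \<phi> x = p"
    "\<And>k i. \<bar>fvert b s r k $ i - p $ i\<bar> \<le> 1"
proof -
  obtain b s r where f: "frame b s r" and y: "\<And>i. 0 \<le> fcoord b s ((1/2) *\<^sub>R p) i"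
    "\<And>i. fcoord b s ((1/2) *\<^sub>R p) i \<le> 1"
    "\<And>i j. r i < r j \<Longrightarrow> fcoord b s ((1/2) *\<^sub>R p) j \<le> fcoord b s ((1/2) *\<^sub>R p) i"
    using point_frame[of "(1/2) *\<^sub>R p"] by blast
  define u where "u = bary r (fcoord b s ((1/2) *\<^sub>R p))"
  define x where "x E = (if E \<in> flag_simplex A \<phi> b s r then u (stype CARD('n) E) else 0)" for E
  have xk: "x (vertex_at A \<phi> (fvert b s r k)) = u k" if "k \<le> CARD('n)" for k
    using that vertex_at_types(2)[OF \<phi> f that] by (auto simp: x_def flag_simplex_def)
  have "0 \<le> u k" if "k \<le> CARD('n)" for k unfolding u_def by (rule bary_nonneg[OF f y that])
  moreover have "stype CARD('n) E \<le> CARD('n)" if "E \<in> flag_simplex A \<phi> b s r" for E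
    using that vertex_at_types(2)[OF \<phi> f] by (auto simp: flag_simplex_def)
  ultimately have nn: "0 \<le> x E" for E by (simp add: x_def)
  have "(\<Sum>E\<in>flag_simplex A \<phi> b s r. x E) = 1"
    unfolding flag_simplex_sum[OF \<phi> f] using xk bary_sum[of r] by (simp add: u_def)
  then have xin: "x \<in> closed_simplex (flag_simplex A \<phi> b s r)" using nn by (simp add: closed_simplex_def x_def)
  have "chart_map \<phi> x = (\<Sum>k\<le>CARD('n). u k *\<^sub>R fvert b s r k)"
    unfolding flag_simplex_coords(2)[OF \<phi> f order_refl xin] using xk by simp
  also have "\<dots> = p" unfolding u_def bary_combination[OF f] by simp
  finally have px: "chart_map \<phi> x = p" .
  have "\<bar>fvert b s r k $ i - p $ i\<bar> \<le> 1" for k i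
  proof -
    have "p $ i - b $ i = s $ i * fcoord b s ((1/2) *\<^sub>R p) i"
      using frame_sgn[OF f, of i] by (auto simp: fcoord_def)
    then show ?thesis using y(1,2)[of i] frame_sgn[OF f, of i] by (auto simp: fvert_def)
  qed
  then show thesis using that[OF f xin px] by blast
qed

lemma cell_cases:
  assumes "C \<in> cells CARD('n) A" "A \<in> \<A>"
  obtains S where "S \<in> subd CARD('n)" "\<Union>S \<in> A" "C = closed_simplex S" "finite S" "S \<noteq> {}"
proof -
  obtain S where S: "S \<in> subd CARD('n)" "\<Union>S \<in> A" "C = closed_simplex S" using assms(1) by (auto simp: cells_def)
  obtain \<phi> where \<phi>: "typed_iso A \<phi>" using apartment[OF assms(2)] by (auto simp: typed_iso_def)
  obtain b s r where "frame b s r" "S \<subseteq> flag_simplex A \<phi> b s r" using cell_frame[OF assms(2) \<phi> S(1,2)] .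
  then have "finite S" by (intro finite_subset[OF _ finite_flag_simplex])
  moreover have "S \<noteq> {}" using S(1) by (simp add: subdivision_def)
  ultimately show thesis by (intro that[OF S])
qed

lemma cells_common:
  assumes "C \<in> cells CARD('n) A" "C \<in> cells CARD('n) B" "A \<in> \<A>" "B \<in> \<A>"
  obtains S where "S \<in> subd CARD('n)" "\<Union>S \<in> A" "\<Union>S \<in> B" "C = closed_simplex S" "finite S" "S \<noteq> {}"
proof -
  obtain S where S: "S \<in> subd CARD('n)" "\<Union>S \<in> A" "C = closed_simplex S" "finite S" "S \<noteq> {}"
    using cell_cases[OF assms(1,3)] .
  obtain T where T: "T \<in> subd CARD('n)" "\<Union>T \<in> B" "C = closed_simplex T" "finite T" "T \<noteq> {}"
    using cell_cases[OF assms(2,4)] .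
  have "S = T" using closed_simplex_inj[OF S(4) T(4)] S(3) T(3) by simp
  then show thesis using that S T by blast
qed

text \<open>Both points are given by barycentric coordinates on flags, so \<open>barycentric_unique\<close> applies to the coefficients
regarded as functions on the integer points.\<close>

lemma chart_map_inj:
  assumes A: "A \<in> \<A>" and \<phi>: "typed_iso A \<phi>"
    and x: "x \<in> \<Union>(cells CARD('n) A)" and y: "y \<in> \<Union>(cells CARD('n) A)" and eq: "chart_map \<phi> x = chart_map \<phi> y"
  shows "x = y"
proof -
  obtain S where S: "S \<in> subd CARD('n)" "\<Union>S \<in> A" "x \<in> closed_simplex S" using x by (auto simp: cells_def)
  obtain T where T: "T \<in> subd CARD('n)" "\<Union>T \<in> A" "y \<in> closed_simplex T" using y by (auto simp: cells_def)
  obtain b s r where f: "frame b s r" "S \<subseteq> flag_simplex A \<phi> b s r" using cell_frame[OF A \<phi> S(1,2)] .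
  obtain b' s' r' where f': "frame b' s' r'" "T \<subseteq> flag_simplex A \<phi> b' s' r'" using cell_frame[OF A \<phi> T(1,2)] .
  define W W' where "W = fvert b s r ` {..CARD('n)}" and "W' = fvert b' s' r' ` {..CARD('n)}"
  have pos: "position (\<phi> ` vertex_at A \<phi> v) = v" if "v \<in> W \<union> W'" for v
    using that position_vertex_at[OF \<phi> f(1)] position_vertex_at[OF \<phi> f'(1)] by (auto simp: W_def W'_def)
  have flag_simplex: "flag_simplex A \<phi> b s r = vertex_at A \<phi> ` W" "flag_simplex A \<phi> b' s' r' = vertex_at A \<phi> ` W'"
    by (auto simp: flag_simplex_def W_def W'_def)
  \<comment> \<open>Coefficients as functions on integer points; outside both flags they are set to \<open>0\<close>.\<close>
  define c where "c x v = (if v \<in> W \<union> W' then x (vertex_at A \<phi> v) else 0)" for x :: "'v set \<Rightarrow> real" and v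
  have out: "x (vertex_at A \<phi> v) = 0" if "v \<in> W \<union> W'" "v \<notin> W" for v
  proof (rule flag_simplex_coords(3)[OF \<phi> f S(3)], unfold flag_simplex, rule notI)
    assume "vertex_at A \<phi> v \<in> vertex_at A \<phi> ` W"
    then obtain w where w: "w \<in> W" "vertex_at A \<phi> v = vertex_at A \<phi> w" by blast
    have "position (\<phi> ` vertex_at A \<phi> w) = w" by (rule pos) (use w(1) in blast)
    then have "v = w" using pos[OF that(1)] unfolding w(2) by simp
    then show False using w(1) that(2) by blast
  qed
  have out': "y (vertex_at A \<phi> v) = 0" if "v \<in> W \<union> W'" "v \<notin> W'" for v
  proof (rule flag_simplex_coords(3)[OF \<phi> f' T(3)], unfold flag_simplex, rule notI)
    assume "vertex_at A \<phi> v \<in> vertex_at A \<phi> ` W'"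
    then obtain w where w: "w \<in> W'" "vertex_at A \<phi> v = vertex_at A \<phi> w" by blast
    have "position (\<phi> ` vertex_at A \<phi> w) = w" by (rule pos) (use w(1) in blast)
    then have "v = w" using pos[OF that(1)] unfolding w(2) by simp
    then show False using w(1) that(2) by blast
  qed
  have cx: "c x (fvert b s r k) = x (vertex_at A \<phi> (fvert b s r k))" if "k \<in> {..CARD('n)}" for k
    using that by (auto simp: c_def W_def)
  have cy: "c y (fvert b' s' r' k) = y (vertex_at A \<phi> (fvert b' s' r' k))" if "k \<in> {..CARD('n)}" for k
    using that by (auto simp: c_def W'_def)
  have c_eq: "c x = c y"
  proof (rule barycentric_unique[OF f(1) _ _ _ f'(1)])
    show "0 \<le> c x v" for v using flag_simplex_coords(4)[OF \<phi> f S(3)] by (simp add: c_def)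
    show "0 \<le> c y v" for v using flag_simplex_coords(4)[OF \<phi> f' T(3)] by (simp add: c_def)
    show "c x v = 0" if "v \<notin> fvert b s r ` {..CARD('n)}" for v
      using out[of v] that by (auto simp: c_def W_def)
    show "c y v = 0" if "v \<notin> fvert b' s' r' ` {..CARD('n)}" for v
      using out'[of v] that by (auto simp: c_def W'_def)
    show "(\<Sum>k\<le>CARD('n). c x (fvert b s r k)) = 1"
      by (rule trans[OF sum.cong[OF HOL.refl cx] flag_simplex_coords(1)[OF \<phi> f S(3)]])
    show "(\<Sum>k\<le>CARD('n). c y (fvert b' s' r' k)) = 1"
      by (rule trans[OF sum.cong[OF HOL.refl cy] flag_simplex_coords(1)[OF \<phi> f' T(3)]])
    have "(\<Sum>k\<le>CARD('n). c x (fvert b s r k) *\<^sub>R fvert b s r k) = chart_map \<phi> x"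
      unfolding flag_simplex_coords(2)[OF \<phi> f S(3)] by (intro sum.cong) (simp_all add: cx)
    moreover have "(\<Sum>k\<le>CARD('n). c y (fvert b' s' r' k) *\<^sub>R fvert b' s' r' k) = chart_map \<phi> y"
      unfolding flag_simplex_coords(2)[OF \<phi> f' T(3)] by (intro sum.cong) (simp_all add: cy)
    ultimately show "(\<Sum>k\<le>CARD('n). c x (fvert b s r k) *\<^sub>R fvert b s r k)
      = (\<Sum>k\<le>CARD('n). c y (fvert b' s' r' k) *\<^sub>R fvert b' s' r' k)"
      using eq by simp
  qed
  show ?thesis
  proof
    fix E show "x E = y E"
    proof (cases "E \<in> flag_simplex A \<phi> b s r \<union> flag_simplex A \<phi> b' s' r'")
      case True
      then obtain v where v: "v \<in> W \<union> W'" "E = vertex_at A \<phi> v" unfolding flag_simplex by blast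
      then show ?thesis using fun_cong[OF c_eq, of v] by (simp add: c_def)
    next
      case False
      then show ?thesis using flag_simplex_coords(3)[OF \<phi> f S(3)] flag_simplex_coords(3)[OF \<phi> f' T(3)] by simp
    qed
  qed
qed

end

lemma polygonal_path_trans:
  "polygonal_path K \<tau> x y k \<Longrightarrow> polygonal_path K \<tau> y z l \<Longrightarrow> polygonal_path K \<tau> x z (k + l)"
  by (induction rule: polygonal_path.induct) (auto simp: add.assoc intro: polygonal_path.step)

context typed_building begin

lemma chart_bij:
  assumes A: "A \<in> \<A>" and \<phi>: "typed_iso A \<phi>"
  shows "bij_betw (chart_map \<phi>) (\<Union>(cells CARD('n) A)) UNIV"
  unfolding bij_betw_def
proof
  show "inj_on (chart_map \<phi>) (\<Union>(cells CARD('n) A))" by (rule inj_onI) (rule chart_map_inj[OF A \<phi>])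
  have "p \<in> chart_map \<phi> ` \<Union>(cells CARD('n) A)" for p
  proof -
    obtain b s r x where *: "frame b s r" "x \<in> closed_simplex (flag_simplex A \<phi> b s r)" "chart_map \<phi> x = p"
      using point_in_flag_simplex[OF A \<phi>] by metis
    then have "x \<in> \<Union>(cells CARD('n) A)" using flag_simplex_in_subdivision[OF A \<phi> *(1)] by (auto simp: cells_def)
    then show ?thesis using *(3) by blast
  qed
  then show "chart_map \<phi> ` \<Union>(cells CARD('n) A) = UNIV" by blast
qed

lemma cell_image_closed:
  assumes A: "A \<in> \<A>" and \<phi>: "typed_iso A \<phi>" and C: "C \<in> cells CARD('n) A"
  shows "closed (chart_map \<phi> ` C)"
proof -
  obtain S where S: "S \<in> subd CARD('n)" "\<Union>S \<in> A" "C = closed_simplex S" "finite S" "S \<noteq> {}"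
    using cell_cases[OF C A] .
  obtain b s r where f: "frame b s r" "S \<subseteq> flag_simplex A \<phi> b s r" using cell_frame[OF A \<phi> S(1,2)] .
  define P where "P E = position (\<phi> ` E)" for E
  have inj: "inj_on P S"
  proof (rule inj_onI)
    fix E F assume EF: "E \<in> S" "F \<in> S" and eq: "P E = P F"
    obtain j where j: "j \<le> CARD('n)" "E = vertex_at A \<phi> (fvert b s r j)"
      using f(2) EF(1) by (auto simp: flag_simplex_def)
    obtain k where k: "k \<le> CARD('n)" "F = vertex_at A \<phi> (fvert b s r k)"
      using f(2) EF(2) by (auto simp: flag_simplex_def)
    have "fvert b s r j = fvert b s r k"
      using eq unfolding P_def j(2) k(2) position_vertex_at[OF \<phi> f(1) j(1)] position_vertex_at[OF \<phi> f(1) k(1)] .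
    then show "E = F" unfolding j(2) k(2) by simp
  qed
  have cm: "chart_map \<phi> x = (\<Sum>E\<in>S. x E *\<^sub>R P E)" if "x \<in> closed_simplex S" for x
    unfolding chart_map_def P_def using that S(4)
    by (intro sum.mono_neutral_left) (auto simp: closed_simplex_def)
  have "chart_map \<phi> ` closed_simplex S = convex hull (P ` S)"
  proof (intro equalityI subsetI)
    fix p assume "p \<in> chart_map \<phi> ` closed_simplex S"
    then obtain x where x: "x \<in> closed_simplex S" "p = (\<Sum>E\<in>S. x E *\<^sub>R P E)" using cm by auto
    show "p \<in> convex hull (P ` S)"
      unfolding x(2) using x(1) S(4)
      by (intro convex_sum convex_convex_hull) (auto simp: closed_simplex_def intro: hull_inc)
  next
    fix p assume "p \<in> convex hull (P ` S)"
    then obtain u where u: "\<forall>v\<in>P ` S. 0 \<le> u v" "sum u (P ` S) = 1" "(\<Sum>v\<in>P ` S. u v *\<^sub>R v) = p"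
      using convex_hull_finite[of "P ` S"] S(4) by auto
    define x where "x E = (if E \<in> S then u (P E) else 0)" for E
    have "x \<in> closed_simplex S"
      using u(1,2) by (auto simp: closed_simplex_def x_def sum.reindex[OF inj])
    moreover have "chart_map \<phi> x = p"
      unfolding cm[OF \<open>x \<in> closed_simplex S\<close>] u(3)[symmetric] by (simp add: sum.reindex[OF inj] x_def)
    ultimately show "p \<in> chart_map \<phi> ` closed_simplex S" by blast
  qed
  then show ?thesis
    using S(3,4) by (simp add: compact_imp_closed finite_imp_compact_convex_hull)
qed

lemma finite_lattice_box: "finite {v :: real^'n. \<forall>i. v $ i \<in> \<int> \<and> \<bar>v $ i\<bar> \<le> B}"
proof -
  have "{v :: real^'n. \<forall>i. v $ i \<in> \<int> \<and> \<bar>v $ i\<bar> \<le> B}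
      \<subseteq> (\<lambda>g. \<chi> i. of_int (g i)) ` (UNIV \<rightarrow>\<^sub>E {- \<lceil>B\<rceil>..\<lceil>B\<rceil>})"
  proof
    fix v :: "real^'n" assume v: "v \<in> {v. \<forall>i. v $ i \<in> \<int> \<and> \<bar>v $ i\<bar> \<le> B}"
    have "\<lfloor>v $ i\<rfloor> \<in> {- \<lceil>B\<rceil>..\<lceil>B\<rceil>}" for i
    proof -
      have "\<bar>v $ i\<bar> \<le> B" using v by simp
      then show ?thesis by simp linarith
    qed
    moreover have "v = (\<chi> i. of_int \<lfloor>v $ i\<rfloor>)" using v by (simp add: vec_eq_iff)
    ultimately show "v \<in> (\<lambda>g. \<chi> i. of_int (g i)) ` (UNIV \<rightarrow>\<^sub>E {- \<lceil>B\<rceil>..\<lceil>B\<rceil>})"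
      by (intro image_eqI[of _ _ "\<lambda>i. \<lfloor>v $ i\<rfloor>"]) auto
  qed
  then show ?thesis by (rule finite_subset) (intro finite_imageI finite_PiE, auto)
qed

text \<open>Every point lies in the simplex of a flag nearby, and only finitely many flags are near a bounded set.\<close>

lemma chart_locally_finite:
  assumes A: "A \<in> \<A>" and \<phi>: "typed_iso A \<phi>" and R: "bounded R"
  shows "\<exists>F \<subseteq> cells CARD('n) A. finite F \<and> R \<subseteq> (\<Union>S\<in>F. chart_map \<phi> ` S)"
proof -
  obtain B where B: "\<And>p. p \<in> R \<Longrightarrow> norm p \<le> B" using R by (auto simp: bounded_iff)
  \<comment> \<open>A flag whose simplex contains \<open>p\<close> stays within distance \<open>1\<close> of \<open>p\<close>.\<close>
  define L where "L = {v :: real^'n. \<forall>i. v $ i \<in> \<int> \<and> \<bar>v $ i\<bar> \<le> B + 1}"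
  define F where "F = {closed_simplex (vertex_at A \<phi> ` W) | W. W \<subseteq> L} \<inter> cells CARD('n) A"
  have "finite {closed_simplex (vertex_at A \<phi> ` W) | W. W \<subseteq> L}"
  proof -
    have "{closed_simplex (vertex_at A \<phi> ` W) | W. W \<subseteq> L} = (\<lambda>W. closed_simplex (vertex_at A \<phi> ` W)) ` Pow L" by auto
    then show ?thesis using finite_lattice_box[of "B + 1"] by (simp add: L_def)
  qed
  then have "finite F" by (simp add: F_def)
  moreover have "p \<in> (\<Union>S\<in>F. chart_map \<phi> ` S)" if p: "p \<in> R" for p
  proof -
    obtain b s r x where f: "frame b s r" and x: "x \<in> closed_simplex (flag_simplex A \<phi> b s r)" "chart_map \<phi> x = p"
      and near: "\<And>k i. \<bar>fvert b s r k $ i - p $ i\<bar> \<le> 1"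
      using point_in_flag_simplex[OF A \<phi>] by metis
    have "fvert b s r ` {..CARD('n)} \<subseteq> L"
    proof -
      have "\<bar>fvert b s r k $ i\<bar> \<le> B + 1" for k i
        using near[of k i] component_le_norm_cart[of p i] B[OF p] by linarith
      then show ?thesis using fvert_Ints[OF f] by (auto simp: L_def)
    qed
    moreover have "flag_simplex A \<phi> b s r = vertex_at A \<phi> ` fvert b s r ` {..CARD('n)}" by (auto simp: flag_simplex_def)
    ultimately have "closed_simplex (flag_simplex A \<phi> b s r) \<in> F"
      using flag_simplex_in_subdivision[OF A \<phi> f] by (auto simp: F_def cells_def)
    then show ?thesis using x by blast
  qed
  ultimately show ?thesis by (intro exI[of _ F]) (auto simp: F_def)
qed

text \<open>Distances to two consecutive points of the flag determine one coordinate.\<close>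

lemma frame_spans:
  fixes u v :: "real^'n"
  assumes f: "frame b s r" and eq: "\<And>k. k \<le> CARD('n) \<Longrightarrow> norm (u - fvert b s r k) = norm (v - fvert b s r k)"
  shows "u = v"
proof (rule vec_eq_iff[THEN iffD2], rule allI)
  fix i
  define k where "k = r i"
  have k: "k < CARD('n)" using frame_rank_less[OF f] by (simp add: k_def)
  have step: "fvert b s r (Suc k) = fvert b s r k + axis i (s $ i)"
    using frame_rank_inj[OF f, of _ i] by (auto simp: vec_eq_iff fvert_def axis_def k_def less_Suc_eq)
  have sq: "(u - fvert b s r j) \<bullet> (u - fvert b s r j) = (v - fvert b s r j) \<bullet> (v - fvert b s r j)"
    if "j \<le> CARD('n)" for j
    using eq[OF that] by (simp add: norm_eq)
  have ax: "w \<bullet> axis i c = w $ i * c" for w :: "real^'n" and c by (simp add: inner_axis)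
  have "(u - fvert b s r k) \<bullet> axis i (s $ i) = (v - fvert b s r k) \<bullet> axis i (s $ i)"
    using sq[of k] sq[of "Suc k"] k unfolding step
    by (simp add: inner_diff inner_add inner_commute algebra_simps)
  then show "u $ i = v $ i" using frame_sgn[OF f, of i] by (auto simp: ax)
qed

lemma chart_chamber:
  assumes A: "A \<in> \<A>" and \<phi>: "typed_iso A \<phi>" and x: "x \<in> \<Union>(cells CARD('n) A)"
  shows "\<exists>C\<in>cells CARD('n) A. x \<in> C \<and>
    (\<forall>u v. (\<forall>c\<in>C. norm (u - chart_map \<phi> c) = norm (v - chart_map \<phi> c)) \<longrightarrow> u = v)"
proof -
  obtain S where S: "S \<in> subd CARD('n)" "\<Union>S \<in> A" "x \<in> closed_simplex S" using x by (auto simp: cells_def)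
  obtain b s r where f: "frame b s r" "S \<subseteq> flag_simplex A \<phi> b s r" using cell_frame[OF A \<phi> S(1,2)] .
  have vert: "\<exists>c\<in>closed_simplex (flag_simplex A \<phi> b s r). chart_map \<phi> c = fvert b s r k" if k: "k \<le> CARD('n)" for k
  proof
    let ?c = "\<lambda>E. if E = vertex_at A \<phi> (fvert b s r k) then 1 else 0 :: real"
    have "vertex_at A \<phi> (fvert b s r k) \<in> flag_simplex A \<phi> b s r" using k by (auto simp: flag_simplex_def)
    then show "?c \<in> closed_simplex (flag_simplex A \<phi> b s r)" by (rule vertex_in_closed_simplex[OF finite_flag_simplex])
    have "{E. ?c E \<noteq> 0} = {vertex_at A \<phi> (fvert b s r k)}" by auto
    then show "chart_map \<phi> ?c = fvert b s r k" using position_vertex_at[OF \<phi> f(1) k] by (simp add: chart_map_def)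
  qed
  have "u = v" if "\<forall>c\<in>closed_simplex (flag_simplex A \<phi> b s r). norm (u - chart_map \<phi> c) = norm (v - chart_map \<phi> c)" for u v
    by (rule frame_spans[OF f(1)]) (use vert that in metis)
  moreover have "x \<in> closed_simplex (flag_simplex A \<phi> b s r)" using closed_simplex_mono[OF f(2) finite_flag_simplex] S(3) by blast
  moreover have "closed_simplex (flag_simplex A \<phi> b s r) \<in> cells CARD('n) A"
    using flag_simplex_in_subdivision[OF A \<phi> f(1)] by (auto simp: cells_def)
  ultimately show ?thesis by blast
qed

text \<open>The support of the point is a simplex in both apartments.\<close>

lemma chart_common_cell:
  assumes A: "A \<in> \<A>" and B: "B \<in> \<A>" and x: "x \<in> \<Union>(cells CARD('n) A)" "x \<in> \<Union>(cells CARD('n) B)"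
  shows "\<exists>C \<in> cells CARD('n) A \<inter> cells CARD('n) B. x \<in> C"
proof -
  obtain CA CB where C: "CA \<in> cells CARD('n) A" "x \<in> CA" "CB \<in> cells CARD('n) B" "x \<in> CB" using x by blast
  obtain S where S: "S \<in> subd CARD('n)" "\<Union>S \<in> A" "CA = closed_simplex S" "finite S" "S \<noteq> {}"
    using cell_cases[OF C(1) A] .
  obtain T where T: "T \<in> subd CARD('n)" "\<Union>T \<in> B" "CB = closed_simplex T" "finite T" "T \<noteq> {}"
    using cell_cases[OF C(3) B] .
  define P where "P = {E. x E \<noteq> 0}"
  have xS: "x \<in> closed_simplex S" and xT: "x \<in> closed_simplex T" using C S T by auto
  have PS: "P \<subseteq> S" and PT: "P \<subseteq> T" using xS xT by (auto simp: P_def closed_simplex_def)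
  have "(\<Sum>E\<in>S. x E) = (\<Sum>E\<in>P. x E)"
    using S(4) PS by (intro sum.mono_neutral_right) (auto simp: P_def)
  then have sumP: "(\<Sum>E\<in>P. x E) = 1" using xS by (simp add: closed_simplex_def)
  then have Pne: "P \<noteq> {}" by auto
  have xP: "x \<in> closed_simplex P" using sumP xS by (auto simp: closed_simplex_def P_def)
  have "closed_simplex P \<in> cells CARD('n) A \<inter> cells CARD('n) B"
    using subdivision_subset[OF A S(1,2) PS Pne] subdivision_subset[OF B T(1,2) PT Pne] by (auto simp: cells_def)
  then show ?thesis using xP by blast
qed

text \<open>Compose the chart of \<open>A\<close> with the inverse of a type-preserving isomorphism from \<open>A\<close> to \<open>B\<close> that fixes both cells.\<close>

lemma chart_agree:
  assumes A: "A \<in> \<A>" and \<phi>: "typed_iso A \<phi>" and B: "B \<in> \<A>"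
    and C: "C \<in> cells CARD('n) A \<inter> cells CARD('n) B" and D: "D \<in> cells CARD('n) A \<inter> cells CARD('n) B"
  obtains \<phi>' where "typed_iso B \<phi>'" "\<And>x. x \<in> C \<union> D \<Longrightarrow> chart_map \<phi>' x = chart_map \<phi> x"
proof -
  obtain S where S: "S \<in> subd CARD('n)" "\<Union>S \<in> A" "\<Union>S \<in> B" "C = closed_simplex S" "finite S" "S \<noteq> {}"
    using cells_common[of C A B] C A B by blast
  obtain T where T: "T \<in> subd CARD('n)" "\<Union>T \<in> A" "\<Union>T \<in> B" "D = closed_simplex T" "finite T" "T \<noteq> {}"
    using cells_common[of D A B] D A B by blast
  obtain \<psi> where \<psi>: "simplicial_iso \<psi> A B" "\<And>v. v \<in> \<Union>S \<union> \<Union>T \<Longrightarrow> \<psi> v = v"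
    "\<And>v. v \<in> \<Union>A \<Longrightarrow> \<tau> (\<psi> v) = \<tau> v"
    using typed_exchange[OF A B, of "\<Union>S" "\<Union>T"] S(2,3) T(2,3) by auto
  define g where "g = inv_into (\<Union>A) \<psi>"
  have bij: "bij_betw \<psi> (\<Union>A) (\<Union>B)" using \<psi>(1) by (simp add: simplicial_iso_def)
  have g: "simplicial_iso g B A" unfolding g_def by (rule simplicial_iso_inv[OF \<psi>(1)])
  have g\<psi>: "\<psi> (g v) = v" if "v \<in> \<Union>B" for v
    unfolding g_def using bij that by (simp add: bij_betw_inv_into_right)
  have gfix: "g v = v" if "v \<in> \<Union>S \<union> \<Union>T" for v
  proof -
    have "v \<in> \<Union>A" using that S(2) T(2) by blast
    then have "g (\<psi> v) = v" unfolding g_def using bij by (simp add: bij_betw_inv_into_left)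
    then show ?thesis using \<psi>(2)[OF that] by simp
  qed
  have types: "\<tau> v = coxeter_type ty (\<phi> (g v))" if "v \<in> \<Union>B" for v
  proof -
    have gv: "g v \<in> \<Union>A" by (rule simplicial_iso_vertex[OF g that])
    have "\<tau> v = \<tau> (g v)" using \<psi>(3)[OF gv] unfolding g\<psi>[OF that] .
    then show ?thesis using typed_iso_type[OF \<phi> gv] by simp
  qed
  have "typed_iso B (\<phi> \<circ> g)"
    unfolding typed_iso_def using simplicial_iso_comp[OF g] \<phi> types by (auto simp: typed_iso_def)
  moreover have "chart_map (\<phi> \<circ> g) x = chart_map \<phi> x" if "x \<in> C \<union> D" for x
  proof -
    have "(\<phi> \<circ> g) ` E = \<phi> ` E" if E: "E \<in> S \<union> T" for E
    proof -
      have "g ` E = E" using gfix E by (force simp: image_iff)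
      moreover have "(\<phi> \<circ> g) ` E = \<phi> ` g ` E" by (simp add: image_image)
      ultimately show ?thesis by simp
    qed
    moreover have "E \<in> S \<union> T" if "x E \<noteq> 0" for E
      using that \<open>x \<in> C \<union> D\<close> S(4) T(4) by (auto simp: closed_simplex_def)
    ultimately show ?thesis unfolding chart_map_def by (intro sum.cong) auto
  qed
  ultimately show thesis by (rule that)
qed

lemma chart_isometry:
  assumes A: "A \<in> \<A>" and \<phi>: "typed_iso A \<phi>" and B: "B \<in> \<A>" and \<phi>': "typed_iso B \<phi>'"
    and C: "C \<in> cells CARD('n) A \<inter> cells CARD('n) B" and x: "x \<in> C" and y: "y \<in> C" and N: "N \<in> both_norms"
  shows "N (chart_map \<phi> x - chart_map \<phi> y) = N (chart_map \<phi>' x - chart_map \<phi>' y)"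
proof -
  obtain S where S: "S \<in> subd CARD('n)" "\<Union>S \<in> A" "\<Union>S \<in> B" "C = closed_simplex S" "finite S" "S \<noteq> {}"
    using cells_common[of C A B] C A B by blast
  have x': "x \<in> closed_simplex S" and y': "y \<in> closed_simplex S" using x y S(4) by auto
  obtain b s r where f: "frame b s r" "S \<subseteq> flag_simplex A \<phi> b s r" using cell_frame[OF A \<phi> S(1,2)] .
  obtain b' s' r' where f': "frame b' s' r'" "S \<subseteq> flag_simplex B \<phi>' b' s' r'" using cell_frame[OF B \<phi>' S(1,3)] .
  show ?thesis
    using N chart_map_norms[OF \<phi> f x' y'] chart_map_norms[OF \<phi>' f' x' y'] by auto
qed

section \<open>The length metric of a building\<close>

sublocale flat_atlas charts
proof
  fix X f assume "(X, f) \<in> charts"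
  then obtain A \<phi> where A: "A \<in> \<A>" "typed_iso A \<phi>" "X = cells CARD('n) A" "f = chart_map \<phi>" by (auto simp: charts_def)
  show "bij_betw f (\<Union>X) UNIV" unfolding A(3,4) by (rule chart_bij[OF A(1,2)])
  show "closed (f ` S)" if "S \<in> X" for S using cell_image_closed[OF A(1,2)] that A(3,4) by simp
  show "\<exists>F\<subseteq>X. finite F \<and> R \<subseteq> (\<Union>S\<in>F. f ` S)" if "bounded R" for R
    unfolding A(3,4) by (rule chart_locally_finite[OF A(1,2) that])
  show "\<exists>C\<in>X. x \<in> C \<and> (\<forall>u v. (\<forall>c\<in>C. norm (u - f c) = norm (v - f c)) \<longrightarrow> u = v)" if "x \<in> \<Union>X" for x
    using chart_chamber[OF A(1,2)] that unfolding A(3,4) .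
  fix Y g assume "(Y, g) \<in> charts"
  then obtain B \<psi> where B: "B \<in> \<A>" "typed_iso B \<psi>" "Y = cells CARD('n) B" "g = chart_map \<psi>" by (auto simp: charts_def)
  show "\<exists>Z h. (Z, h) \<in> charts \<and> S \<in> Z \<and> T \<in> Z" if S: "S \<in> X" and T: "T \<in> Y" for S T
  proof -
    obtain P where P: "P \<in> subd CARD('n)" "\<Union>P \<in> A" "S = closed_simplex P" using S by (auto simp: A(3) cells_def)
    obtain Q where Q: "Q \<in> subd CARD('n)" "\<Union>Q \<in> B" "T = closed_simplex Q" using T by (auto simp: B(3) cells_def)
    have "\<Union>P \<in> K" "\<Union>Q \<in> K" using apartment_simplices P(2) Q(2) A(1) B(1) by blast+
    then obtain E where E: "E \<in> \<A>" "\<Union>P \<in> E" "\<Union>Q \<in> E" using two_simplices by blast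
    obtain \<theta> where \<theta>: "typed_iso E \<theta>" using apartment[OF E(1)] by (auto simp: typed_iso_def)
    have "(cells CARD('n) E, chart_map \<theta>) \<in> charts" using E(1) \<theta> by (auto simp: charts_def)
    moreover have "S \<in> cells CARD('n) E" "T \<in> cells CARD('n) E" using P Q E by (auto simp: cells_def)
    ultimately show ?thesis by blast
  qed
  show "\<exists>S\<in>X \<inter> Y. x \<in> S" if "x \<in> \<Union>X" "x \<in> \<Union>Y" for x
    using chart_common_cell[OF A(1) B(1)] that unfolding A(3) B(3) .
  show "\<exists>h. (Y, h) \<in> charts \<and> (\<forall>x\<in>S \<union> T. h x = f x)"
    if ST: "S \<in> X \<inter> Y" "T \<in> X \<inter> Y" for S T
  proof -
    show ?thesis
    proof (rule chart_agree[OF A(1,2) B(1) ST[unfolded A(3) B(3)]])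
      fix \<theta> assume \<theta>: "typed_iso B \<theta>" "\<And>x. x \<in> S \<union> T \<Longrightarrow> chart_map \<theta> x = chart_map \<phi> x"
      have "(Y, chart_map \<theta>) \<in> charts" unfolding charts_def B(3) using B(1) \<theta>(1) by blast
      then show ?thesis unfolding A(4) using \<theta>(2) by (intro exI[of _ "chart_map \<theta>"] conjI ballI)
    qed
  qed
  show "N (f x - f y) = N (g x - g y)" if "S \<in> X \<inter> Y" "x \<in> S" "y \<in> S" "N \<in> both_norms" for S x y N
    unfolding A(4) B(4) by (rule chart_isometry[OF A(1,2) B(1,2) that[unfolded A(3) B(3)]])
qed

lemma pts_realization: "pts = realization (subd CARD('n))"
proof (intro equalityI subsetI)
  fix x assume "x \<in> pts"
  then show "x \<in> realization (subd CARD('n))"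
    unfolding pts_def by (auto simp: charts_def cells_def realization_def)
next
  fix x assume "x \<in> realization (subd CARD('n))"
  then obtain S where S: "S \<in> subd CARD('n)" "x \<in> closed_simplex S" by (auto simp: realization_def)
  then have "\<Union>S \<in> K" by (simp add: subdivision_def)
  then obtain A where A: "A \<in> \<A>" "\<Union>S \<in> A" using cover by blast
  obtain \<phi> where "typed_iso A \<phi>" using apartment[OF A(1)] by (auto simp: typed_iso_def)
  then have "(cells CARD('n) A, chart_map \<phi>) \<in> charts" using A by (auto simp: charts_def)
  moreover have "x \<in> \<Union>(cells CARD('n) A)" using S A by (auto simp: cells_def)
  ultimately show "x \<in> pts" by (rule ptsI)
qed

lemma cell_dist:
  assumes S: "S \<in> subd CARD('n)" and x: "x \<in> closed_simplex S" and y: "y \<in> closed_simplex S"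
  shows "simplex_dist (stype CARD('n)) S x y = dst infnorm x y"
proof -
  have "\<Union>S \<in> K" using S by (simp add: subdivision_def)
  then obtain A where A: "A \<in> \<A>" "\<Union>S \<in> A" using cover by blast
  obtain \<phi> where \<phi>: "typed_iso A \<phi>" using apartment[OF A(1)] by (auto simp: typed_iso_def)
  then have ch: "(cells CARD('n) A, chart_map \<phi>) \<in> charts" using A by (auto simp: charts_def)
  have "x \<in> \<Union>(cells CARD('n) A)" "y \<in> \<Union>(cells CARD('n) A)" using S A x y by (auto simp: cells_def)
  then have "dst infnorm x y = infnorm (chart_map \<phi> x - chart_map \<phi> y)" by (intro dst_chart[OF ch]) auto
  then show ?thesis using simplex_dist_chart[OF A(1) \<phi> S A(2) x y] by simp
qed

text \<open>The length of a polygonal path is the sum of chart distances of its pieces.\<close>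

lemma polygonal_path_dst:
  assumes "polygonal_path (subd CARD('n)) (stype CARD('n)) x z l"
  shows "x \<in> pts \<and> z \<in> pts \<and> dst infnorm x z \<le> l"
  using assms
proof induction
  case (refl x)
  then show ?case using dst_refl[of infnorm x] pts_realization by simp
next
  case (step S x y z l)
  have x: "x \<in> pts" using step.hyps(1,2) unfolding pts_realization realization_def by blast
  have "dst infnorm x z \<le> dst infnorm x y + dst infnorm y z"
    using step.IH x by (intro dst_triangle) auto
  then show ?case using x step.IH cell_dist[OF step.hyps(1-3)] by simp
qed

text \<open>The affine segment in a common chart is a polygonal path that realises the distance.\<close>

lemma linf_metric_dst:
  assumes x: "x \<in> pts" and y: "y \<in> pts"
  shows "linf_metric (subd CARD('n)) (stype CARD('n)) x y = dst infnorm x y"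
proof -
  let ?Q = "polygonal_path (subd CARD('n)) (stype CARD('n))"
  obtain X f where ch: "(X, f) \<in> charts" and xy: "x \<in> \<Union>X" "y \<in> \<Union>X" using two_point_chart[OF x y] .
  have I: "infnorm \<in> both_norms" by simp
  have "?Q x y (infnorm (f y - f x))"
  proof (rule polygonal_chain[OF ch I xy])
    fix C p q assume C: "C \<in> X" "p \<in> C" "q \<in> C"
    obtain S where S: "S \<in> subd CARD('n)" "C = closed_simplex S" using ch C(1) by (auto simp: charts_def cells_def)
    have q: "q \<in> realization (subd CARD('n))" using S C(3) by (auto simp: realization_def)
    have "?Q p q (simplex_dist (stype CARD('n)) S p q + 0)"
      using S C(2,3) by (intro polygonal_path.step[OF S(1) _ _ polygonal_path.refl[OF q]]) auto
    moreover have "simplex_dist (stype CARD('n)) S p q = infnorm (f q - f p)"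
      using cell_dist[OF S(1), of p q] C dst_chart[OF ch I, of p q] S(2) infnorm_sub[of "f p" "f q"] by auto
    ultimately show "?Q p q (infnorm (f q - f p))" by simp
  qed (rule polygonal_path_trans)
  moreover have "infnorm (f y - f x) = dst infnorm x y"
    using dst_chart[OF ch I xy] infnorm_sub[of "f x" "f y"] by simp
  ultimately have "?Q x y (dst infnorm x y)" by simp
  then have "Inf {l. ?Q x y l} = dst infnorm x y"
    by (intro cInf_eq_minimum) (auto dest: polygonal_path_dst)
  then show ?thesis using x y by (simp add: linf_metric_def pts_realization)
qed

lemma building_CUB: "CUB (realization (subd CARD('n))) (linf_metric (subd CARD('n)) (stype CARD('n)))"
proof -
  have "CUB pts (linf_metric (subd CARD('n)) (stype CARD('n)))"
    by (rule CUB_pts) (auto simp: linf_metric_dst, auto simp: linf_metric_def pts_realization)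
  then show ?thesis by (simp add: pts_realization)
qed

end

theorem theorem9p3:
  fixes ty :: affine_type and K :: "'v set set" and \<tau> :: "'v \<Rightarrow> nat"
  assumes "euclidean_building ty TYPE('n::finite) K \<tau>"
  shows "CUB (realization (subdivision ty CARD('n) K \<tau>))
             (linf_metric (subdivision ty CARD('n) K \<tau>) (subdivision_type ty CARD('n) \<tau>))"
proof -
  obtain \<A> where \<A>: "\<Union>\<A> = K"
    "\<forall>A\<in>\<A>. \<exists>\<phi>. simplicial_iso \<phi> A (coxeter_complex ty :: (real^'n) set set) \<and>
       (\<forall>v\<in>\<Union>A. \<tau> v = coxeter_type ty (\<phi> v))"
    "\<forall>S\<in>K. \<forall>T\<in>K. \<exists>A\<in>\<A>. S \<in> A \<and> T \<in> A"
    "\<forall>A\<in>\<A>. \<forall>A'\<in>\<A>. \<forall>S \<in> A \<inter> A'. \<forall>T \<in> A \<inter> A'.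
       \<exists>\<psi>. simplicial_iso \<psi> A A' \<and> (\<forall>v \<in> S \<union> T. \<psi> v = v)"
    using assms unfolding euclidean_building_def by (elim conjE exE)
  have "typed_building TYPE('n) ty K \<tau> \<A>"
  proof
    show "admissible_rank ty CARD('n)" "K \<noteq> {}" using assms by (simp_all add: euclidean_building_def)
    show "\<Union>\<A> = K" by (rule \<A>(1))
    show "\<exists>\<phi>. simplicial_iso \<phi> A (coxeter_complex ty :: (real^'n) set set) \<and>
       (\<forall>v\<in>\<Union>A. \<tau> v = coxeter_type ty (\<phi> v))" if "A \<in> \<A>" for A
      using \<A>(2) that by (rule bspec)
    show "\<exists>A\<in>\<A>. S \<in> A \<and> T \<in> A" if "S \<in> K" "T \<in> K" for S T
      by (rule \<A>(3)[THEN bspec, THEN bspec, OF that])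
    show "\<exists>\<psi>. simplicial_iso \<psi> A A' \<and> (\<forall>v \<in> S \<union> T. \<psi> v = v)"
      if "A \<in> \<A>" "A' \<in> \<A>" "S \<in> A \<inter> A'" "T \<in> A \<inter> A'" for A A' S T
      by (rule \<A>(4)[THEN bspec, THEN bspec, THEN bspec, THEN bspec, OF that])
  qed
  then show ?thesis by (rule typed_building.building_CUB)
qed

end
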